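(* Let $\Omega\subset\mathbb{R}^d$ be a bounded Lipschitz domain and $s\in(0,1)$. Let $V$ be the space of continuous piecewise linear finite elements (vanishing on $\partial\Omega$) over a graded bisection grid $\mathcal T=\mathcal T_J\in\mathbb{T}(\mathcal T_0)$, and consider the space decomposition $V=\sum_{p\in\mathcal P}V_p+\sum_{j=0}^J V_j$. Then the BPX preconditioner $$B=\sum_{p\in\mathcal P}I_p\,h_p^{2s}\,Q_p+(1-\widetilde\gamma^{\,s})\sum_{j=0}^J I_j\,h_j^{2s}\,Q_j$$ is spectrally equivalent to $$\widehat B=\gamma^{2s\bar J}\sum_{p\in\mathcal P}I_pQ_p+(1-\gamma^{2s})\sum_{k=0}^{\bar J}\gamma^{2sk}\Big(\sum_{p\in\mathcal P_{k+k_*}}I_pQ_p+\sum_{j\in\mathcal I_{k+k_*}}I_jQ_j\Big),$$ i.e. $(Bv,v)\simeq(\widehat Bv,v)$ for all $v\in V$ with equivalence constants independent of $s$ and $J$; whence $\lambda_{\min}(BA)\gtrsim c_0^{-1}$. Therefore $$\mathrm{cond}(BA)\lesssim c_0c_1 .$$ Here $c_0,c_1$ are constants independent of $s$ and $J$, namely: $c_0$ is the constant such that every $v\in V$ can be written as $v=\sum_{p\in\mathcal P}v_p+\sum_{k=0}^{\bar J}\big(\sum_{q\in\mathcal P_{k+k_*}}v_{q,k}+\sum_{j\in\mathcal I_{k+k_*}}v_{j,k}\big)$ with $v_p\in V_p$, $v_{q,k}\in V_q$, $v_{j,k}\in V_j$ and $$\gamma^{-2s\bar J}\sum_{p\in\mathcal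 P}\|v_p\|_0^2+\sum_{k=0}^{\bar J}\frac{\gamma^{-2sk}}{1-\gamma^{2s}}\Big(\sum_{p\in\mathcal P_{k+k_*}}\|v_{p,k}\|_0^2+\sum_{j\in\mathcal I_{k+k_*}}\|v_{j,k}\|_0^2\Big)\le c_0|v|_s^2,$$ and $c_1$ is the constant such that $|v|_s^2\le c_1\big(\sum_{p\in\mathcal P}h_p^{-2s}\|v_p\|_0^2+\frac1{1-\widetilde\gamma^s}\sum_{j=0}^Jh_j^{-2s}\|v_j\|_0^2\big)$ for every decomposition $v=\sum_{p\in\mathcal P}v_p+\sum_{j=0}^Jv_j$ with $v_p\in V_p$, $v_j\in V_j$.
   Context: Function spaces. $(\cdot,\cdot)$, $\|\cdot\|_0$: inner product and norm of $L^2(\Omega)$. For functions extended by zero outside $\Omega$, $a(u,v)=(u,v)_s:=\frac{C(d,s)}2\iint_{\mathbb R^d\times\mathbb R^d}\frac{(u(x)-u(y))(v(x)-v(y))}{|x-y|^{d+2s}}dx\,dy$, with $C(d,s)=\frac{2^{2s}s\Gamma(s+d/2)}{\pi^{d/2}\Gamma(1-s)}$, and $|v|_s^2:=(v,v)_s$. $A:V\to V$ is given by $(Au,v)=a(u,v)$ for all $u,v\in V$. Bisection. In a labeled triangulation every simplex $\tau$ carries a refinement edge $e$; bisection $b_\tau$ replaces $\tau$ by the two children obtained by joining the midpoint of $e$ to the vertices of $\tau$ not on $e$, the children being assigned refinement edges by the bisection rule. $\mathcal T_0$ is a conforming labeled initial triangulation of $\Omega$ with elements of size $\simeq 1$, and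 $\mathbb T(\mathcal T_0)$ is the set of conforming triangulations obtained from $\mathcal T_0$ by finitely many bisections. Standing assumptions: $\mathbb T(\mathcal T_0)$ is shape regular, and all uniform refinements $\overline{\mathcal T}_k:=\overline{\mathcal T}_{k-1}+\{b_\tau:\tau\in\overline{\mathcal T}_{k-1}\}$, $\overline{\mathcal T}_0=\mathcal T_0$, are conforming. An edge $e$ is compatible if it is the refinement edge of all elements containing it; the compatible bisection $b_e$ bisects all these elements simultaneously. Every $\mathcal T\in\mathbb T(\mathcal T_0)$ can be written $\mathcal T=\mathcal T_0+(b_1,\dots,b_J)$ with compatible bisections $b_j$; fix such a sequence and set $\mathcal T_j=\mathcal T_0+(b_1,\dots,b_j)$, so $\mathcal T=\mathcal T_J$. The generation $g(\tau)$ is $0$ for $\tau\in\mathcal T_0$ and $1$ plus that of the father otherwise. For $b_j$, let $e_j$ be its refinement edge, $p_j$ the midpoint of $e_j$, $p_j^\pm$ the endpoints of $e_j$, $T_j=\{p_j,p_j^+,p_j^-\}$ (bisection triplet), $\omega_j$ the union of the elements of $\mathcal T_j$ containing $p_j$ (they all have the same generation, denoted $g_j$), $h_j\simeq\gamma^{g_j}$ the local mesh size of $\omega_j$, $\gamma=(1/2)^{1/d}$. $k_*$ is a fixed integer, depending only on the shape regularity of $\mathbb T(\mathcal T_0)$, such that for every $j$ and every vertex $p$ of $\mathcal T_j$ the generations of elements of $\mathcal T_j$ containing $p$ differ by at most $k_*$ and there are at most $k_*$ such elements. $\bar J=\max_{\tau\in\mathcal T_J}g(\tau)$. Spaces. $\mathbb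 V(\mathcal T_j)$: continuous piecewise linear functions over $\mathcal T_j$ vanishing on $\partial\Omega$, with nodal basis $\{\phi_{j,p}\}_{p\in\mathcal N_j}$, $\mathcal N_j$ the interior vertices of $\mathcal T_j$. $V_j=\mathrm{span}\{\phi_{j,q}:q\in T_j\cap\mathcal N_j\}$ for $1\le j\le J$; $V_0=\mathbb V(\mathcal T_0)$ with $g_0=0$, $h_0\simeq1$. $V=\mathbb V(\mathcal T_J)$, $\mathcal P=\mathcal N_J$, with nodal basis $\phi_p$; $V_p=\mathrm{span}\{\phi_p\}$; $\ell(p)$ (level of $p$) is the maximal generation of elements of $\mathcal T_J$ containing $p$; $h_p\simeq\gamma^{\ell(p)}$ is the local mesh size at $p$. $\mathcal P_{m}=\{q\in\mathcal P:\ell(q)\le m\}$, $\mathcal I_{k+k_*}=\{0\le i\le J: k-k_*\le g_i\le k+k_*\}$. $Q_p,Q_j$ are the $L^2$-projections of $V$ onto $V_p,V_j$; $I_p,I_j$ the inclusions into $V$. $\widetilde\gamma\in(0,1)$ is a fixed constant. $\mathrm{cond}(BA)=\lambda_{\max}(BA)/\lambda_{\min}(BA)$. Hidden constants in $\lesssim,\gtrsim,\simeq$ are independent of $s$ and $J$. *)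

theory Defs
  imports "HOL-Analysis.Analysis"
begin

section \<open>Lipschitz domains\<close>

text \<open>Near each boundary point, after choosing a unit direction \<open>n\<close>, the domain is the set of
  points lying strictly above the graph of a Lipschitz function of the components orthogonal
  to \<open>n\<close>.\<close>

definition bounded_lipschitz_domain :: "'a::euclidean_space set \<Rightarrow> bool" where
  "bounded_lipschitz_domain \<Omega> \<longleftrightarrow>
     open \<Omega> \<and> connected \<Omega> \<and> \<Omega> \<noteq> {} \<and> bounded \<Omega> \<and>
     (\<forall>x \<in> frontier \<Omega>. \<exists>r>0. \<exists>n. norm n = 1 \<and>
        (\<exists>\<psi> :: 'a \<Rightarrow> real. \<exists>L. L-lipschitz_on {z. z \<bullet> n = 0} \<psi> \<and>
          \<Omega> \<inter> ball x r = {y \<in> ball x r. \<psi> (y - (y \<bullet> n) *\<^sub>R n) < y \<bullet> n}))"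


section \<open>Labeled simplices and bisection\<close>

text \<open>A simplex is given by its vertex set. Besides its refinement edge (a pair of vertices) it
  carries its generation and a tag, which is whatever further information a bisection rule needs
  (e.g. the type of a simplex in dimension at least three).\<close>

datatype ('a, 't) lsimplex =
  LSimplex (verts: "'a set") (ref_edge: "'a set") (gen: nat) (tag: 't)

definition labeled_simplex :: "('a::euclidean_space, 't) lsimplex \<Rightarrow> bool" where
  "labeled_simplex \<tau> \<longleftrightarrow>
     \<not> affine_dependent (verts \<tau>) \<and> card (verts \<tau>) = DIM('a) + 1 \<and>
     ref_edge \<tau> \<subseteq> verts \<tau> \<and> card (ref_edge \<tau>) = 2"

definition elem :: "('a::euclidean_space, 't) lsimplex \<Rightarrow> 'a set" where
  "elem \<tau> = convex hull (verts \<tau>)"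

definition edge_mid :: "'a::euclidean_space set \<Rightarrow> 'a" where
  "edge_mid e = (\<Sum>x\<in>e. x) /\<^sub>R 2"

text \<open>The bisection of \<open>\<tau>\<close> has one child for each endpoint \<open>p\<close> of the refinement edge, obtained by
  replacing the vertex \<open>p\<close> by the midpoint of that edge. The rule assigns to the child its
  refinement edge and its tag.\<close>

type_synonym ('a, 't) bisection_rule = "('a, 't) lsimplex \<Rightarrow> 'a \<Rightarrow> 'a set \<times> 't"

definition child ::
  "('a::euclidean_space, 't) bisection_rule \<Rightarrow> ('a, 't) lsimplex \<Rightarrow> 'a \<Rightarrow> ('a, 't) lsimplex" where
  "child \<rho> \<tau> p =
     LSimplex (insert (edge_mid (ref_edge \<tau>)) (verts \<tau> - {p}))
       (fst (\<rho> \<tau> p)) (Suc (gen \<tau>)) (snd (\<rho> \<tau> p))"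

definition bisect ::
  "('a::euclidean_space, 't) bisection_rule \<Rightarrow> ('a, 't) lsimplex \<Rightarrow> ('a, 't) lsimplex set" where
  "bisect \<rho> \<tau> = child \<rho> \<tau> ` ref_edge \<tau>"

definition admissible_rule :: "('a::euclidean_space, 't) bisection_rule \<Rightarrow> bool" where
  "admissible_rule \<rho> \<longleftrightarrow>
     (\<forall>\<tau> p. labeled_simplex \<tau> \<and> p \<in> ref_edge \<tau> \<longrightarrow>
        ref_edge (child \<rho> \<tau> p) \<subseteq> verts (child \<rho> \<tau> p) \<and> card (ref_edge (child \<rho> \<tau> p)) = 2)"


section \<open>Triangulations\<close>

text \<open>Conformity is contained in the library's \<^const>\<open>triangulation\<close>: the intersection of any two
  elements is a face of both.\<close>

definition conforming ::
  "'a::euclidean_space set \<Rightarrow> ('a, 't) lsimplex set \<Rightarrow> bool" where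
  "conforming \<Omega> \<T> \<longleftrightarrow>
     finite \<T> \<and> (\<forall>\<tau>\<in>\<T>. labeled_simplex \<tau>) \<and> inj_on verts \<T> \<and>
     triangulation (elem ` \<T>) \<and> (\<Union>\<tau>\<in>\<T>. elem \<tau>) = closure \<Omega>"

definition refine ::
  "('a::euclidean_space, 't) bisection_rule \<Rightarrow> ('a, 't) lsimplex set \<Rightarrow> ('a, 't) lsimplex set
     \<Rightarrow> ('a, 't) lsimplex set" where
  "refine \<rho> \<T> S = (\<T> - S) \<union> (\<Union>\<tau>\<in>S. bisect \<rho> \<tau>)"

primrec uniform_refinement ::
  "('a::euclidean_space, 't) bisection_rule \<Rightarrow> ('a, 't) lsimplex set \<Rightarrow> nat
     \<Rightarrow> ('a, 't) lsimplex set" where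
  "uniform_refinement \<rho> \<T>\<^sub>0 0 = \<T>\<^sub>0"
| "uniform_refinement \<rho> \<T>\<^sub>0 (Suc k) =
     refine \<rho> (uniform_refinement \<rho> \<T>\<^sub>0 k) (uniform_refinement \<rho> \<T>\<^sub>0 k)"

text \<open>All grids, conforming or not, obtained by finitely many bisections.\<close>

inductive_set bisection_grids ::
  "('a::euclidean_space, 't) bisection_rule \<Rightarrow> ('a, 't) lsimplex set
     \<Rightarrow> ('a, 't) lsimplex set set"
  for \<rho> \<T>\<^sub>0 where
  initial: "\<T>\<^sub>0 \<in> bisection_grids \<rho> \<T>\<^sub>0"
| bisect: "\<T> \<in> bisection_grids \<rho> \<T>\<^sub>0 \<Longrightarrow> \<tau> \<in> \<T> \<Longrightarrow> refine \<rho> \<T> {\<tau>} \<in> bisection_grids \<rho> \<T>\<^sub>0"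

definition conforming_grids ::
  "'a::euclidean_space set \<Rightarrow> ('a, 't) bisection_rule \<Rightarrow> ('a, 't) lsimplex set
     \<Rightarrow> ('a, 't) lsimplex set set" where
  "conforming_grids \<Omega> \<rho> \<T>\<^sub>0 = {\<T> \<in> bisection_grids \<rho> \<T>\<^sub>0. conforming \<Omega> \<T>}"

definition shape_regular :: "('a::euclidean_space, 't) lsimplex set set \<Rightarrow> bool" where
  "shape_regular F \<longleftrightarrow>
     (\<exists>\<sigma>. \<forall>\<T>\<in>F. \<forall>\<tau>\<in>\<T>. diameter (elem \<tau>) ^ DIM('a) \<le> \<sigma> * measure lborel (elem \<tau>))"

definition compatible_edge :: "('a::euclidean_space, 't) lsimplex set \<Rightarrow> 'a set \<Rightarrow> bool" where
  "compatible_edge \<T> e \<longleftrightarrow>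
     (\<exists>\<tau>\<in>\<T>. e \<subseteq> verts \<tau>) \<and> (\<forall>\<tau>\<in>\<T>. e \<subseteq> verts \<tau> \<longrightarrow> ref_edge \<tau> = e)"

definition compatible_bisection ::
  "('a::euclidean_space, 't) bisection_rule \<Rightarrow> ('a, 't) lsimplex set \<Rightarrow> 'a set
     \<Rightarrow> ('a, 't) lsimplex set" where
  "compatible_bisection \<rho> \<T> e = refine \<rho> \<T> {\<tau>\<in>\<T>. e \<subseteq> verts \<tau>}"

text \<open>The grids \<open>\<T>\<^sub>j = \<T>\<^sub>0 + (b\<^sub>1, \<dots>, b\<^sub>j)\<close>, where \<open>b\<^sub>i\<close> bisects the edge \<open>e i\<close>; the value \<open>e 0\<close> is
  irrelevant.\<close>

primrec grid_seq ::
  "('a::euclidean_space, 't) bisection_rule \<Rightarrow> ('a, 't) lsimplex set \<Rightarrow> (nat \<Rightarrow> 'a set) \<Rightarrow> nat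
     \<Rightarrow> ('a, 't) lsimplex set" where
  "grid_seq \<rho> \<T>\<^sub>0 e 0 = \<T>\<^sub>0"
| "grid_seq \<rho> \<T>\<^sub>0 e (Suc j) = compatible_bisection \<rho> (grid_seq \<rho> \<T>\<^sub>0 e j) (e (Suc j))"

definition compatible_sequence ::
  "('a::euclidean_space, 't) bisection_rule \<Rightarrow> ('a, 't) lsimplex set \<Rightarrow> (nat \<Rightarrow> 'a set) \<Rightarrow> nat
     \<Rightarrow> bool" where
  "compatible_sequence \<rho> \<T>\<^sub>0 e J \<longleftrightarrow>
     (\<forall>j<J. compatible_edge (grid_seq \<rho> \<T>\<^sub>0 e j) (e (Suc j)))"

text \<open>\<open>k\<^sub>*\<close> bounds the variation of generations around any vertex and the valence of any vertex.\<close>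

definition local_quasi_uniformity ::
  "('a::euclidean_space, 't) lsimplex set set \<Rightarrow> nat \<Rightarrow> bool" where
  "local_quasi_uniformity F kst \<longleftrightarrow>
     (\<forall>\<T>\<in>F. \<forall>p \<in> (\<Union>\<tau>\<in>\<T>. verts \<tau>).
        (\<forall>\<tau>\<in>\<T>. \<forall>\<tau>'\<in>\<T>. p \<in> verts \<tau> \<and> p \<in> verts \<tau>' \<longrightarrow> gen \<tau> \<le> gen \<tau>' + kst) \<and>
        card {\<tau>\<in>\<T>. p \<in> verts \<tau>} \<le> kst)"


section \<open>Finite element spaces\<close>

text \<open>Finite element functions are extended by zero outside \<open>\<Omega>\<close>.\<close>

definition fe_space ::
  "'a::euclidean_space set \<Rightarrow> ('a, 't) lsimplex set \<Rightarrow> ('a \<Rightarrow> real) set" where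
  "fe_space \<Omega> \<T> =
     {v. continuous_on (closure \<Omega>) v \<and> (\<forall>x. x \<notin> \<Omega> \<longrightarrow> v x = 0) \<and>
         (\<forall>\<tau>\<in>\<T>. \<exists>b c. \<forall>x \<in> elem \<tau>. v x = b \<bullet> x + c)}"

definition nodes :: "'a::euclidean_space set \<Rightarrow> ('a, 't) lsimplex set \<Rightarrow> 'a set" where
  "nodes \<Omega> \<T> = (\<Union>\<tau>\<in>\<T>. verts \<tau>) \<inter> \<Omega>"

definition nodal_basis ::
  "'a::euclidean_space set \<Rightarrow> ('a, 't) lsimplex set \<Rightarrow> 'a \<Rightarrow> 'a \<Rightarrow> real" where
  "nodal_basis \<Omega> \<T> p =
     (THE \<phi>. \<phi> \<in> fe_space \<Omega> \<T> \<and> \<phi> p = 1 \<and> (\<forall>q \<in> nodes \<Omega> \<T>. q \<noteq> p \<longrightarrow> \<phi> q = 0))"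

text \<open>The span of a finite set of functions (there is no vector space class instance for
  functions).\<close>

definition fun_span :: "('a \<Rightarrow> real) set \<Rightarrow> ('a \<Rightarrow> real) set" where
  "fun_span F = {\<lambda>x. \<Sum>f\<in>F. c f * f x | c. True}"

definition node_space ::
  "'a::euclidean_space set \<Rightarrow> ('a, 't) lsimplex set \<Rightarrow> 'a \<Rightarrow> ('a \<Rightarrow> real) set" where
  "node_space \<Omega> \<T> p = fun_span {nodal_basis \<Omega> \<T> p}"

text \<open>In what follows \<open>M j\<close> is the grid \<open>\<T>\<^sub>j\<close> and \<open>e j\<close> the edge bisected by \<open>b\<^sub>j\<close>.\<close>

definition triplet :: "'a::euclidean_space set \<Rightarrow> 'a set" where
  "triplet e = insert (edge_mid e) e"

definition patch_space ::
  "'a::euclidean_space set \<Rightarrow> (nat \<Rightarrow> ('a, 't) lsimplex set) \<Rightarrow> (nat \<Rightarrow> 'a set) \<Rightarrow> nat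
     \<Rightarrow> ('a \<Rightarrow> real) set" where
  "patch_space \<Omega> M e j =
     (if j = 0 then fe_space \<Omega> (M 0)
      else fun_span (nodal_basis \<Omega> (M j) ` (triplet (e j) \<inter> nodes \<Omega> (M j))))"

definition patch_gen ::
  "(nat \<Rightarrow> ('a::euclidean_space, 't) lsimplex set) \<Rightarrow> (nat \<Rightarrow> 'a set) \<Rightarrow> nat \<Rightarrow> nat" where
  "patch_gen M e j =
     (if j = 0 then 0
      else (THE g. \<forall>\<tau> \<in> M j. edge_mid (e j) \<in> elem \<tau> \<longrightarrow> gen \<tau> = g))"

definition max_gen :: "('a, 't) lsimplex set \<Rightarrow> nat" where
  "max_gen \<T> = Max (gen ` \<T>)"

definition level :: "('a, 't) lsimplex set \<Rightarrow> 'a \<Rightarrow> nat" where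
  "level \<T> p = Max (gen ` {\<tau>\<in>\<T>. p \<in> verts \<tau>})"

definition nodes_upto ::
  "'a::euclidean_space set \<Rightarrow> ('a, 't) lsimplex set \<Rightarrow> nat \<Rightarrow> 'a set" where
  "nodes_upto \<Omega> \<T> m = {q \<in> nodes \<Omega> \<T>. level \<T> q \<le> m}"

definition patches_near ::
  "(nat \<Rightarrow> ('a::euclidean_space, 't) lsimplex set) \<Rightarrow> (nat \<Rightarrow> 'a set) \<Rightarrow> nat \<Rightarrow> nat \<Rightarrow> nat
     \<Rightarrow> nat set" where
  "patches_near M e J kst k =
     {i. i \<le> J \<and> int k - int kst \<le> int (patch_gen M e i) \<and> patch_gen M e i \<le> k + kst}"


section \<open>Forms and operators\<close>

definition l2_inner ::
  "'a::euclidean_space set \<Rightarrow> ('a \<Rightarrow> real) \<Rightarrow> ('a \<Rightarrow> real) \<Rightarrow> real" where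
  "l2_inner \<Omega> u v = (LINT x:\<Omega>|lborel. u x * v x)"

definition l2_norm :: "'a::euclidean_space set \<Rightarrow> ('a \<Rightarrow> real) \<Rightarrow> real" where
  "l2_norm \<Omega> v = sqrt (l2_inner \<Omega> v v)"

definition frac_const :: "nat \<Rightarrow> real \<Rightarrow> real" where
  "frac_const d s =
     2 powr (2 * s) * s * Gamma (s + real d / 2) / (pi powr (real d / 2) * Gamma (1 - s))"

definition frac_form ::
  "real \<Rightarrow> ('a::euclidean_space \<Rightarrow> real) \<Rightarrow> ('a \<Rightarrow> real) \<Rightarrow> real" where
  "frac_form s u v =
     frac_const DIM('a) s / 2 *
     (LINT (x, y)|(lborel \<Otimes>\<^sub>M lborel).
        (u x - u y) * (v x - v y) / norm (x - y) powr (real DIM('a) + 2 * s))"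

definition frac_norm :: "real \<Rightarrow> ('a::euclidean_space \<Rightarrow> real) \<Rightarrow> real" where
  "frac_norm s v = sqrt (frac_form s v v)"

definition form_operator ::
  "'a::euclidean_space set \<Rightarrow> real \<Rightarrow> ('a \<Rightarrow> real) set \<Rightarrow> ('a \<Rightarrow> real) \<Rightarrow> ('a \<Rightarrow> real)" where
  "form_operator \<Omega> s V u = (THE w. w \<in> V \<and> (\<forall>v\<in>V. l2_inner \<Omega> w v = frac_form s u v))"

definition l2_proj ::
  "'a::euclidean_space set \<Rightarrow> ('a \<Rightarrow> real) set \<Rightarrow> ('a \<Rightarrow> real) \<Rightarrow> ('a \<Rightarrow> real)" where
  "l2_proj \<Omega> W v = (THE w. w \<in> W \<and> (\<forall>z\<in>W. l2_inner \<Omega> w z = l2_inner \<Omega> v z))"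

text \<open>The inclusions \<open>I\<^sub>p\<close> and \<open>I\<^sub>j\<close> are invisible, all spaces being sets of functions on the whole
  space. The functions \<open>hp\<close> and \<open>hj\<close> are the local mesh sizes \<open>h\<^sub>p\<close> and \<open>h\<^sub>j\<close>, and \<open>\<gamma>t\<close> is the constant
  written with a tilde in the literature.\<close>

definition bpx ::
  "'a::euclidean_space set \<Rightarrow> (nat \<Rightarrow> ('a, 't) lsimplex set) \<Rightarrow> (nat \<Rightarrow> 'a set) \<Rightarrow> nat \<Rightarrow> real
     \<Rightarrow> real \<Rightarrow> ('a \<Rightarrow> real) \<Rightarrow> (nat \<Rightarrow> real) \<Rightarrow> ('a \<Rightarrow> real) \<Rightarrow> ('a \<Rightarrow> real)" where
  "bpx \<Omega> M e J s \<gamma>t hp hj v = (\<lambda>x.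
     (\<Sum>p \<in> nodes \<Omega> (M J). hp p powr (2 * s) * l2_proj \<Omega> (node_space \<Omega> (M J) p) v x)
     + (1 - \<gamma>t powr s) *
       (\<Sum>j\<le>J. hj j powr (2 * s) * l2_proj \<Omega> (patch_space \<Omega> M e j) v x))"

definition bpx_hat ::
  "'a::euclidean_space set \<Rightarrow> (nat \<Rightarrow> ('a, 't) lsimplex set) \<Rightarrow> (nat \<Rightarrow> 'a set) \<Rightarrow> nat \<Rightarrow> real
     \<Rightarrow> real \<Rightarrow> nat \<Rightarrow> ('a \<Rightarrow> real) \<Rightarrow> ('a \<Rightarrow> real)" where
  "bpx_hat \<Omega> M e J s \<gamma> kst v = (\<lambda>x.
     \<gamma> powr (2 * s * real (max_gen (M J))) *
       (\<Sum>p \<in> nodes \<Omega> (M J). l2_proj \<Omega> (node_space \<Omega> (M J) p) v x)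
     + (1 - \<gamma> powr (2 * s)) *
       (\<Sum>k\<le>max_gen (M J). \<gamma> powr (2 * s * real k) *
          ((\<Sum>p \<in> nodes_upto \<Omega> (M J) (k + kst). l2_proj \<Omega> (node_space \<Omega> (M J) p) v x)
           + (\<Sum>j \<in> patches_near M e J kst k. l2_proj \<Omega> (patch_space \<Omega> M e j) v x))))"

text \<open>Real eigenvalues of a linear operator on a space \<open>V\<close> of functions. The product \<open>BA\<close> is
  self-adjoint with respect to the fractional form on the finite-dimensional space \<open>V\<close>, so all of
  its eigenvalues are real.\<close>

definition eigenvalues_on ::
  "('a \<Rightarrow> real) set \<Rightarrow> (('a \<Rightarrow> real) \<Rightarrow> ('a \<Rightarrow> real)) \<Rightarrow> real set" where
  "eigenvalues_on V L = {\<mu>. \<exists>v\<in>V. v \<noteq> (\<lambda>x. 0) \<and> L v = (\<lambda>x. \<mu> * v x)}"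

definition lambda_max ::
  "('a \<Rightarrow> real) set \<Rightarrow> (('a \<Rightarrow> real) \<Rightarrow> ('a \<Rightarrow> real)) \<Rightarrow> real" where
  "lambda_max V L = Max (eigenvalues_on V L)"

definition lambda_min ::
  "('a \<Rightarrow> real) set \<Rightarrow> (('a \<Rightarrow> real) \<Rightarrow> ('a \<Rightarrow> real)) \<Rightarrow> real" where
  "lambda_min V L = Min (eigenvalues_on V L)"

definition cond_number ::
  "('a \<Rightarrow> real) set \<Rightarrow> (('a \<Rightarrow> real) \<Rightarrow> ('a \<Rightarrow> real)) \<Rightarrow> real" where
  "cond_number V L = lambda_max V L / lambda_min V L"


section \<open>Decompositions\<close>

text \<open>\<open>v = \<Sum>\<^sub>p v\<^sub>p + \<Sum>\<^sub>j v\<^sub>j\<close> with \<open>v\<^sub>p \<in> V\<^sub>p\<close> and \<open>v\<^sub>j \<in> V\<^sub>j\<close>.\<close>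

definition decomposes ::
  "'a::euclidean_space set \<Rightarrow> (nat \<Rightarrow> ('a, 't) lsimplex set) \<Rightarrow> (nat \<Rightarrow> 'a set) \<Rightarrow> nat
     \<Rightarrow> ('a \<Rightarrow> real) \<Rightarrow> ('a \<Rightarrow> 'a \<Rightarrow> real) \<Rightarrow> (nat \<Rightarrow> 'a \<Rightarrow> real) \<Rightarrow> bool" where
  "decomposes \<Omega> M e J v vp vj \<longleftrightarrow>
     (\<forall>p \<in> nodes \<Omega> (M J). vp p \<in> node_space \<Omega> (M J) p) \<and>
     (\<forall>j\<le>J. vj j \<in> patch_space \<Omega> M e j) \<and>
     v = (\<lambda>x. (\<Sum>p \<in> nodes \<Omega> (M J). vp p x) + (\<Sum>j\<le>J. vj j x))"

text \<open>The constant \<open>c\<^sub>0\<close> of the stable decomposition.\<close>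

definition stable_decomposition ::
  "'a::euclidean_space set \<Rightarrow> (nat \<Rightarrow> ('a, 't) lsimplex set) \<Rightarrow> (nat \<Rightarrow> 'a set) \<Rightarrow> nat \<Rightarrow> real
     \<Rightarrow> real \<Rightarrow> nat \<Rightarrow> real \<Rightarrow> bool" where
  "stable_decomposition \<Omega> M e J s \<gamma> kst c\<^sub>0 \<longleftrightarrow>
     (\<forall>v \<in> fe_space \<Omega> (M J). \<exists>vp vq vj.
        (\<forall>p \<in> nodes \<Omega> (M J). vp p \<in> node_space \<Omega> (M J) p) \<and>
        (\<forall>k \<le> max_gen (M J).
           (\<forall>q \<in> nodes_upto \<Omega> (M J) (k + kst). vq q k \<in> node_space \<Omega> (M J) q) \<and>
           (\<forall>j \<in> patches_near M e J kst k. vj j k \<in> patch_space \<Omega> M e j)) \<and>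
        v = (\<lambda>x. (\<Sum>p \<in> nodes \<Omega> (M J). vp p x)
               + (\<Sum>k\<le>max_gen (M J). (\<Sum>q \<in> nodes_upto \<Omega> (M J) (k + kst). vq q k x)
                                       + (\<Sum>j \<in> patches_near M e J kst k. vj j k x))) \<and>
        \<gamma> powr (- 2 * s * real (max_gen (M J))) *
            (\<Sum>p \<in> nodes \<Omega> (M J). (l2_norm \<Omega> (vp p))\<^sup>2)
        + (\<Sum>k\<le>max_gen (M J). \<gamma> powr (- 2 * s * real k) / (1 - \<gamma> powr (2 * s)) *
             ((\<Sum>q \<in> nodes_upto \<Omega> (M J) (k + kst). (l2_norm \<Omega> (vq q k))\<^sup>2)
              + (\<Sum>j \<in> patches_near M e J kst k. (l2_norm \<Omega> (vj j k))\<^sup>2)))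
        \<le> c\<^sub>0 * (frac_norm s v)\<^sup>2)"

text \<open>The constant \<open>c\<^sub>1\<close> of the boundedness estimate.\<close>

definition bounded_decompositions ::
  "'a::euclidean_space set \<Rightarrow> (nat \<Rightarrow> ('a, 't) lsimplex set) \<Rightarrow> (nat \<Rightarrow> 'a set) \<Rightarrow> nat \<Rightarrow> real
     \<Rightarrow> real \<Rightarrow> ('a \<Rightarrow> real) \<Rightarrow> (nat \<Rightarrow> real) \<Rightarrow> real \<Rightarrow> bool" where
  "bounded_decompositions \<Omega> M e J s \<gamma>t hp hj c\<^sub>1 \<longleftrightarrow>
     (\<forall>v vp vj. decomposes \<Omega> M e J v vp vj \<longrightarrow>
        (frac_norm s v)\<^sup>2 \<le> c\<^sub>1 *
          ((\<Sum>p \<in> nodes \<Omega> (M J). hp p powr (- 2 * s) * (l2_norm \<Omega> (vp p))\<^sup>2)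
           + 1 / (1 - \<gamma>t powr s) *
             (\<Sum>j\<le>J. hj j powr (- 2 * s) * (l2_norm \<Omega> (vj j))\<^sup>2)))"

text \<open>\<open>h\<^sub>p \<simeq> \<gamma>\<^bsup>\<ell>(p)\<^esup>\<close> and \<open>h\<^sub>j \<simeq> \<gamma>\<^bsup>g\<^sub>j\<^esup>\<close> with equivalence constants \<open>m1\<close> and \<open>m2\<close>; for \<open>j = 0\<close> this is
  \<open>h\<^sub>0 \<simeq> 1\<close>.\<close>

definition local_mesh_sizes ::
  "'a::euclidean_space set \<Rightarrow> (nat \<Rightarrow> ('a, 't) lsimplex set) \<Rightarrow> (nat \<Rightarrow> 'a set) \<Rightarrow> nat \<Rightarrow> real
     \<Rightarrow> real \<Rightarrow> real \<Rightarrow> ('a \<Rightarrow> real) \<Rightarrow> (nat \<Rightarrow> real) \<Rightarrow> bool" where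
  "local_mesh_sizes \<Omega> M e J \<gamma> m1 m2 hp hj \<longleftrightarrow>
     (\<forall>p \<in> nodes \<Omega> (M J).
        m1 * \<gamma> ^ level (M J) p \<le> hp p \<and> hp p \<le> m2 * \<gamma> ^ level (M J) p) \<and>
     (\<forall>j\<le>J. m1 * \<gamma> ^ patch_gen M e j \<le> hj j \<and> hj j \<le> m2 * \<gamma> ^ patch_gen M e j)"

end

theory Submission
  imports Defs "HOL-Library.Function_Algebras"
begin

text \<open>The quadratic forms \<open>(Bv, v)\<close> and \<open>(Bhat v, v)\<close> are both combinations of the numbers \<open>\<parallel>Q\<^sub>p v\<parallel>\<^sup>2\<close> and
  \<open>\<parallel>Q\<^sub>j v\<parallel>\<^sup>2\<close>. With \<open>q = \<gamma>\<^bsup>2s\<^esup>\<close>, interchanging the sums over levels and subspaces turns the coefficients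
  in \<open>(Bhat v, v)\<close> into geometric sums that are comparable with \<open>q\<^bsup>\<ell>(p)\<^esup>\<close> and \<open>(1 - q) q\<^bsup>g(j)\<^esup>\<close>, uniformly
  in \<open>s\<close>. For the patches this needs that \<open>g(j)\<close> is at most the maximal generation, hence that all elements
  at a compatible edge have the same generation, which follows from the conformity of the uniform
  refinements.

  For an eigenvector \<open>v\<close> of \<open>BA\<close> with eigenvalue \<open>\<mu>\<close>, pairing \<open>Av\<close> with the stable decomposition of \<open>v\<close> and using
  Young's inequality bounds \<open>|v|\<^sub>s\<^sup>2\<close> by \<open>c\<^sub>0\<close> \<open>(Bhat Av, Av)\<close>, hence by \<open>C c\<^sub>0 \<mu> |v|\<^sub>s\<^sup>2\<close>. Conversely,
  \<open>BAv = \<mu> v\<close> is itself a decomposition of \<open>\<mu> v\<close>, and the boundedness estimate applied to it gives \<open>\<mu> \<le> c\<^sub>1\<close>.\<close>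

section \<open>Inner products on spaces of functions\<close>

text \<open>Projections, operators, nodal functions and generations are all given by
  \<open>THE\<close>, so each needs existence and uniqueness before it can be used;
  \<open>lambda_min\<close> and \<open>lambda_max\<close> are a \<open>Min\<close> and a
  \<open>Max\<close>, so the spectrum must be shown finite and nonempty. The nodal functions are the
  hardest case: conformity is available for the uniform refinements, but nodal functions are needed
  on every \<open>grid_seq\<close> grid. Hence the invariant \<open>nodal_grid\<close>, which starts
  from conformity and passes through a compatible bisection. The other difficulty is uniformity as s
  tends to 0, where \<open>1 - \<gamma> powr (2 * s)\<close> and \<open>1 - \<gamma>t powr s\<close>
  both vanish. Convexity of the exponential bounds their quotient in both directions, and the
  separate fine-grid term of Bhat makes up for the part of the geometric sum that is cut off at the
  maximal generation. The constant is thus explicit in \<open>\<gamma>\<close>,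
  \<open>\<gamma>t\<close>, \<open>kst\<close>, \<open>m1\<close>, \<open>m2\<close>. Both forms are
  treated as inner products on Lipschitz functions vanishing outside the domain, a class that
  contains all the finite element spaces.\<close>

interpretation funs: vector_space "\<lambda>(c::real) (f::'b \<Rightarrow> real). (\<lambda>x. c * f x)"
  by unfold_locales (auto simp: fun_eq_iff algebra_simps)

lemma sum_fun_eval: "(\<Sum>i\<in>I. f i) x = (\<Sum>i\<in>I. f i x)" for f :: "'i \<Rightarrow> 'b \<Rightarrow> real"
  by (induction I rule: infinite_finite_induct) auto

lemma fun_span_eq: "finite F \<Longrightarrow> fun_span F = funs.span F"
  by (auto simp: fun_span_def funs.span_finite fun_eq_iff sum_fun_eval image_iff)

text \<open>The laws are required on \<open>V\<close> only, since the integrals behind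
  \<open>l2_inner\<close> and \<open>frac_form\<close> are linear only where the integrands are
  integrable.\<close>

locale inner_form =
  fixes V :: "('b \<Rightarrow> real) set" and ip :: "('b \<Rightarrow> real) \<Rightarrow> ('b \<Rightarrow> real) \<Rightarrow> real"
  assumes subspace: "funs.subspace V"
    and sym: "u \<in> V \<Longrightarrow> v \<in> V \<Longrightarrow> ip u v = ip v u"
    and add_left: "u \<in> V \<Longrightarrow> v \<in> V \<Longrightarrow> w \<in> V \<Longrightarrow> ip (u + v) w = ip u w + ip v w"
    and scale_left: "u \<in> V \<Longrightarrow> w \<in> V \<Longrightarrow> ip (\<lambda>x. c * u x) w = c * ip u w"
    and pos: "u \<in> V \<Longrightarrow> u \<noteq> 0 \<Longrightarrow> 0 < ip u u"
begin

lemmas mem_simps = funs.subspace_0[OF subspace] funs.subspace_add[OF subspace]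
  funs.subspace_scale[OF subspace] funs.subspace_diff[OF subspace] funs.subspace_sum[OF subspace]

lemma add_right: "u \<in> V \<Longrightarrow> v \<in> V \<Longrightarrow> w \<in> V \<Longrightarrow> ip w (u + v) = ip w u + ip w v"
  using add_left sym mem_simps by metis

lemma scale_right: "u \<in> V \<Longrightarrow> w \<in> V \<Longrightarrow> ip w (\<lambda>x. c * u x) = c * ip w u"
  using scale_left[of u w c] sym[of w "\<lambda>x. c * u x"] sym[of w u] mem_simps(3)[of u c] by simp

lemma zero_left: "w \<in> V \<Longrightarrow> ip 0 w = 0"
  using scale_left[of 0 w 0] mem_simps(1) by (simp add: zero_fun_def)

lemma zero_right: "w \<in> V \<Longrightarrow> ip w 0 = 0"
  using zero_left sym mem_simps(1) by metis

lemma minus_left: "u \<in> V \<Longrightarrow> v \<in> V \<Longrightarrow> w \<in> V \<Longrightarrow> ip (u - v) w = ip u w - ip v w"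
  using add_left[of "u - v" v w] mem_simps(4)[of u v] by simp

lemma minus_right: "u \<in> V \<Longrightarrow> v \<in> V \<Longrightarrow> w \<in> V \<Longrightarrow> ip w (u - v) = ip w u - ip w v"
  using minus_left sym mem_simps by metis

lemma sum_left: "(\<And>i. i \<in> I \<Longrightarrow> f i \<in> V) \<Longrightarrow> w \<in> V \<Longrightarrow> ip (\<Sum>i\<in>I. f i) w = (\<Sum>i\<in>I. ip (f i) w)"
  by (induction I rule: infinite_finite_induct) (auto simp: zero_left add_left mem_simps)

lemma sum_right: "(\<And>i. i \<in> I \<Longrightarrow> f i \<in> V) \<Longrightarrow> w \<in> V \<Longrightarrow> ip w (\<Sum>i\<in>I. f i) = (\<Sum>i\<in>I. ip w (f i))"
  by (induction I rule: infinite_finite_induct) (auto simp: zero_right add_right mem_simps)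

lemma nonneg: "u \<in> V \<Longrightarrow> 0 \<le> ip u u"
  using pos[of u] zero_left[of u] by (cases "u = 0") auto

lemma eq_0_iff: "u \<in> V \<Longrightarrow> ip u u = 0 \<longleftrightarrow> u = 0"
  using pos[of u] zero_left[of u] by (cases "u = 0") auto

text \<open>From \<open>0 \<le> ip (t u - v) (t u - v)\<close> after division by \<open>t\<close>.
  The free \<open>t\<close> is later matched to the weight of each subspace.\<close>

lemma young:
  assumes "u \<in> V" "v \<in> V" "t > 0"
  shows "2 * ip u v \<le> t * ip u u + ip v v / t"
proof -
  let ?z = "(\<lambda>x. t * u x) - v"
  have "0 \<le> ip ?z ?z" using assms by (intro nonneg mem_simps)
  also have "\<dots> = t * (t * ip u u) - t * ip u v - (t * ip v u - ip v v)"
    using assms by (simp add: minus_left minus_right scale_left scale_right mem_simps right_diff_distrib)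
  also have "\<dots> = t * (t * ip u u + ip v v / t - 2 * ip u v)"
    using assms sym[of v u] by (simp add: ring_distribs)
  finally show ?thesis using \<open>t > 0\<close> by (simp add: zero_le_mult_iff)
qed

lemma inner_form_subspace: "funs.subspace W \<Longrightarrow> W \<subseteq> V \<Longrightarrow> inner_form W ip"
  by unfold_locales (auto intro: sym add_left scale_left pos simp: subset_iff)

lemma span_subset: "F \<subseteq> V \<Longrightarrow> funs.span F \<subseteq> V"
  by (simp add: funs.span_minimal subspace)

text \<open>One representation result serves two descriptions: with \<open>l = ip v\<close> it gives
  the projection \<open>Q\<close>, with \<open>l = a u\<close> the operator \<open>A\<close>. The
  span is built up one generator at a time, in the manner of Gram-Schmidt.\<close>

lemma riesz:
  assumes "finite F" "F \<subseteq> V"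
    and "\<And>u v. u \<in> V \<Longrightarrow> v \<in> V \<Longrightarrow> l (u + v) = l u + l v"
    and "\<And>c u. u \<in> V \<Longrightarrow> l (\<lambda>x. c * u x) = c * (l u :: real)"
  shows "\<exists>!w. w \<in> funs.span F \<and> (\<forall>z\<in>funs.span F. ip w z = l z)"
proof (rule ex_ex1I)
  show "w = w'" if "w \<in> funs.span F \<and> (\<forall>z\<in>funs.span F. ip w z = l z)"
    "w' \<in> funs.span F \<and> (\<forall>z\<in>funs.span F. ip w' z = l z)" for w w'
  proof -
    have "w - w' \<in> funs.span F" using that funs.span_diff by blast
    moreover have "w \<in> V" "w' \<in> V" using that span_subset[OF assms(2)] by auto
    ultimately have "ip (w - w') (w - w') = 0" using that by (simp add: minus_left mem_simps)
    then show ?thesis using \<open>w \<in> V\<close> \<open>w' \<in> V\<close> eq_0_iff[of "w - w'"] mem_simps(4) by simp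
  qed
next
  have "\<exists>w \<in> funs.span F. \<forall>z\<in>funs.span F. ip w z = k z"
    if "\<And>u v. u \<in> V \<Longrightarrow> v \<in> V \<Longrightarrow> k (u + v) = k u + k v"
      "\<And>c u. u \<in> V \<Longrightarrow> k (\<lambda>x. c * u x) = c * (k u :: real)" for k
    using assms(1,2) that
  proof (induction F arbitrary: k)
    case empty
    have "k 0 = 0" using empty(3)[of 0 0] mem_simps(1) by (simp add: zero_fun_def)
    then show ?case using zero_left[OF mem_simps(1)] by (simp add: zero_fun_def)
  next
    case (insert f F)
    have F: "F \<subseteq> V" "f \<in> V" using insert.prems(1) by auto
    note FV = subsetD[OF span_subset[OF F(1)]]
    show ?case
    proof (cases "f \<in> funs.span F")
      case True
      then show ?thesis using insert.IH[OF F(1) insert.prems(2,3)] by (simp add: funs.span_redundant)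
    next
      case False
      \<comment> \<open>The induction hypothesis for the functional \<open>ip f\<close> projects
        \<open>f\<close> onto the old span; this is why the functional is left arbitrary. The
        difference \<open>g\<close> is the new direction, orthogonal to the span of
        \<open>F\<close>.\<close>
      have "\<exists>w\<in>funs.span F. \<forall>z\<in>funs.span F. ip w z = ip f z"
        by (rule insert.IH[OF F(1)]) (simp_all only: add_right scale_right F(2))
      then obtain f0 where f0: "f0 \<in> funs.span F" "\<forall>z\<in>funs.span F. ip f0 z = ip f z"
        by blast
      obtain w0 where w0: "w0 \<in> funs.span F" "\<forall>z\<in>funs.span F. ip w0 z = k z"
        using insert.IH[OF F(1) insert.prems(2,3)] by blast
      define g where "g = f - f0"
      have f0V: "f0 \<in> V" using FV f0(1) .
      have "g \<noteq> 0" using f0(1) False by (auto simp: g_def)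
      then have gV: "g \<in> V" "g \<noteq> 0" using f0V F by (auto simp: g_def mem_simps)
      have orth: "ip g z = 0" if "z \<in> funs.span F" for z
        using f0(2) that F(2) f0V FV by (simp add: g_def minus_left)
      have orth': "ip z g = 0" if "z \<in> funs.span F" for z
        using orth[OF that] sym[OF FV[OF that] gV(1)] by simp
      have sub: "funs.span F \<subseteq> funs.span (insert f F)" by (rule funs.span_mono) auto
      have gs: "g \<in> funs.span (insert f F)"
        unfolding g_def using f0(1) sub by (intro funs.span_diff) (auto intro: funs.span_base)
      \<comment> \<open>Adding \<open>c * g\<close> leaves the values on the span of
        \<open>F\<close> unchanged, and this \<open>c\<close> makes the value at \<open>g\<close>
        correct.\<close>
      define c where "c = k g / ip g g"
      define w where "w = w0 + (\<lambda>x. c * g x)"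
      have "w \<in> funs.span (insert f F)"
        unfolding w_def using w0(1) gs sub by (intro funs.span_add funs.span_scale) auto
      moreover have "ip w z = k z" if "z \<in> funs.span (insert f F)" for z
      proof -
        obtain a where a: "z - (\<lambda>x. a * f x) \<in> funs.span F"
          using \<open>z \<in> _\<close> by (auto simp: funs.span_insert)
        define y where "y = z - (\<lambda>x. a * f x) + (\<lambda>x. a * f0 x)"
        have y: "y \<in> funs.span F" unfolding y_def using a f0(1) by (intro funs.span_add funs.span_scale)
        have z: "z = y + (\<lambda>x. a * g x)" by (auto simp: y_def g_def fun_eq_iff algebra_simps)
        have V: "y \<in> V" "w0 \<in> V" using FV y w0 by auto
        have "ip w z = ip w0 y + c * a * ip g g"
          using V gV orth orth' y w0(1) by (simp add: w_def z add_left add_right scale_left scale_right mem_simps)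
        also have "\<dots> = k y + a * k g" using w0 y gV eq_0_iff[of g] by (simp add: c_def)
        also have "\<dots> = k z" unfolding z using V gV by (simp only: insert.prems(2,3) mem_simps)
        finally show ?thesis .
      qed
      ultimately show ?thesis by blast
    qed
  qed
  then show "\<exists>w. w \<in> funs.span F \<and> (\<forall>z\<in>funs.span F. ip w z = l z)" using assms(3,4) by blast
qed

lemma orthogonal_independent:
  assumes "S \<subseteq> V" "0 \<notin> S" and orth: "\<And>u v. u \<in> S \<Longrightarrow> v \<in> S \<Longrightarrow> u \<noteq> v \<Longrightarrow> ip u v = 0"
  shows "funs.independent S"
proof -
  have "u v = 0" if t: "finite t" "t \<subseteq> S" and eq: "(\<Sum>v\<in>t. (\<lambda>x. u v * v x)) = 0" and v: "v \<in> t" for t u v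
  proof -
    have "0 = ip (\<Sum>v\<in>t. (\<lambda>x. u v * v x)) v"
      unfolding eq using assms t v zero_left by (simp add: subset_iff)
    also have "\<dots> = (\<Sum>w\<in>t. u w * ip w v)"
      using assms(1) t v by (subst sum_left) (auto simp: subset_iff mem_simps scale_left intro!: sum.cong)
    also have "\<dots> = (\<Sum>w\<in>t. if w = v then u v * ip v v else 0)"
      using t v orth by (intro sum.cong) auto
    also have "\<dots> = u v * ip v v" using t v by simp
    finally show ?thesis using eq_0_iff[of v] t v assms by auto
  qed
  then show ?thesis by (auto simp: funs.dependent_explicit)
qed

end

section \<open>Eigenvalues of self-adjoint operators on finite-dimensional function spaces\<close>

lemma fun_cube_compact:
  "compact (Pi UNIV (\<lambda>i. if i \<in> I then {-1..1} else {0}) :: ('i \<Rightarrow> real) set)"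
proof -
  \<comment> \<open>Tychonoff in the product topology. Coordinates outside \<open>I\<close> are
    frozen at 0, so for finite \<open>I\<close> this is an ordinary cube of coefficients.\<close>
  have "compactin (product_topology (\<lambda>i. euclidean) UNIV)
    (PiE UNIV (\<lambda>i. if i \<in> I then {-1..1::real} else {0}))"
    unfolding compactin_PiE by auto
  then show ?thesis by (simp add: euclidean_product_topology PiE_UNIV_domain Pi_def)
qed

locale selfadjoint_operator = inner_form +
  fixes F L
  assumes finite_F: "finite F" and V_span: "V = funs.span F"
    and L_mem: "u \<in> V \<Longrightarrow> L u \<in> V"
    and L_add: "u \<in> V \<Longrightarrow> v \<in> V \<Longrightarrow> L (u + v) = L u + L v"
    and L_scale: "u \<in> V \<Longrightarrow> L (\<lambda>x. c * u x) = (\<lambda>x. c * L u x)"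
    and L_sym: "u \<in> V \<Longrightarrow> v \<in> V \<Longrightarrow> ip (L u) v = ip u (L v)"
begin

text \<open>Eigenvectors for distinct eigenvalues are orthogonal by \<open>L_sym\<close>, hence
  independent, and a space spanned by the finite set \<open>F\<close> admits only finitely many of
  them.\<close>

lemma finite_eigenvalues: "finite (eigenvalues_on V L)"
proof -
  define ev where "ev \<mu> = (SOME v. v \<in> V \<and> v \<noteq> 0 \<and> L v = (\<lambda>x. \<mu> * v x))" for \<mu>
  let ?E = "eigenvalues_on V L"
  have ev: "ev \<mu> \<in> V" "ev \<mu> \<noteq> 0" "L (ev \<mu>) = (\<lambda>x. \<mu> * ev \<mu> x)" if "\<mu> \<in> ?E" for \<mu>
    using someI_ex[of "\<lambda>v. v \<in> V \<and> v \<noteq> 0 \<and> L v = (\<lambda>x. \<mu> * v x)"] that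
    by (auto simp: ev_def eigenvalues_on_def zero_fun_def)
  have orth: "ip (ev \<mu>) (ev \<nu>) = 0" if "\<mu> \<in> ?E" "\<nu> \<in> ?E" "\<mu> \<noteq> \<nu>" for \<mu> \<nu>
    using L_sym[of "ev \<mu>" "ev \<nu>"] ev that by (simp add: scale_left scale_right)
  have inj: "inj_on ev ?E"
    using orth ev eq_0_iff by (intro inj_onI) metis
  have "funs.independent (ev ` ?E)"
  proof (rule orthogonal_independent)
    show "ip u v = 0" if "u \<in> ev ` ?E" "v \<in> ev ` ?E" "u \<noteq> v" for u v
      using that orth by blast
  qed (use ev in auto)
  then have "finite (ev ` ?E)"
    using funs.independent_span_bound[OF finite_F] ev V_span by blast
  then show ?thesis using finite_imageD inj by blast
qed

text \<open>The Rayleigh quotient attains its maximum on a compact set of coefficient vectors, and a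
  maximiser is an eigenvector. Without this the \<open>Min\<close> and \<open>Max\<close> of the
  spectrum would carry no information.\<close>

lemma eigenvalue_exists:
  assumes nontriv: "\<exists>v\<in>V. v \<noteq> 0"
  shows "eigenvalues_on V L \<noteq> {}"
proof -
  \<comment> \<open>A basis replaces \<open>F\<close>, which may be dependent: only then does a
    nonzero coefficient vector give a nonzero function.\<close>
  obtain G where G: "G \<subseteq> V" "funs.independent G" "V \<subseteq> funs.span G"
    using funs.maximal_independent_subset by blast
  have finG: "finite G" using funs.independent_span_bound[OF finite_F G(2)] G(1) V_span by auto
  define \<Phi> where "\<Phi> c = (\<Sum>f\<in>G. (\<lambda>x. c f * f x))" for c :: "('a \<Rightarrow> real) \<Rightarrow> real"
  have \<Phi>V: "\<Phi> c \<in> V" for c using G(1) by (auto simp: \<Phi>_def subset_iff intro!: mem_simps)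
  have \<Phi>0: "c f = 0" if "\<Phi> c = 0" "f \<in> G" for c f
    using G(2) finG that by (auto simp: \<Phi>_def funs.dependent_finite)
  \<comment> \<open>The Euclidean unit sphere of coefficients; intersecting with the cube supplies
    compactness and sets the coordinates outside \<open>G\<close> to 0.\<close>
  define K where "K = Pi UNIV (\<lambda>f. if f \<in> G then {-1..1} else {0}) \<inter> {c. (\<Sum>f\<in>G. (c f)\<^sup>2) = (1::real)}"
  have "closed {c. (\<Sum>f\<in>G. (c f)\<^sup>2) = (1::real)}"
    by (intro closed_Collect_eq continuous_intros) (simp_all add: continuous_on_product_then_coordinatewise)
  then have K: "compact K" unfolding K_def by (intro compact_Int_closed fun_cube_compact)
  have \<Phi>ip: "ip (T (\<Phi> c)) (\<Phi> c) = (\<Sum>f\<in>G. \<Sum>g\<in>G. c f * c g * ip (T f) g)"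
    if "\<And>u v. u \<in> V \<Longrightarrow> T u \<in> V" "T (\<Phi> c) = (\<Sum>f\<in>G. (\<lambda>x. c f * T f x))" for T c
  proof -
    have "ip (T (\<Phi> c)) (\<Phi> c) = (\<Sum>f\<in>G. c f * ip (T f) (\<Phi> c))"
      unfolding that(2) using G(1) that(1) \<Phi>V
      by (subst sum_left) (auto simp: subset_iff mem_simps scale_left)
    also have "ip (T f) (\<Phi> c) = (\<Sum>g\<in>G. c g * ip (T f) g)" if "f \<in> G" for f
      unfolding \<Phi>_def using G(1) \<open>\<And>u v. u \<in> V \<Longrightarrow> T u \<in> V\<close> that
      by (subst sum_right) (auto simp: subset_iff mem_simps scale_right)
    ultimately show ?thesis by (simp add: sum_distrib_left mult.assoc)
  qed
  have L0: "L 0 = 0" using L_scale[of 0 0] mem_simps(1) by (simp add: zero_fun_def)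
  have "L (\<Sum>f\<in>A. (\<lambda>x. c f * f x)) = (\<Sum>f\<in>A. (\<lambda>x. c f * L f x))" if "finite A" "A \<subseteq> V" for A c
    using that by (induction A) (auto simp: L0 L_add L_scale mem_simps subset_iff)
  then have L\<Phi>: "L (\<Phi> c) = (\<Sum>f\<in>G. (\<lambda>x. c f * L f x))" for c
    using finG G(1) by (simp add: \<Phi>_def)
  define R where "R c = ip (L (\<Phi> c)) (\<Phi> c) / ip (\<Phi> c) (\<Phi> c)" for c
  have nz: "ip (\<Phi> c) (\<Phi> c) \<noteq> 0" if "c \<in> K" for c
  proof
    assume "ip (\<Phi> c) (\<Phi> c) = 0"
    then have "\<Phi> c = 0" using eq_0_iff \<Phi>V by blast
    then have "\<forall>f\<in>G. c f = 0" using \<Phi>0 by blast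
    then have "(\<Sum>f\<in>G. (c f)\<^sup>2) = 0" by simp
    then show False using that by (simp add: K_def)
  qed
  have cont: "continuous_on K (\<lambda>c. c f)" for f
    by (rule continuous_on_subset[OF continuous_on_product_coordinates]) simp
  have "continuous_on K (\<lambda>c. ip (L (\<Phi> c)) (\<Phi> c))"
    by (subst \<Phi>ip[of L, OF L_mem L\<Phi>]) (auto intro!: continuous_on_sum continuous_on_mult cont)
  moreover have "continuous_on K (\<lambda>c. ip (\<Phi> c) (\<Phi> c))"
    by (subst \<Phi>ip[of "\<lambda>x. x", OF _ \<Phi>_def]) (auto intro!: continuous_on_sum continuous_on_mult cont)
  ultimately have contR: "continuous_on K R"
    unfolding R_def using nz by (intro continuous_on_divide) auto
  have normalise: "\<exists>c\<in>K. \<exists>r. r \<noteq> 0 \<and> \<Phi> c = (\<lambda>x. r * v x)" if v: "v \<in> V" "v \<noteq> 0" for v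
  proof -
    obtain u where u: "v = (\<Sum>f\<in>G. (\<lambda>x. u f * f x))"
      using v G(3) finG by (auto simp: funs.span_finite)
    define n where "n = sqrt (\<Sum>f\<in>G. (u f)\<^sup>2)"
    have "n \<noteq> 0"
    proof
      assume "n = 0"
      then have "\<forall>f\<in>G. u f = 0" using finG by (simp add: n_def sum_nonneg_eq_0_iff)
      then have "v = 0" by (simp add: u fun_eq_iff sum_fun_eval)
      then show False using v by simp
    qed
    define c where "c f = (if f \<in> G then u f / n else 0)" for f
    have n2: "n\<^sup>2 = (\<Sum>f\<in>G. (u f)\<^sup>2)" by (simp add: n_def sum_nonneg)
    have 1: "(\<Sum>f\<in>G. (c f)\<^sup>2) = 1"
      using \<open>n \<noteq> 0\<close> by (simp add: c_def power_divide flip: sum_divide_distrib n2)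
    have "c f \<in> {-1..1}" if "f \<in> G" for f
    proof -
      have "(c f)\<^sup>2 \<le> 1" unfolding 1[symmetric] using finG that by (intro member_le_sum) auto
      then show ?thesis by (simp add: abs_square_le_1 abs_le_iff)
    qed
    then have "c \<in> K" using 1 by (auto simp: K_def c_def)
    moreover have "\<Phi> c = (\<lambda>x. 1 / n * v x)"
      by (auto simp: \<Phi>_def u c_def fun_eq_iff sum_fun_eval sum_divide_distrib intro!: sum.cong)
    ultimately show ?thesis using \<open>n \<noteq> 0\<close> by (intro bexI[of _ c] exI[of _ "1 / n"]) auto
  qed
  have "K \<noteq> {}" using normalise nontriv by blast
  then obtain c where c: "c \<in> K" "\<And>c'. c' \<in> K \<Longrightarrow> R c' \<le> R c"
    using continuous_attains_sup[OF K _ contR] by blast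
  define \<mu> where "\<mu> = R c"
  define D where "D u v = \<mu> * ip u v - ip (L u) v" for u v
  have Dpos: "0 \<le> D v v" if v: "v \<in> V" for v
  proof (cases "v = 0")
    case True
    then show ?thesis by (simp add: D_def L0 zero_left mem_simps)
  next
    case False
    then obtain c' r where c': "c' \<in> K" "r \<noteq> 0" "\<Phi> c' = (\<lambda>x. r * v x)" using normalise v by blast
    have "R c' = ip (L v) v / ip v v"
      unfolding R_def c' using c'(2) v by (simp add: L_scale L_mem scale_left scale_right mem_simps)
    then have "ip (L v) v / ip v v \<le> \<mu>" using c(2)[OF c'(1)] by (simp add: \<mu>_def)
    then show ?thesis using pos[OF v False] by (simp add: D_def field_simps)
  qed
  define x where "x = \<Phi> c"
  have x: "x \<in> V" "D x x = 0" "x \<noteq> 0"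
    using nz[OF c(1)] \<Phi>V[of c] by (auto simp: x_def D_def \<mu>_def R_def zero_left)
  \<comment> \<open>The form \<open>D\<close> is positive semidefinite and vanishes at \<open>x\<close>, so \<open>x\<close> lies in its kernel.\<close>
  define y where "y = (\<lambda>z. \<mu> * x z) - L x"
  have y: "y \<in> V" using x by (simp add: y_def mem_simps L_mem)
  have Dxy: "D x y = ip y y"
    using x y by (simp add: D_def y_def minus_left scale_left L_mem mem_simps)
  have "y = 0"
  proof (rule ccontr)
    assume "y \<noteq> 0"
    then have yy: "ip y y > 0" using pos y by blast
    have expand: "D (x - (\<lambda>z. t * y z)) (x - (\<lambda>z. t * y z)) = t * (t * D y y - 2 * ip y y)" for t
    proof -
      have L': "L (x - (\<lambda>z. t * y z)) = L x - (\<lambda>z. t * L y z)"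
      proof -
        have "L (x - (\<lambda>z. t * y z)) = L (x + (\<lambda>z. (- t) * y z))"
          by (rule arg_cong[of _ _ L]) (auto simp: fun_eq_iff)
        also have "\<dots> = L x + (\<lambda>z. (- t) * L y z)" using x y by (simp only: L_add L_scale mem_simps)
        also have "\<dots> = L x - (\<lambda>z. t * L y z)" by (auto simp: fun_eq_iff)
        finally show ?thesis .
      qed
      have Dyx: "\<mu> * ip y x - ip (L y) x = ip y y"
        using Dxy x y L_sym[of y x] sym[of y x] sym[of y "L x"] by (simp add: D_def L_mem)
      have Dxy': "ip (L x) y = \<mu> * ip x y - ip y y" using Dxy by (simp add: D_def)
      have Dxx': "ip (L x) x = \<mu> * ip x x" using x by (simp add: D_def)
      have Dyx': "ip (L y) x = \<mu> * ip y x - ip y y" using Dyx by simp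
      show ?thesis
        unfolding D_def L' using x y
        by (simp add: minus_left minus_right scale_left scale_right mem_simps L_mem Dxy' Dxx' Dyx')
          (simp add: algebra_simps)
    qed
    \<comment> \<open>Small enough that \<open>2 * ip y y\<close> wins over
      \<open>t * D y y\<close>; the summand \<open>ip y y\<close> in the denominator covers the case
      \<open>D y y = 0\<close>.\<close>
    define t where "t = ip y y / (D y y + ip y y)"
    have D: "D y y \<ge> 0" using Dpos y by blast
    have "t > 0" using D yy by (simp add: t_def)
    moreover have "t * D y y - 2 * ip y y < 0"
    proof -
      have "t * D y y \<le> ip y y"
        using D yy by (simp add: t_def field_simps)
      then show ?thesis using yy by simp
    qed
    ultimately have "t * (t * D y y - 2 * ip y y) < 0" by (simp add: mult_pos_neg)
    moreover have "0 \<le> D (x - (\<lambda>z. t * y z)) (x - (\<lambda>z. t * y z))"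
      using x y by (intro Dpos mem_simps)
    ultimately show False using expand by simp
  qed
  then have "L x = (\<lambda>z. \<mu> * x z)" by (simp add: y_def)
  then have "\<mu> \<in> eigenvalues_on V L" using x by (auto simp: eigenvalues_on_def zero_fun_def)
  then show ?thesis by blast
qed

end

section \<open>Subspace correction preconditioners\<close>

text \<open>\<open>F i\<close> is a finite generating set of a subspace. Different indices may have
  the same subspace, as happens in Bhat, where one subspace recurs on several levels.\<close>

locale subspace_corrections = inner_form V ip for V :: "('b \<Rightarrow> real) set" and ip +
  fixes I :: "'i set" and F :: "'i \<Rightarrow> ('b \<Rightarrow> real) set" and w :: "'i \<Rightarrow> real"
  assumes finite_I: "finite I" and F: "i \<in> I \<Longrightarrow> finite (F i)" "i \<in> I \<Longrightarrow> F i \<subseteq> V"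
    and w_pos: "i \<in> I \<Longrightarrow> 0 < w i"
begin

definition Q :: "'i \<Rightarrow> ('b \<Rightarrow> real) \<Rightarrow> 'b \<Rightarrow> real" where
  "Q i v = (THE u. u \<in> funs.span (F i) \<and> (\<forall>z\<in>funs.span (F i). ip u z = ip v z))"

definition B :: "('b \<Rightarrow> real) \<Rightarrow> 'b \<Rightarrow> real" where
  "B v = (\<Sum>i\<in>I. (\<lambda>x. w i * Q i v x))"

lemma span_F: "i \<in> I \<Longrightarrow> u \<in> funs.span (F i) \<Longrightarrow> u \<in> V"
  using span_subset[OF F(2)] by blast

lemma Q_unique:
  assumes "i \<in> I" "v \<in> V"
  shows "\<exists>!u. u \<in> funs.span (F i) \<and> (\<forall>z\<in>funs.span (F i). ip u z = ip v z)"
  by (rule riesz[OF F(1)[OF assms(1)] F(2)[OF assms(1)]]) (simp_all only: add_right scale_right assms(2))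

lemma Q:
  assumes "i \<in> I" "v \<in> V"
  shows "Q i v \<in> funs.span (F i)" "Q i v \<in> V" "z \<in> funs.span (F i) \<Longrightarrow> ip (Q i v) z = ip v z"
  using theI'[OF Q_unique[OF assms]] span_F[OF assms(1)] unfolding Q_def by blast+

lemma Q_eqI:
  assumes "i \<in> I" "v \<in> V" "u \<in> funs.span (F i)" "\<And>z. z \<in> funs.span (F i) \<Longrightarrow> ip u z = ip v z"
  shows "Q i v = u"
  unfolding Q_def by (rule the1_equality[OF Q_unique[OF assms(1,2)]]) (use assms in blast)

lemma Q_add:
  assumes "i \<in> I" "u \<in> V" "v \<in> V"
  shows "Q i (u + v) = Q i u + Q i v"
proof (rule Q_eqI[OF assms(1) mem_simps(2)[OF assms(2,3)]])
  show "Q i u + Q i v \<in> funs.span (F i)" using Q(1) assms by (intro funs.span_add) auto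
  show "ip (Q i u + Q i v) z = ip (u + v) z" if "z \<in> funs.span (F i)" for z
    using that Q assms span_F[OF assms(1) that] by (simp add: add_left)
qed

lemma Q_scale:
  assumes "i \<in> I" "u \<in> V"
  shows "Q i (\<lambda>x. c * u x) = (\<lambda>x. c * Q i u x)"
proof (rule Q_eqI[OF assms(1) mem_simps(3)[OF assms(2)]])
  show "(\<lambda>x. c * Q i u x) \<in> funs.span (F i)" using Q(1) assms by (intro funs.span_scale) auto
  show "ip (\<lambda>x. c * Q i u x) z = ip (\<lambda>x. c * u x) z" if "z \<in> funs.span (F i)" for z
    using that Q assms span_F[OF assms(1) that] by (simp add: scale_left)
qed

lemma ip_Q: "i \<in> I \<Longrightarrow> u \<in> V \<Longrightarrow> v \<in> V \<Longrightarrow> ip (Q i u) v = ip (Q i u) (Q i v)"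
  using Q(1,2)[of i] Q(3)[of i v "Q i u"] sym by metis

lemma B_mem: "v \<in> V \<Longrightarrow> B v \<in> V"
  unfolding B_def by (intro mem_simps Q(2))

lemma B_add: "u \<in> V \<Longrightarrow> v \<in> V \<Longrightarrow> B (u + v) = B u + B v"
  by (auto simp: B_def fun_eq_iff sum_fun_eval Q_add distrib_left sum.distrib)

lemma B_scale: "u \<in> V \<Longrightarrow> B (\<lambda>x. c * u x) = (\<lambda>x. c * B u x)"
  by (auto simp: B_def fun_eq_iff sum_fun_eval Q_scale sum_distrib_left mult.left_commute intro!: sum.cong)

lemma ip_B:
  assumes "u \<in> V" "v \<in> V"
  shows "ip (B u) v = (\<Sum>i\<in>I. w i * ip (Q i u) (Q i v))"
proof -
  have "ip (B u) v = (\<Sum>i\<in>I. ip (\<lambda>x. w i * Q i u x) v)"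
    unfolding B_def using assms Q(2) by (intro sum_left mem_simps(3)) auto
  also have "\<dots> = (\<Sum>i\<in>I. w i * ip (Q i u) (Q i v))"
    using assms by (intro sum.cong) (auto simp: scale_left Q ip_Q)
  finally show ?thesis .
qed

lemma B_sym:
  assumes "u \<in> V" "v \<in> V"
  shows "ip (B u) v = ip u (B v)"
proof -
  have "(\<Sum>i\<in>I. w i * ip (Q i u) (Q i v)) = (\<Sum>i\<in>I. w i * ip (Q i v) (Q i u))"
    using Q(2) sym assms by (intro sum.cong) auto
  then show ?thesis using ip_B[OF assms] ip_B[OF assms(2,1)] sym[OF assms(1) B_mem[OF assms(2)]] by simp
qed

text \<open>Young's inequality in each subspace, with parameter \<open>t * w i\<close>, gives
  \<open>2 * X \<le> t * S + c * X / t\<close> for every \<open>t > 0\<close>, where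
  \<open>S = ip (B g) g\<close>. The case \<open>t = c\<close> is the claim, and positivity of
  \<open>c\<close> comes from the same inequality.\<close>

lemma stable_decomposition_bound:
  assumes g: "g \<in> V" and vs: "\<And>i. i \<in> I \<Longrightarrow> vs i \<in> funs.span (F i)"
    and X: "X = ip g (\<Sum>i\<in>I. vs i)" "X > 0"
    and N: "(\<Sum>i\<in>I. ip (vs i) (vs i) / w i) \<le> c * X"
  shows "c > 0" "X \<le> c * ip (B g) g"
proof -
  define S where "S = ip (B g) g"
  have S: "S = (\<Sum>i\<in>I. w i * ip (Q i g) (Q i g))" unfolding S_def by (rule ip_B[OF g g])
  have vsV: "vs i \<in> V" if "i \<in> I" for i using span_F vs that by blast
  have "S \<ge> 0" unfolding S using w_pos Q(2) g nonneg by (intro sum_nonneg mult_nonneg_nonneg) (auto simp: less_imp_le)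
  have X': "X = (\<Sum>i\<in>I. ip (Q i g) (vs i))"
    unfolding X using vs vsV Q(3) g by (subst sum_right) (auto intro!: sum.cong)
  have key: "2 * X \<le> t * S + c * X / t" if t: "t > 0" for t
  proof -
    have "2 * X = (\<Sum>i\<in>I. 2 * ip (Q i g) (vs i))" unfolding X' by (simp add: sum_distrib_left)
    also have "\<dots> \<le> (\<Sum>i\<in>I. t * (w i * ip (Q i g) (Q i g)) + ip (vs i) (vs i) / w i / t)"
    proof (rule sum_mono)
      fix i assume i: "i \<in> I"
      show "2 * ip (Q i g) (vs i) \<le> t * (w i * ip (Q i g) (Q i g)) + ip (vs i) (vs i) / w i / t"
        using young[OF Q(2)[OF i g] vsV[OF i], of "t * w i"] t w_pos[OF i] by (simp add: mult.assoc mult.commute)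
    qed
    also have "\<dots> = t * S + (\<Sum>i\<in>I. ip (vs i) (vs i) / w i) / t"
      unfolding S by (simp add: sum.distrib sum_distrib_left sum_divide_distrib)
    also have "\<dots> \<le> t * S + c * X / t" using N t by (simp add: divide_right_mono)
    finally show ?thesis .
  qed
  show c: "c > 0"
  proof (rule ccontr)
    assume "\<not> c > 0"
    \<comment> \<open>Makes \<open>t * S \<le> X\<close>. For \<open>c \<le> 0\<close> the other
      term is not positive, and \<open>2 * X \<le> X\<close> contradicts
      \<open>X > 0\<close>.\<close>
    define t where "t = X / (S + 1)"
    have t: "t > 0" using \<open>S \<ge> 0\<close> X by (simp add: t_def)
    have "c * X / t \<le> 0" using \<open>\<not> c > 0\<close> X t by (simp add: divide_nonpos_pos mult_nonpos_nonneg)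
    moreover have "t * S \<le> X" using \<open>S \<ge> 0\<close> X by (simp add: t_def field_simps)
    ultimately show False using key[OF t] X by linarith
  qed
  show "X \<le> c * ip (B g) g" using key[OF c] c unfolding S_def by simp
qed

end

section \<open>The operator BA and its eigenvalues\<close>

locale preconditioned = subspace_corrections V ip I F w + en: inner_form V a
  for V :: "('b \<Rightarrow> real) set" and ip and I :: "'i set" and F w a +
  fixes G
  assumes finite_G: "finite G" and V_span: "V = funs.span G"
begin

definition A :: "('b \<Rightarrow> real) \<Rightarrow> 'b \<Rightarrow> real" where
  "A u = (THE y. y \<in> V \<and> (\<forall>v\<in>V. ip y v = a u v))"

lemma A_unique: "u \<in> V \<Longrightarrow> \<exists>!y. y \<in> V \<and> (\<forall>v\<in>V. ip y v = a u v)"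
proof -
  assume u: "u \<in> V"
  have G: "G \<subseteq> V" using V_span funs.span_superset by blast
  show ?thesis unfolding V_span
    by (rule riesz[OF finite_G G]) (simp_all only: en.add_right en.scale_right u)
qed

lemma A: "u \<in> V \<Longrightarrow> A u \<in> V" "u \<in> V \<Longrightarrow> v \<in> V \<Longrightarrow> ip (A u) v = a u v"
  using theI'[OF A_unique] unfolding A_def by blast+

lemma A_eqI: "u \<in> V \<Longrightarrow> y \<in> V \<Longrightarrow> (\<And>v. v \<in> V \<Longrightarrow> ip y v = a u v) \<Longrightarrow> A u = y"
  unfolding A_def by (rule the1_equality[OF A_unique]) blast+

lemma A_add: "u \<in> V \<Longrightarrow> v \<in> V \<Longrightarrow> A (u + v) = A u + A v"
  by (rule A_eqI) (simp_all only: mem_simps A add_left en.add_left)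

lemma A_scale: "u \<in> V \<Longrightarrow> A (\<lambda>x. c * u x) = (\<lambda>x. c * A u x)"
  by (rule A_eqI) (simp_all only: mem_simps A scale_left en.scale_left)

text \<open>Pairing with \<open>v\<close> in \<open>a\<close> is pairing with \<open>A v\<close> in
  \<open>ip\<close>. Symmetry of \<open>B\<close> in \<open>ip\<close> thus becomes symmetry of
  \<open>B \<circ> A\<close> in \<open>a\<close>, although \<open>B \<circ> A\<close> need not be
  symmetric in \<open>ip\<close>.\<close>

lemma a_BA: "u \<in> V \<Longrightarrow> v \<in> V \<Longrightarrow> a (B (A u)) v = ip (B (A u)) (A v)"
  using A(2)[of v "B (A u)"] en.sym[of "B (A u)" v] sym[of "A v" "B (A u)"] A(1) B_mem by simp

sublocale BA: selfadjoint_operator V a G "B \<circ> A"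
proof unfold_locales
  show "finite G" "V = funs.span G" by (fact finite_G V_span)+
  show "(B \<circ> A) u \<in> V" if "u \<in> V" for u using that A B_mem by simp
  show "(B \<circ> A) (u + v) = (B \<circ> A) u + (B \<circ> A) v" if "u \<in> V" "v \<in> V" for u v
    using that by (simp add: A_add B_add A)
  show "(B \<circ> A) (\<lambda>x. c * u x) = (\<lambda>x. c * (B \<circ> A) u x)" if "u \<in> V" for u c
    using that by (simp add: A_scale B_scale A)
  show "a ((B \<circ> A) u) v = a u ((B \<circ> A) v)" if uv: "u \<in> V" "v \<in> V" for u v
    using a_BA[OF uv] a_BA[OF uv(2,1)] B_sym[of "A u" "A v"] A[of u] A[of v] B_mem
      sym[of "A u" "B (A v)"] en.sym[of u "B (A v)"] uv by simp
qed

lemma eigenvector: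
  assumes "\<mu> \<in> eigenvalues_on V (B \<circ> A)"
  obtains v where "v \<in> V" "a v v > 0" "B (A v) = (\<lambda>x. \<mu> * v x)" "ip (B (A v)) (A v) = \<mu> * a v v"
proof -
  obtain v where v: "v \<in> V" "v \<noteq> 0" "B (A v) = (\<lambda>x. \<mu> * v x)"
    using assms by (auto simp: eigenvalues_on_def zero_fun_def)
  moreover have "ip (B (A v)) (A v) = \<mu> * a v v"
    using v a_BA[OF v(1) v(1)] by (simp add: en.scale_left)
  ultimately show ?thesis using that en.pos by blast
qed

text \<open>In the weighted norms the decomposition of \<open>\<mu> v\<close> into the terms
  \<open>w i Q i (A v)\<close> costs exactly \<open>ip (B (A v)) (A v)\<close>, that is
  \<open>\<mu> * a v v\<close>, while the energy of \<open>\<mu> v\<close> is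
  \<open>\<mu> * (\<mu> * a v v)\<close>. Cancelling requires \<open>\<mu> > 0\<close>, which in the
  application comes from the lower bound.\<close>

lemma eigenvalue_upper:
  assumes \<mu>: "\<mu> \<in> eigenvalues_on V (B \<circ> A)" "\<mu> > 0"
    and bound: "\<And>vs. (\<And>i. i \<in> I \<Longrightarrow> vs i \<in> funs.span (F i)) \<Longrightarrow>
      a (\<Sum>i\<in>I. vs i) (\<Sum>i\<in>I. vs i) \<le> c * (\<Sum>i\<in>I. ip (vs i) (vs i) / w i)"
  shows "\<mu> \<le> c"
proof -
  obtain v where v: "v \<in> V" "a v v > 0" "B (A v) = (\<lambda>x. \<mu> * v x)" "ip (B (A v)) (A v) = \<mu> * a v v"
    using eigenvector[OF \<mu>(1)] .
  define vs where "vs i = (\<lambda>x. w i * Q i (A v) x)" for i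
  have vs: "vs i \<in> funs.span (F i)" if "i \<in> I" for i
    unfolding vs_def using Q(1) A(1) v(1) that by (intro funs.span_scale) auto
  have "(\<Sum>i\<in>I. vs i) = (\<lambda>x. \<mu> * v x)" using v(3) by (simp add: vs_def B_def)
  then have "\<mu> * (\<mu> * a v v) = a (\<Sum>i\<in>I. vs i) (\<Sum>i\<in>I. vs i)"
    using v(1) mem_simps(3)[OF v(1)] by (simp add: en.scale_left en.scale_right)
  also have "\<dots> \<le> c * (\<Sum>i\<in>I. ip (vs i) (vs i) / w i)" using vs by (rule bound)
  also have "(\<Sum>i\<in>I. ip (vs i) (vs i) / w i) = (\<Sum>i\<in>I. w i * ip (Q i (A v)) (Q i (A v)))"
  proof (rule sum.cong[OF refl])
    fix i assume i: "i \<in> I"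
    have "Q i (A v) \<in> V" using Q(2) i A(1) v(1) by blast
    then have "ip (vs i) (vs i) = w i * (w i * ip (Q i (A v)) (Q i (A v)))"
      unfolding vs_def using mem_simps(3)[of "Q i (A v)"] by (simp add: scale_left scale_right)
    then show "ip (vs i) (vs i) / w i = w i * ip (Q i (A v)) (Q i (A v))" using w_pos[OF i] by simp
  qed
  also have "\<dots> = \<mu> * a v v" using ip_B[of "A v" "A v"] A(1) v by simp
  finally have "\<mu> * (\<mu> * a v v) \<le> c * (\<mu> * a v v)" .
  then show ?thesis using \<mu>(2) v(2) by simp
qed

lemma eigenvalue_lower:
  assumes \<mu>: "\<mu> \<in> eigenvalues_on V (B \<circ> A)"
    and bound: "\<And>v. v \<in> V \<Longrightarrow> v \<noteq> 0 \<Longrightarrow> a v v \<le> c * ip (B (A v)) (A v)" and c: "c > 0"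
  shows "1 / c \<le> \<mu>"
proof -
  obtain v where v: "v \<in> V" "a v v > 0" "B (A v) = (\<lambda>x. \<mu> * v x)" "ip (B (A v)) (A v) = \<mu> * a v v"
    using eigenvector[OF \<mu>] .
  have "v \<noteq> 0" using v en.zero_left[OF v(1)] by auto
  then have "1 * a v v \<le> (c * \<mu>) * a v v" using bound[OF v(1)] v(4) by (simp add: mult.assoc)
  then have "1 \<le> c * \<mu>" using v(2) mult_le_cancel_right by fastforce
  then show ?thesis using c by (simp add: field_simps)
qed

end

section \<open>Hat functions on bisection grids\<close>

text \<open>Excludes slits: at a boundary point interior to the closure, a small step along
  \<open>- n\<close> leads strictly below the graph, to a point of the closure with a neighbourhood
  that misses the domain.\<close>

lemma interior_closure_lipschitz_domain:
  assumes "bounded_lipschitz_domain \<Omega>"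
  shows "interior (closure \<Omega>) = \<Omega>"
proof
  have op: "open \<Omega>" using assms by (simp add: bounded_lipschitz_domain_def)
  then show "\<Omega> \<subseteq> interior (closure \<Omega>)" by (simp add: interior_maximal closure_subset)
  show "interior (closure \<Omega>) \<subseteq> \<Omega>"
  proof (rule ccontr)
    assume "\<not> ?thesis"
    then obtain x where x: "x \<in> interior (closure \<Omega>)" "x \<notin> \<Omega>" by blast
    then have "x \<in> frontier \<Omega>" using op interior_subset by (auto simp: frontier_def interior_open)
    then obtain r n \<psi> L where rn: "r > 0" "norm n = 1" "L-lipschitz_on {z. z \<bullet> n = 0} \<psi>"
      and chart: "\<Omega> \<inter> ball x r = {y \<in> ball x r. \<psi> (y - (y \<bullet> n) *\<^sub>R n) < y \<bullet> n}"
      using assms unfolding bounded_lipschitz_domain_def by blast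
    have nn: "n \<bullet> n = 1" using rn(2) by (simp add: norm_eq_1)
    define P where "P y = y - (y \<bullet> n) *\<^sub>R n" for y
    have contP: "continuous_on UNIV P" unfolding P_def by (intro continuous_intros)
    have "P ` UNIV \<subseteq> {z. z \<bullet> n = 0}" by (auto simp: P_def inner_diff_left nn)
    then have cont: "continuous_on UNIV (\<lambda>y. \<psi> (P y) - y \<bullet> n)"
      by (intro continuous_intros continuous_on_compose2[OF lipschitz_on_continuous_on[OF rn(3)] contP])
    have above: "\<psi> (P x) \<ge> x \<bullet> n"
    proof (rule ccontr)
      assume "\<not> ?thesis"
      then have "x \<in> {y \<in> ball x r. \<psi> (y - (y \<bullet> n) *\<^sub>R n) < y \<bullet> n}" using rn(1) by (simp add: P_def)
      then show False using x(2) chart by blast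
    qed
    obtain d where d: "d > 0" "ball x d \<subseteq> closure \<Omega>" using x(1) by (auto simp: mem_interior)
    define t where "t = min d r / 2"
    have t: "t > 0" "t < d" "t < r" using d rn by (auto simp: t_def)
    define y where "y = x - t *\<^sub>R n"
    have Py: "P y = P x" by (simp add: P_def y_def algebra_simps nn)
    have "\<psi> (P y) - y \<bullet> n > 0" using above t by (simp add: Py) (simp add: y_def algebra_simps nn)
    moreover have yx: "dist x y = t" using t rn by (simp add: y_def dist_norm)
    moreover have "open {y. \<psi> (P y) - y \<bullet> n > 0}" by (intro open_Collect_less continuous_on_const cont)
    ultimately have "y \<in> {y. \<psi> (P y) - y \<bullet> n > 0} \<inter> ball x r" "open ({y. \<psi> (P y) - y \<bullet> n > 0} \<inter> ball x r)"
      using t by auto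
    moreover have "y \<in> closure \<Omega>" using d t yx by auto
    ultimately have "\<Omega> \<inter> ({y. \<psi> (P y) - y \<bullet> n > 0} \<inter> ball x r) \<noteq> {}"
      using open_Int_closure_eq_empty[of "{y. \<psi> (P y) - y \<bullet> n > 0} \<inter> ball x r" \<Omega>] by auto
    then obtain z where z: "z \<in> \<Omega> \<inter> ball x r" "\<psi> (P z) - z \<bullet> n > 0" by blast
    then show False unfolding chart by (simp add: P_def)
  qed
qed

section \<open>Simplices, affine functions and open faces\<close>

lemma labeled_simplexD:
  fixes \<tau> :: "('a::euclidean_space, 't) lsimplex"
  assumes "labeled_simplex \<tau>"
  shows "\<not> affine_dependent (verts \<tau>)" "finite (verts \<tau>)" "verts \<tau> \<noteq> {}"
    "card (verts \<tau>) = DIM('a) + 1" "ref_edge \<tau> \<subseteq> verts \<tau>" "card (ref_edge \<tau>) = 2"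
  using assms by (auto simp: labeled_simplex_def intro: card_ge_0_finite)

lemma ref_edge_pair:
  assumes "labeled_simplex \<tau>" "p \<in> ref_edge \<tau>"
  obtains q where "ref_edge \<tau> = {p, q}" "p \<noteq> q"
proof -
  obtain x y where "ref_edge \<tau> = {x, y}" "x \<noteq> y"
    using labeled_simplexD(6)[OF assms(1)] by (auto simp: card_2_iff)
  then show ?thesis using that[of x] that[of y] assms(2) by (cases "p = x") (auto simp: insert_commute)
qed

lemma verts_child: "verts (child \<rho> \<tau> p) = insert (edge_mid (ref_edge \<tau>)) (verts \<tau> - {p})"
  by (simp add: child_def)

lemma edge_mid_pair: "p \<noteq> q \<Longrightarrow> edge_mid {p, q} = (1 / 2) *\<^sub>R p + (1 / 2) *\<^sub>R q"
  by (simp add: edge_mid_def scaleR_add_right)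

lemma edge_mid_neq: "p \<noteq> q \<Longrightarrow> edge_mid {p, q} \<noteq> p \<and> edge_mid {p, q} \<noteq> q"
  using midpoint_eq_endpoint[of p q] by (auto simp: edge_mid_def midpoint_def)

lemma compact_elem: "labeled_simplex \<tau> \<Longrightarrow> compact (elem \<tau>)"
  by (simp add: elem_def labeled_simplexD finite_imp_compact_convex_hull)

lemma verts_subset_elem: "verts \<tau> \<subseteq> elem \<tau>"
  by (simp add: elem_def hull_subset)

lemma affine_le_on_hull:
  assumes "x \<in> convex hull S" "\<And>v. v \<in> S \<Longrightarrow> b \<bullet> v + c \<le> b' \<bullet> v + (c' :: real)"
  shows "b \<bullet> x + c \<le> b' \<bullet> x + c'"
proof -
  have "convex hull S \<subseteq> {x. (b - b') \<bullet> x \<le> c' - c}"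
    using assms(2) by (intro hull_minimal convex_halfspace_le) (auto simp: algebra_simps)
  then show ?thesis using assms(1) by (auto simp: algebra_simps)
qed

lemma affine_eq_on_hull:
  assumes "x \<in> convex hull S" "\<And>v. v \<in> S \<Longrightarrow> b \<bullet> v + c = b' \<bullet> v + (c' :: real)"
  shows "b \<bullet> x + c = b' \<bullet> x + c'"
proof (rule antisym)
  show "b \<bullet> x + c \<le> b' \<bullet> x + c'" using assms(2) by (intro affine_le_on_hull[OF assms(1)]) simp
  show "b' \<bullet> x + c' \<le> b \<bullet> x + c" using assms(2) by (intro affine_le_on_hull[OF assms(1)]) simp
qed

text \<open>Moving one vertex to the origin turns affine into linear independence, so the data
  extend linearly. For 0-1 data the result is a barycentric coordinate.\<close>

lemma affine_extension:
  fixes S :: "'a::euclidean_space set" and g :: "'a \<Rightarrow> real"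
  assumes "\<not> affine_dependent S"
  shows "\<exists>b c. \<forall>v\<in>S. b \<bullet> v + c = g v"
proof (cases "S = {}")
  case False
  then obtain a where a: "a \<in> S" by blast
  then have "independent ((\<lambda>x. -a + x) ` (S - {a}))"
    using assms affine_dependent_iff_dependent2 by blast
  then obtain f where f: "linear f" "\<forall>w\<in>(\<lambda>x. -a + x) ` (S - {a}). f w = g (a + w) - g a"
    using linear_independent_extend[of _ "\<lambda>w. g (a + w) - g a"] by blast
  have fb: "f x = adjoint f 1 \<bullet> x" for x using adjoint_works[OF f(1), of x 1] by (simp add: inner_commute)
  have "adjoint f 1 \<bullet> v + (g a - adjoint f 1 \<bullet> a) = g v" if "v \<in> S" for v
  proof (cases "v = a")
    case False
    then have "-a + v \<in> (\<lambda>x. -a + x) ` (S - {a})" using that by blast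
    then have "f (-a + v) = g (a + (-a + v)) - g a" using f(2) by (rule bspec[rotated])
    then have "f (-a + v) = g v - g a" by simp
    then show ?thesis by (simp add: fb inner_diff_right)
  qed simp
  then show ?thesis by (intro exI ballI)
qed simp

text \<open>For affinely independent \<open>S\<close> this is the relative interior of the simplex.
  Positive coefficients make faces easy to follow under bisection.\<close>

definition open_simplex :: "'a::real_vector set \<Rightarrow> 'a set" where
  "open_simplex S = {x. \<exists>u. (\<forall>v\<in>S. 0 < u v) \<and> sum u S = 1 \<and> (\<Sum>v\<in>S. u v *\<^sub>R v) = x}"

lemma open_simplex_subset: "finite S \<Longrightarrow> open_simplex S \<subseteq> convex hull S"
  by (auto simp: open_simplex_def convex_hull_finite) (metis less_imp_le)

lemma convex_hull_open_simplex:
  assumes "finite S" "x \<in> convex hull S"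
  shows "\<exists>S'\<subseteq>S. x \<in> open_simplex S'"
proof -
  obtain u where u: "\<forall>v\<in>S. 0 \<le> u v" "sum u S = 1" "(\<Sum>v\<in>S. u v *\<^sub>R v) = x"
    using assms by (auto simp: convex_hull_finite)
  let ?S = "{v\<in>S. u v \<noteq> 0}"
  have "sum u ?S = sum u S" "(\<Sum>v\<in>?S. u v *\<^sub>R v) = (\<Sum>v\<in>S. u v *\<^sub>R v)"
    using assms(1) by (auto intro!: sum.mono_neutral_left)
  then have "x \<in> open_simplex ?S" using u by (auto simp: open_simplex_def intro!: exI[of _ u] order.not_eq_order_implies_strict)
  then show ?thesis by (intro exI[of _ ?S]) auto
qed

text \<open>An open face has points arbitrarily close to each of its vertices; through an interior
  vertex this forces the face to meet the domain.\<close>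

lemma open_simplex_toward_vertex:
  assumes "finite S" "x \<in> open_simplex S" "p \<in> S" "0 < t" "t \<le> 1"
  shows "(1 - t) *\<^sub>R p + t *\<^sub>R x \<in> open_simplex S"
proof -
  obtain u where u: "\<forall>v\<in>S. 0 < u v" "sum u S = 1" "(\<Sum>v\<in>S. u v *\<^sub>R v) = x"
    using assms by (auto simp: open_simplex_def)
  let ?w = "\<lambda>v. (if v = p then 1 - t else 0) + t * u v"
  have "sum ?w S = 1" using assms u by (simp add: sum.distrib flip: sum_distrib_left)
  moreover have "(\<Sum>v\<in>S. ?w v *\<^sub>R v) = (\<Sum>v\<in>S. (if v = p then (1 - t) *\<^sub>R p else 0)) + t *\<^sub>R (\<Sum>v\<in>S. u v *\<^sub>R v)"
    unfolding scaleR_sum_right sum.distrib[symmetric] by (intro sum.cong) (auto simp: algebra_simps)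
  moreover have "\<forall>v\<in>S. 0 < ?w v" using assms u by (auto simp: add_nonneg_pos)
  ultimately show ?thesis using assms u unfolding open_simplex_def
    by (intro CollectI exI[of _ ?w]) simp
qed

section \<open>Hat functions and nodal grids\<close>

abbreviation vertices :: "('a, 't) lsimplex set \<Rightarrow> 'a set" where
  "vertices \<T> \<equiv> (\<Union>\<tau>\<in>\<T>. verts \<tau>)"

definition hat_function ::
  "'a::euclidean_space set \<Rightarrow> ('a, 't) lsimplex set \<Rightarrow> 'a \<Rightarrow> ('a \<Rightarrow> real) \<Rightarrow> bool" where
  "hat_function \<Omega> \<T> p \<psi> \<longleftrightarrow> continuous_on (closure \<Omega>) \<psi> \<and>
     (\<forall>\<tau>\<in>\<T>. \<exists>b c. \<forall>x\<in>elem \<tau>. \<psi> x = b \<bullet> x + c) \<and>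
     (\<forall>q\<in>vertices \<T>. \<psi> q = (if q = p then 1 else 0))"

text \<open>A substitute for conformity that is easily seen to be inherited under compatible bisection. Hat
  functions are required at the boundary vertices, too, since the endpoints of an edge with interior
  midpoint may both lie on the boundary.\<close>

definition nodal_grid :: "'a::euclidean_space set \<Rightarrow> ('a, 't) lsimplex set \<Rightarrow> bool" where
  "nodal_grid \<Omega> \<T> \<longleftrightarrow>
     finite \<T> \<and> (\<forall>\<tau>\<in>\<T>. labeled_simplex \<tau>) \<and> (\<Union>\<tau>\<in>\<T>. elem \<tau>) = closure \<Omega> \<and>
     (\<forall>p\<in>vertices \<T>. \<exists>\<psi>. hat_function \<Omega> \<T> p \<psi>) \<and>
     (\<forall>\<tau>\<in>\<T>. \<forall>S\<subseteq>verts \<tau>. open_simplex S \<inter> \<Omega> \<noteq> {} \<longrightarrow> open_simplex S \<subseteq> \<Omega>)"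

lemma nodal_gridD:
  assumes "nodal_grid \<Omega> \<T>"
  shows "finite \<T>" "\<And>\<tau>. \<tau> \<in> \<T> \<Longrightarrow> labeled_simplex \<tau>" "(\<Union>\<tau>\<in>\<T>. elem \<tau>) = closure \<Omega>"
    "\<And>p. p \<in> vertices \<T> \<Longrightarrow> \<exists>\<psi>. hat_function \<Omega> \<T> p \<psi>"
  using assms unfolding nodal_grid_def by auto

lemma nodal_grid_face:
  assumes "nodal_grid \<Omega> \<T>" "\<tau> \<in> \<T>" "S \<subseteq> verts \<tau>" "x \<in> open_simplex S" "x \<in> \<Omega>"
  shows "open_simplex S \<subseteq> \<Omega>"
  using assms unfolding nodal_grid_def by (metis disjoint_iff)

lemma hat_vertex:
  "hat_function \<Omega> \<T> p \<psi> \<Longrightarrow> \<tau> \<in> \<T> \<Longrightarrow> q \<in> verts \<tau> \<Longrightarrow> \<psi> q = (if q = p then 1 else 0)"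
  by (auto simp: hat_function_def)

lemma hat_nonneg:
  assumes "hat_function \<Omega> \<T> p \<psi>" "\<tau> \<in> \<T>" "x \<in> elem \<tau>"
  shows "0 \<le> \<psi> x"
proof -
  obtain b c where bc: "\<forall>x\<in>elem \<tau>. \<psi> x = b \<bullet> x + c" using assms unfolding hat_function_def by blast
  have "0 \<bullet> x + 0 \<le> b \<bullet> x + c"
  proof (rule affine_le_on_hull)
    show "x \<in> convex hull (verts \<tau>)" using assms by (simp add: elem_def)
    show "0 \<bullet> v + 0 \<le> b \<bullet> v + c" if "v \<in> verts \<tau>" for v
      using hat_vertex[OF assms(1,2) that] bc that verts_subset_elem[of \<tau>] by (auto split: if_splits)
  qed
  then show ?thesis using bc assms by simp
qed

lemma hat_eq_0:
  assumes "hat_function \<Omega> \<T> p \<psi>" "\<tau> \<in> \<T>" "x \<in> convex hull S" "S \<subseteq> verts \<tau>" "p \<notin> S"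
  shows "\<psi> x = 0"
proof -
  obtain b c where bc: "\<forall>x\<in>elem \<tau>. \<psi> x = b \<bullet> x + c" using assms unfolding hat_function_def by blast
  have "b \<bullet> x + c = 0 \<bullet> x + 0"
  proof (rule affine_eq_on_hull[OF assms(3)])
    show "b \<bullet> v + c = 0 \<bullet> v + 0" if "v \<in> S" for v
    proof -
      have "v \<in> verts \<tau>" using assms that by blast
      then show ?thesis
        using hat_vertex[OF assms(1,2), of v] assms(5) that bc verts_subset_elem[of \<tau>] by auto
    qed
  qed
  moreover have "x \<in> elem \<tau>" using assms(3,4) hull_mono unfolding elem_def by blast
  ultimately show ?thesis using bc by simp
qed

text \<open>Hat functions are 0 or 1 at vertices, and 0 on elements that lack their vertex. The
  value 1/2 therefore certifies that the midpoint is neither a vertex nor a point of an element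
  lacking an endpoint of the edge.\<close>

lemma hat_midpoint:
  assumes "hat_function \<Omega> \<T> p \<psi>" "\<tau> \<in> \<T>" "p \<in> verts \<tau>" "q \<in> verts \<tau>" "p \<noteq> q"
  shows "\<psi> (edge_mid {p, q}) = 1 / 2"
proof -
  obtain b c where bc: "\<forall>x\<in>elem \<tau>. \<psi> x = b \<bullet> x + c" using assms unfolding hat_function_def by blast
  have pq: "p \<in> elem \<tau>" "q \<in> elem \<tau>" using assms verts_subset_elem[of \<tau>] by auto
  then have "edge_mid {p, q} \<in> elem \<tau>"
    using assms(5) unfolding edge_mid_pair[OF assms(5)] elem_def by (intro convexD) auto
  then have "\<psi> (edge_mid {p, q}) = (1 / 2) * \<psi> p + (1 / 2) * \<psi> q"
    using bc pq by (simp add: edge_mid_pair[OF assms(5)] inner_add_right algebra_simps)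
  then show ?thesis using assms by (auto simp: hat_function_def)
qed

text \<open>As a face of each simplex the intersection is the hull of some vertices of either; the
  two vertex sets agree because both consist of its extreme points.\<close>

lemma conforming_inter:
  assumes "conforming \<Omega> \<T>" "\<tau> \<in> \<T>" "\<tau>' \<in> \<T>"
  obtains S where "S \<subseteq> verts \<tau>" "S \<subseteq> verts \<tau>'" "elem \<tau> \<inter> elem \<tau>' = convex hull S"
proof -
  have tri: "triangulation (elem ` \<T>)" and lab: "\<forall>\<tau>\<in>\<T>. labeled_simplex \<tau>"
    using assms(1) by (auto simp: conforming_def)
  have "(elem \<tau> \<inter> elem \<tau>') face_of elem \<tau>" "(elem \<tau>' \<inter> elem \<tau>) face_of elem \<tau>'"
    using tri assms unfolding triangulation_def by blast+
  moreover have ind: "\<not> affine_dependent (verts \<tau>)" "\<not> affine_dependent (verts \<tau>')"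
    using lab assms labeled_simplexD(1) by blast+
  ultimately obtain S S' where S: "S \<subseteq> verts \<tau>" "elem \<tau> \<inter> elem \<tau>' = convex hull S"
    and S': "S' \<subseteq> verts \<tau>'" "elem \<tau>' \<inter> elem \<tau> = convex hull S'"
    unfolding elem_def by (auto simp: face_of_convex_hull_affine_independent)
  have "\<not> affine_dependent S" "\<not> affine_dependent S'"
    using ind S(1) S'(1) affine_independent_subset by blast+
  then have "S = {x. x extreme_point_of (convex hull S)}" "S' = {x. x extreme_point_of (convex hull S')}"
    by (simp_all add: extreme_point_of_convex_hull_affine_independent)
  moreover have "convex hull S = convex hull S'" using S(2) S'(2) by blast
  ultimately have "S = S'" by simp
  then show ?thesis using that S S' by blast
qed

text \<open>The elementwise affine functions with the right vertex values agree on intersections,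
  which are spanned by common vertices, and therefore glue.\<close>

lemma conforming_hat:
  assumes "conforming \<Omega> \<T>"
  shows "\<exists>\<psi>. hat_function \<Omega> \<T> p \<psi>"
proof -
  have lab: "\<And>\<tau>. \<tau> \<in> \<T> \<Longrightarrow> labeled_simplex \<tau>" and fin: "finite \<T>"
    and cover: "(\<Union>\<tau>\<in>\<T>. elem \<tau>) = closure \<Omega>" using assms by (auto simp: conforming_def)
  have "\<forall>\<tau>\<in>\<T>. \<exists>b c. \<forall>v\<in>verts \<tau>. b \<bullet> v + c = (if v = p then 1 else 0)"
    using affine_extension[of _ "\<lambda>v. if v = p then 1 else 0"] labeled_simplexD(1)[OF lab] by blast
  then obtain b c where bc: "\<And>\<tau> v. \<tau> \<in> \<T> \<Longrightarrow> v \<in> verts \<tau> \<Longrightarrow> b \<tau> \<bullet> v + c \<tau> = (if v = p then 1 else (0::real))"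
    by metis
  define \<psi> where "\<psi> x = (let \<tau> = SOME \<tau>. \<tau> \<in> \<T> \<and> x \<in> elem \<tau> in b \<tau> \<bullet> x + c \<tau>)" for x
  have consistent: "b \<tau> \<bullet> x + c \<tau> = b \<tau>' \<bullet> x + c \<tau>'"
    if \<tau>\<tau>: "\<tau> \<in> \<T>" "\<tau>' \<in> \<T>" "x \<in> elem \<tau>" "x \<in> elem \<tau>'" for \<tau> \<tau>' x
  proof -
    obtain S where "S \<subseteq> verts \<tau>" "S \<subseteq> verts \<tau>'" "elem \<tau> \<inter> elem \<tau>' = convex hull S"
      using conforming_inter[OF assms \<tau>\<tau>(1,2)] .
    then show ?thesis using \<tau>\<tau> bc by (intro affine_eq_on_hull[of x S]) (auto simp: subset_iff)
  qed
  have \<psi>: "\<psi> x = b \<tau> \<bullet> x + c \<tau>" if "\<tau> \<in> \<T>" "x \<in> elem \<tau>" for \<tau> x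
  proof -
    have "(SOME \<tau>. \<tau> \<in> \<T> \<and> x \<in> elem \<tau>) \<in> \<T> \<and> x \<in> elem (SOME \<tau>. \<tau> \<in> \<T> \<and> x \<in> elem \<tau>)"
      by (rule someI) (use that in blast)
    then show ?thesis unfolding \<psi>_def Let_def using that by (intro consistent) simp_all
  qed
  have "continuous_on (\<Union>\<tau>\<in>\<T>. elem \<tau>) \<psi>"
  proof (rule continuous_on_closed_Union[OF fin])
    show "closed (elem \<tau>)" if "\<tau> \<in> \<T>" for \<tau> using that lab compact_elem compact_imp_closed by blast
    show "continuous_on (elem \<tau>) \<psi>" if "\<tau> \<in> \<T>" for \<tau>
      by (rule continuous_on_eq[where f = "\<lambda>x. b \<tau> \<bullet> x + c \<tau>"]) (use \<psi>[OF that] in \<open>auto intro!: continuous_intros\<close>)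
  qed
  moreover have "\<psi> q = (if q = p then 1 else 0)" if "\<tau> \<in> \<T>" "q \<in> verts \<tau>" for \<tau> q
    using \<psi>[OF that(1)] bc[OF that] that verts_subset_elem[of \<tau>] by auto
  moreover have "\<exists>b c. \<forall>x\<in>elem \<tau>. \<psi> x = b \<bullet> x + c" if "\<tau> \<in> \<T>" for \<tau>
    using \<psi>[OF that] by blast
  ultimately have "hat_function \<Omega> \<T> p \<psi>" unfolding hat_function_def cover by blast
  then show ?thesis by blast
qed

text \<open>The substantial point is that an open face meeting the domain stays inside it: any point
  of the face is shown to be interior to the closure, and a Lipschitz domain is the interior of its
  closure.\<close>

lemma nodal_grid_conforming:
  assumes "bounded_lipschitz_domain \<Omega>" "conforming \<Omega> \<T>"
  shows "nodal_grid \<Omega> \<T>"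
  unfolding nodal_grid_def
proof (intro conjI ballI allI impI subsetI)
  have lab: "\<And>\<tau>. \<tau> \<in> \<T> \<Longrightarrow> labeled_simplex \<tau>" and fin: "finite \<T>"
    and cover: "(\<Union>\<tau>\<in>\<T>. elem \<tau>) = closure \<Omega>" using assms by (auto simp: conforming_def)
  show "finite \<T>" "(\<Union>\<tau>\<in>\<T>. elem \<tau>) = closure \<Omega>" by fact+
  show "labeled_simplex \<tau>" if "\<tau> \<in> \<T>" for \<tau> using that lab by blast
  show "\<exists>\<psi>. hat_function \<Omega> \<T> p \<psi>" for p using conforming_hat assms by blast
  fix \<tau> S x assume \<tau>: "\<tau> \<in> \<T>" and S: "S \<subseteq> verts \<tau>" and "open_simplex S \<inter> \<Omega> \<noteq> {}" and x: "x \<in> open_simplex S"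
  then obtain y where y: "y \<in> open_simplex S" "y \<in> \<Omega>" by blast
  have op: "open \<Omega>" using assms by (simp add: bounded_lipschitz_domain_def)
  have finS: "finite S" using S labeled_simplexD(2)[OF lab[OF \<tau>]] finite_subset by blast
  obtain a where a: "\<And>v. v \<in> S \<Longrightarrow> 0 < a v" "sum a S = 1" "(\<Sum>v\<in>S. a v *\<^sub>R v) = x"
    using x by (auto simp: open_simplex_def)
  obtain b where b: "\<And>v. v \<in> S \<Longrightarrow> 0 < b v" "sum b S = 1" "(\<Sum>v\<in>S. b v *\<^sub>R v) = y"
    using y by (auto simp: open_simplex_def)
  \<comment> \<open>Removing the elements that miss \<open>y\<close> leaves a ball around
    \<open>y\<close> met only by elements that contain \<open>y\<close>.\<close>
  define K where "K = (\<Union>\<tau>'\<in>{\<tau>'\<in>\<T>. y \<notin> elem \<tau>'}. elem \<tau>')"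
  have "closed K" unfolding K_def using fin lab compact_elem compact_imp_closed by (intro closed_UN) auto
  then have "open (\<Omega> - K)" using op by blast
  moreover have "y \<in> \<Omega> - K" using y by (auto simp: K_def)
  ultimately obtain \<epsilon> where \<epsilon>: "\<epsilon> > 0" "ball y \<epsilon> \<subseteq> \<Omega> - K" using open_contains_ball by blast
  \<comment> \<open>The barycentric coordinate of \<open>y\<close> at \<open>v\<close> is positive,
    but would vanish if the face shared with \<open>\<tau>'\<close> did not have \<open>v\<close> as
    a vertex.\<close>
  have star: "S \<subseteq> verts \<tau>'" if \<tau>': "\<tau>' \<in> \<T>" "y \<in> elem \<tau>'" for \<tau>'
  proof
    fix v assume v: "v \<in> S"
    obtain S' where S': "S' \<subseteq> verts \<tau>" "S' \<subseteq> verts \<tau>'" "elem \<tau> \<inter> elem \<tau>' = convex hull S'"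
      using conforming_inter[OF assms(2) \<tau> \<tau>'(1)] .
    have "y \<in> elem \<tau>" using open_simplex_subset[OF finS] y(1) hull_mono[OF S] by (auto simp: elem_def)
    then have yS': "y \<in> convex hull S'" using S' \<tau>' by blast
    obtain d k where dk: "\<forall>w\<in>verts \<tau>. d \<bullet> w + k = (if w = v then 1 else (0::real))"
      using affine_extension[OF labeled_simplexD(1)[OF lab[OF \<tau>]], of "\<lambda>w. if w = v then 1 else 0"] by blast
    have "d \<bullet> y + k = (\<Sum>w\<in>S. b w * (d \<bullet> w + k))"
      using b(2) by (simp add: b(3)[symmetric] inner_sum_right distrib_left sum.distrib flip: sum_distrib_right)
    also have "\<dots> = (\<Sum>w\<in>S. if w = v then b v else 0)" using dk S by (intro sum.cong) auto
    also have "\<dots> = b v" using v finS by simp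
    finally have pos: "d \<bullet> y + k > 0" using b(1) v by simp
    have "v \<in> S'"
    proof (rule ccontr)
      assume "v \<notin> S'"
      then have "d \<bullet> y + k = 0 \<bullet> y + 0" using dk S'(1) by (intro affine_eq_on_hull[OF yS']) auto
      then show False using pos by simp
    qed
    then show "v \<in> verts \<tau>'" using S' by blast
  qed
  \<comment> \<open>Chosen so that all coefficients \<open>a v - \<kappa> * b v\<close> are
    nonnegative; then \<open>x + \<kappa> w\<close> is a convex combination of \<open>y + w\<close>
    and the points of \<open>S\<close>.\<close>
  define \<kappa> where "\<kappa> = Min (insert 1 ((\<lambda>v. a v / b v) ` S))"
  have \<kappa>pos: "\<kappa> > 0" unfolding \<kappa>_def using finS a b by simp
  have \<kappa>le: "\<kappa> * b v \<le> a v" if "v \<in> S" for v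
  proof -
    have "\<kappa> \<le> a v / b v" unfolding \<kappa>_def using finS that by simp
    then show ?thesis using b(1)[OF that] by (simp add: field_simps)
  qed
  \<comment> \<open>The elements around \<open>y\<close> contain \<open>S\<close>, so they contain, with a ball around \<open>y\<close>, its
    homothetic image with centre in \<open>open_simplex S\<close> around \<open>x\<close>.\<close>
  have "ball x (\<kappa> * \<epsilon>) \<subseteq> closure \<Omega>"
  proof
    fix z assume z: "z \<in> ball x (\<kappa> * \<epsilon>)"
    define w where "w = (1 / \<kappa>) *\<^sub>R (z - x)"
    have zw: "z = x + \<kappa> *\<^sub>R w" using \<kappa>pos by (simp add: w_def)
    have "norm w < \<epsilon>" using z \<kappa>pos by (simp add: w_def dist_norm norm_minus_commute pos_divide_less_eq mult.commute)
    then have yw: "y + w \<in> ball y \<epsilon>" by (simp add: dist_norm)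
    then have "y + w \<in> closure \<Omega>" using \<epsilon>(2) closure_subset by blast
    then obtain \<tau>' where \<tau>': "\<tau>' \<in> \<T>" "y + w \<in> elem \<tau>'" using cover by blast
    then have "y \<in> elem \<tau>'" using yw \<epsilon>(2) by (auto simp: K_def)
    then have S': "S \<subseteq> elem \<tau>'" using star[OF \<tau>'(1)] verts_subset_elem[of \<tau>'] by blast
    \<comment> \<open>\<open>None\<close> stands for the point \<open>y + w\<close> and
      \<open>Some v\<close> for the vertex \<open>v\<close>, so that a coincidence of the two does
      no harm.\<close>
    let ?c = "case_option \<kappa> (\<lambda>v. a v - \<kappa> * b v)" and ?y = "case_option (y + w) (\<lambda>v. v)"
    have "(\<Sum>i\<in>insert None (Some ` S). ?c i *\<^sub>R ?y i) \<in> elem \<tau>'"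
    proof (rule convex_sum)
      show "convex (elem \<tau>')" by (simp add: elem_def)
      show "(\<Sum>i\<in>insert None (Some ` S). ?c i) = 1"
        using finS a(2) b(2) by (simp add: sum.reindex sum_subtractf flip: sum_distrib_left)
    qed (use finS \<kappa>le \<kappa>pos S' \<tau>' in auto)
    also have "(\<Sum>i\<in>insert None (Some ` S). ?c i *\<^sub>R ?y i) = z"
      using finS a(3) b(3)
      by (simp add: sum.reindex sum_subtractf scaleR_left_diff_distrib zw scaleR_add_right
          flip: scaleR_scaleR scaleR_sum_right)
    finally show "z \<in> closure \<Omega>" using \<tau>' cover by blast
  qed
  then have "x \<in> interior (closure \<Omega>)" using \<kappa>pos \<epsilon>(1) mem_interior mult_pos_pos by blast
  then show "x \<in> \<Omega>" using interior_closure_lipschitz_domain[OF assms(1)] by simp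
qed

section \<open>Bisection of simplices and grids\<close>

lemma labeled_child:
  fixes \<tau> :: "('a::euclidean_space, 't) lsimplex"
  assumes "labeled_simplex \<tau>" "admissible_rule \<rho>" "p \<in> ref_edge \<tau>"
  shows "labeled_simplex (child \<rho> \<tau> p)"
proof -
  note \<tau> = labeled_simplexD[OF assms(1)]
  obtain q where q: "ref_edge \<tau> = {p, q}" "p \<noteq> q" using ref_edge_pair[OF assms(1,3)] .
  define m where "m = edge_mid (ref_edge \<tau>)"
  have m: "m = (1 / 2) *\<^sub>R p + (1 / 2) *\<^sub>R q" using q by (simp add: m_def edge_mid_pair)
  have pq: "p \<in> verts \<tau>" "q \<in> verts \<tau>" using q \<tau>(5) by auto
  \<comment> \<open>Otherwise \<open>p = 2 m - q\<close> would lie in the affine hull of the other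
    vertices.\<close>
  have notin: "m \<notin> affine hull (verts \<tau> - {p})"
  proof
    assume "m \<in> affine hull (verts \<tau> - {p})"
    moreover have "q \<in> affine hull (verts \<tau> - {p})" using pq q by (intro hull_inc) auto
    ultimately have "2 *\<^sub>R m + (- 1) *\<^sub>R q \<in> affine hull (verts \<tau> - {p})"
      by (intro mem_affine) auto
    also have "2 *\<^sub>R m + (- 1) *\<^sub>R q = p" by (simp add: m algebra_simps)
    finally show False using \<tau>(1) pq unfolding affine_dependent_def by blast
  qed
  then have "\<not> affine_dependent (insert m (verts \<tau> - {p}))"
    using \<tau>(1) by (intro affine_independent_insert affine_independent_Diff) auto
  moreover have "m \<notin> verts \<tau> - {p}" using notin hull_inc[of m "verts \<tau> - {p}" affine] by blast
  then have "card (insert m (verts \<tau> - {p})) = DIM('a) + 1"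
    using \<tau>(2,4) pq by simp
  moreover have "ref_edge (child \<rho> \<tau> p) \<subseteq> verts (child \<rho> \<tau> p) \<and> card (ref_edge (child \<rho> \<tau> p)) = 2"
    using assms unfolding admissible_rule_def by blast
  ultimately show ?thesis unfolding labeled_simplex_def by (simp add: verts_child m_def)
qed

lemma elem_child_subset:
  assumes "labeled_simplex \<tau>" "p \<in> ref_edge \<tau>"
  shows "elem (child \<rho> \<tau> p) \<subseteq> elem \<tau>"
proof -
  note \<tau> = labeled_simplexD[OF assms(1)]
  obtain q where q: "ref_edge \<tau> = {p, q}" "p \<noteq> q" using ref_edge_pair[OF assms] .
  have pq: "p \<in> convex hull (verts \<tau>)" "q \<in> convex hull (verts \<tau>)"
    using q \<tau>(5) by (auto intro: hull_inc)
  then have "(1 / 2) *\<^sub>R p + (1 / 2) *\<^sub>R q \<in> convex hull (verts \<tau>)" by (intro convexD) auto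
  then have "insert ((1 / 2) *\<^sub>R p + (1 / 2) *\<^sub>R q) (verts \<tau> - {p}) \<subseteq> convex hull (verts \<tau>)"
    by (auto intro: hull_inc)
  then show ?thesis using q(2) by (simp add: elem_def verts_child q(1) edge_mid_pair hull_minimal)
qed

text \<open>A point lies in the child that gives up the endpoint \<open>p\<close> with the smaller
  coordinate: \<open>u p p + u q q = 2 u p m + (u q - u p) q\<close>.\<close>

lemma elem_bisect:
  assumes "labeled_simplex \<tau>"
  shows "(\<Union>\<tau>'\<in>bisect \<rho> \<tau>. elem \<tau>') = elem \<tau>"
proof
  show "(\<Union>\<tau>'\<in>bisect \<rho> \<tau>. elem \<tau>') \<subseteq> elem \<tau>"
    using elem_child_subset[OF assms] by (auto simp: bisect_def)
  note \<tau> = labeled_simplexD[OF assms]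
  obtain a b where ab: "ref_edge \<tau> = {a, b}" "a \<noteq> b" using \<tau>(6) by (auto simp: card_2_iff)
  show "elem \<tau> \<subseteq> (\<Union>\<tau>'\<in>bisect \<rho> \<tau>. elem \<tau>')"
  proof
    fix x assume "x \<in> elem \<tau>"
    then obtain u where u: "\<forall>v\<in>verts \<tau>. 0 \<le> u v" "sum u (verts \<tau>) = 1" "(\<Sum>v\<in>verts \<tau>. u v *\<^sub>R v) = x"
      using \<tau>(2) by (auto simp: elem_def convex_hull_finite)
    obtain p q where pq: "{p, q} = {a, b}" "p \<noteq> q" "u p \<le> u q"
      using ab(2) by (metis insert_commute linear)
    have pqv: "p \<in> verts \<tau>" "q \<in> verts \<tau>" using pq ab \<tau>(5) by auto
    define m where "m = (1 / 2) *\<^sub>R p + (1 / 2) *\<^sub>R q"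
    have m: "edge_mid (ref_edge \<tau>) = m" using pq ab by (metis edge_mid_pair m_def)
    define C where "C = convex hull (insert m (verts \<tau> - {p}))"
    define w where "w v = (if v = p then 2 * u p else if v = q then u q - u p else u v)" for v
    \<comment> \<open>Replacing \<open>p\<close> by \<open>m\<close> in the summand rather than in
      the index set keeps both combinations indexed by \<open>verts \<tau>\<close>.\<close>
    define y where "y v = (if v = p then m else v)" for v
    have split: "(\<Sum>v\<in>verts \<tau>. f v) = f p + (f q + (\<Sum>v\<in>verts \<tau> - {p} - {q}. f v))" for f :: "'a \<Rightarrow> 'c::comm_monoid_add"
      using \<tau>(2) pqv pq(2) by (simp add: sum.remove[of _ p] sum.remove[of _ q])
    have "(\<Sum>v\<in>verts \<tau>. w v *\<^sub>R y v) \<in> C"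
    proof (rule convex_sum)
      show "convex C" by (simp add: C_def)
      have "(\<Sum>v\<in>verts \<tau> - {p} - {q}. w v) = (\<Sum>v\<in>verts \<tau> - {p} - {q}. u v)"
        by (intro sum.cong) (auto simp: w_def)
      then show "sum w (verts \<tau>) = 1" using u(2) pq(2) by (simp add: split w_def)
      show "0 \<le> w v" if "v \<in> verts \<tau>" for v using u(1) pq pqv that by (auto simp: w_def)
      show "y v \<in> C" if "v \<in> verts \<tau>" for v
        using that by (auto simp: C_def y_def intro!: hull_inc)
    qed (use \<tau> in auto)
    also have "(\<Sum>v\<in>verts \<tau> - {p} - {q}. w v *\<^sub>R y v) = (\<Sum>v\<in>verts \<tau> - {p} - {q}. u v *\<^sub>R v)"
      by (intro sum.cong) (auto simp: w_def y_def)
    then have "(\<Sum>v\<in>verts \<tau>. w v *\<^sub>R y v) = x"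
      unfolding u(3)[symmetric] split using pq(2) by (simp add: w_def y_def m_def algebra_simps)
    finally have "x \<in> elem (child \<rho> \<tau> p)" by (simp add: C_def elem_def child_def m)
    then show "x \<in> (\<Union>\<tau>'\<in>bisect \<rho> \<tau>. elem \<tau>')" using pq ab by (auto simp: bisect_def)
  qed
qed

text \<open>The coefficient of the midpoint is shared equally between \<open>p\<close> and
  \<open>q\<close>, so an open face of a child with the midpoint as vertex lies in an open face of
  the parent. Whether \<open>q\<close> already belongs to \<open>S\<close> is left open, hence
  \<open>uq\<close>.\<close>

lemma open_simplex_midpoint:
  assumes "finite S" "p \<noteq> q" "p \<notin> S" "edge_mid {p, q} \<in> S" "edge_mid {p, q} \<noteq> q"
  shows "open_simplex S \<subseteq> open_simplex (insert p (insert q (S - {edge_mid {p, q}})))"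
proof
  fix x assume "x \<in> open_simplex S"
  then obtain u where u: "\<forall>v\<in>S. 0 < u v" "sum u S = 1" "(\<Sum>v\<in>S. u v *\<^sub>R v) = x"
    by (auto simp: open_simplex_def)
  define m where "m = edge_mid {p, q}"
  have m: "m = (1 / 2) *\<^sub>R p + (1 / 2) *\<^sub>R q" using assms(2) by (simp add: m_def edge_mid_pair)
  define R where "R = S - {m} - {q}"
  define uq where "uq = (if q \<in> S then u q else 0)"
  define w where "w v = (if v = p then u m / 2 else if v = q then u m / 2 + uq else u v)" for v
  have split: "(\<Sum>v\<in>S. f v) = f m + ((if q \<in> S then f q else 0) + sum f R)" for f :: "'a \<Rightarrow> 'c::comm_monoid_add"
    using assms unfolding R_def m_def[symmetric]
    by (simp add: sum.remove[of S m] sum.remove[of "S - {m}" q])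
  have S': "insert p (insert q (S - {m})) = insert p (insert q R)" by (auto simp: R_def)
  have R: "p \<notin> R" "q \<notin> R" "finite R" using assms by (auto simp: R_def)
  have split': "(\<Sum>v\<in>insert p (insert q R). f v) = f p + (f q + sum f R)" for f :: "'a \<Rightarrow> 'c::comm_monoid_add"
    using R assms(2) by simp
  have eqR: "sum w R = sum u R" "(\<Sum>v\<in>R. w v *\<^sub>R v) = (\<Sum>v\<in>R. u v *\<^sub>R v)"
    using R by (auto intro!: sum.cong simp: w_def)
  have "sum w (insert p (insert q R)) = 1"
    unfolding split' eqR using u(2) assms(2) by (simp add: split w_def uq_def)
  moreover have "(\<Sum>v\<in>insert p (insert q R). w v *\<^sub>R v) = x"
    unfolding split' eqR u(3)[symmetric] split using assms(2)
    by (simp add: w_def uq_def m algebra_simps)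
  moreover have "\<forall>v\<in>insert p (insert q R). 0 < w v"
    using u(1) assms by (auto simp: w_def uq_def R_def m_def add_pos_nonneg less_imp_le)
  ultimately show "x \<in> open_simplex (insert p (insert q (S - {edge_mid {p, q}})))"
    unfolding m_def[symmetric] S' open_simplex_def by blast
qed

lemma compatible_bisection_cases:
  assumes "\<tau>' \<in> compatible_bisection \<rho> \<T> e" "compatible_edge \<T> e" "\<And>\<tau>. \<tau> \<in> \<T> \<Longrightarrow> labeled_simplex \<tau>"
  obtains (old) "\<tau>' \<in> \<T>" "\<not> e \<subseteq> verts \<tau>'"
    | (new) \<tau> p q where "\<tau> \<in> \<T>" "e \<subseteq> verts \<tau>" "ref_edge \<tau> = e" "e = {p, q}" "p \<noteq> q" "\<tau>' = child \<rho> \<tau> p"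
proof -
  from assms(1) consider "\<tau>' \<in> \<T>" "\<not> e \<subseteq> verts \<tau>'"
    | \<tau> p where "\<tau> \<in> \<T>" "e \<subseteq> verts \<tau>" "p \<in> ref_edge \<tau>" "\<tau>' = child \<rho> \<tau> p"
    by (auto simp: compatible_bisection_def refine_def bisect_def)
  then show ?thesis
  proof cases
    case 1
    then show ?thesis by (rule old)
  next
    case (2 \<tau> p)
    moreover have e: "ref_edge \<tau> = e" using 2 assms(2) by (auto simp: compatible_edge_def)
    moreover obtain q where "e = {p, q}" "p \<noteq> q"
      using ref_edge_pair[OF assms(3)[OF 2(1)] 2(3)] e by metis
    ultimately show ?thesis using new by blast
  qed
qed

lemma compatible_edge_pair:
  assumes "compatible_edge \<T> e" "\<And>\<tau>. \<tau> \<in> \<T> \<Longrightarrow> labeled_simplex \<tau>"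
  obtains \<tau> a b where "\<tau> \<in> \<T>" "e = {a, b}" "a \<noteq> b" "a \<in> verts \<tau>" "b \<in> verts \<tau>" "ref_edge \<tau> = e"
proof -
  obtain \<tau> where \<tau>: "\<tau> \<in> \<T>" "e \<subseteq> verts \<tau>" "ref_edge \<tau> = e" using assms(1) by (auto simp: compatible_edge_def)
  obtain a b where "e = {a, b}" "a \<noteq> b"
    using labeled_simplexD(6)[OF assms(2)[OF \<tau>(1)]] \<tau>(3) by (auto simp: card_2_iff)
  then show ?thesis using that \<tau> by blast
qed

text \<open>New faces lie in open faces of the old grid. The midpoint \<open>m\<close> receives a
  new hat function, and each old one is corrected by a multiple of it so as to vanish at
  \<open>m\<close>.\<close>

lemma nodal_grid_step:
  fixes \<T> :: "('a::euclidean_space, 't) lsimplex set"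
  assumes grid: "nodal_grid \<Omega> \<T>" and rule: "admissible_rule \<rho>" and comp: "compatible_edge \<T> e"
  shows "nodal_grid \<Omega> (compatible_bisection \<rho> \<T> e)"
proof -
  note fin = nodal_gridD(1)[OF grid] and lab = nodal_gridD(2)[OF grid]
    and cover = nodal_gridD(3)[OF grid] and hats = nodal_gridD(4)[OF grid]
  define \<T>' where "\<T>' = compatible_bisection \<rho> \<T> e"
  define m where "m = edge_mid e"
  have cases: P if "\<tau>' \<in> \<T>'" "\<tau>' \<in> \<T> \<Longrightarrow> \<not> e \<subseteq> verts \<tau>' \<Longrightarrow> P"
    "\<And>\<tau> p q. \<tau> \<in> \<T> \<Longrightarrow> e \<subseteq> verts \<tau> \<Longrightarrow> ref_edge \<tau> = e \<Longrightarrow> e = {p, q} \<Longrightarrow> p \<noteq> q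
      \<Longrightarrow> \<tau>' = child \<rho> \<tau> p \<Longrightarrow> P" for \<tau>' P
    using compatible_bisection_cases[OF that(1)[unfolded \<T>'_def] comp lab] that(2,3) by metis
  note cases = cases[consumes 1, case_names old new]
  have fin': "finite \<T>'" using fin labeled_simplexD(2,5)[OF lab] finite_subset
    by (fastforce simp: \<T>'_def compatible_bisection_def refine_def bisect_def)
  have lab': "labeled_simplex \<tau>'" if "\<tau>' \<in> \<T>'" for \<tau>'
    using that by (cases rule: cases) (auto intro: lab labeled_child rule)
  have cover': "(\<Union>\<tau>\<in>\<T>'. elem \<tau>) = closure \<Omega>"
  proof -
    have "(\<Union>\<tau>\<in>\<T>'. elem \<tau>) = (\<Union>\<tau>\<in>{\<tau>\<in>\<T>. \<not> e \<subseteq> verts \<tau>}. elem \<tau>) \<union> (\<Union>\<tau>\<in>{\<tau>\<in>\<T>. e \<subseteq> verts \<tau>}. \<Union>\<tau>'\<in>bisect \<rho> \<tau>. elem \<tau>')"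
      by (auto simp: \<T>'_def compatible_bisection_def refine_def)
    also have "\<dots> = (\<Union>\<tau>\<in>\<T>. elem \<tau>)" using elem_bisect[OF lab] by auto
    finally show ?thesis using cover by simp
  qed
  have faces: "open_simplex S \<subseteq> \<Omega>" if "\<tau>' \<in> \<T>'" and S: "S \<subseteq> verts \<tau>'" "open_simplex S \<inter> \<Omega> \<noteq> {}" for \<tau>' S
    using that(1)
  proof (cases rule: cases)
    case old
    then show ?thesis using nodal_grid_face[OF grid, of \<tau>' S] S by blast
  next
    case (new \<tau> p q)
    have Sv: "S \<subseteq> insert m (verts \<tau> - {p})" using S(1) new by (simp add: child_def m_def)
    show ?thesis
    proof (cases "m \<in> S")
      case False
      then show ?thesis using nodal_grid_face[OF grid \<open>\<tau> \<in> \<T>\<close>, of S] S(2) Sv by blast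
    next
      case True
      have mpq: "m \<noteq> p" "m \<noteq> q"
        using edge_mid_neq[OF new(5)] new(4) by (simp_all add: m_def)
      have "finite S" using Sv labeled_simplexD(2)[OF lab[OF new(1)]] finite_subset by blast
      then have "open_simplex S \<subseteq> open_simplex (insert p (insert q (S - {m})))"
        using open_simplex_midpoint[of S p q, folded new(4), folded m_def] new(5) True Sv mpq by auto
      moreover have "insert p (insert q (S - {m})) \<subseteq> verts \<tau>" using Sv new by auto
      ultimately show ?thesis using nodal_grid_face[OF grid \<open>\<tau> \<in> \<T>\<close>] S(2) by blast
    qed
  qed
  obtain \<sigma> a b where \<sigma>: "\<sigma> \<in> \<T>" "a \<in> verts \<sigma>" "b \<in> verts \<sigma>" and e: "e = {a, b}" "a \<noteq> b"
    using compatible_edge_pair[OF comp lab] by metis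
  obtain \<psi> where \<psi>: "\<And>p. p \<in> vertices \<T> \<Longrightarrow> hat_function \<Omega> \<T> p (\<psi> p)" using hats by metis
  have ab: "a \<in> vertices \<T>" "b \<in> vertices \<T>" using \<sigma> by auto
  \<comment> \<open>The hat function at the new vertex. Both \<open>\<psi> a\<close> and \<open>\<psi> b\<close> are nonnegative, and one of them vanishes
    on every element that does not contain the edge.\<close>
  define \<eta> where "\<eta> x = 2 * min (\<psi> a x) (\<psi> b x)" for x
  have \<psi>m: "\<psi> a m = 1 / 2" "\<psi> b m = 1 / 2"
    using hat_midpoint[OF \<psi>[OF ab(1)] \<sigma>(1,2,3) e(2)] hat_midpoint[OF \<psi>[OF ab(2)] \<sigma>(1,3,2)] e
    by (auto simp: m_def insert_commute)
  have mnew: "m \<notin> vertices \<T>"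
    using \<psi>m(1) hat_vertex[OF \<psi>[OF ab(1)], of _ m] by (auto split: if_splits)
  have \<eta>v: "\<eta> q = (if q = m then 1 else 0)" if "q \<in> insert m (vertices \<T>)" for q
    using that mnew \<psi>m e(2) hat_vertex[OF \<psi>[OF ab(1)], of _ q] hat_vertex[OF \<psi>[OF ab(2)], of _ q]
    by (auto simp: \<eta>_def split: if_splits)
  have \<eta>aff: "\<exists>b c. \<forall>x\<in>elem \<tau>'. \<eta> x = b \<bullet> x + c" if "\<tau>' \<in> \<T>'" for \<tau>'
    using that
  proof (cases rule: cases)
    case old
    have "\<eta> x = 0 \<bullet> x + 0" if x: "x \<in> elem \<tau>'" for x
    proof -
      have "\<psi> a x = 0 \<or> \<psi> b x = 0"
        using old e x hat_eq_0[OF \<psi>[OF ab(1)] old(1), of x "verts \<tau>'"] hat_eq_0[OF \<psi>[OF ab(2)] old(1), of x "verts \<tau>'"]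
        by (auto simp: elem_def)
      then show ?thesis
        using hat_nonneg[OF \<psi>[OF ab(1)] old(1) x] hat_nonneg[OF \<psi>[OF ab(2)] old(1) x] by (auto simp: \<eta>_def)
    qed
    then show ?thesis by blast
  next
    case (new \<tau> p q)
    have pq: "p \<in> vertices \<T>" "q \<in> vertices \<T>" "p \<in> verts \<tau>" "q \<in> verts \<tau>" using new by auto
    obtain b1 c1 where 1: "\<forall>x\<in>elem \<tau>. \<psi> p x = b1 \<bullet> x + c1" using \<psi>[OF pq(1)] new(1) unfolding hat_function_def by blast
    obtain b2 c2 where 2: "\<forall>x\<in>elem \<tau>. \<psi> q x = b2 \<bullet> x + c2" using \<psi>[OF pq(2)] new(1) unfolding hat_function_def by blast
    have sub: "elem \<tau>' \<subseteq> elem \<tau>" using elem_child_subset[OF lab[OF new(1)]] new by simp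
    have \<eta>pq: "\<eta> x = 2 * min (\<psi> p x) (\<psi> q x)" for x
      using new(4) e by (auto simp: \<eta>_def doubleton_eq_iff min.commute)
    have "\<eta> x = (2 *\<^sub>R b1) \<bullet> x + 2 * c1" if x: "x \<in> elem \<tau>'" for x
    proof -
      \<comment> \<open>This child has lost \<open>p\<close>, so
        \<open>\<psi> p \<le> \<psi> q\<close> at all its vertices, with equality at
        \<open>m\<close>; hence the minimum defining \<open>\<eta>\<close> is the single affine
        function \<open>\<psi> p\<close>.\<close>
      have "b1 \<bullet> x + c1 \<le> b2 \<bullet> x + c2"
      proof (rule affine_le_on_hull[of x "verts \<tau>'"])
        show "x \<in> convex hull (verts \<tau>')" using x by (simp add: elem_def)
        fix v assume v: "v \<in> verts \<tau>'"
        have "v \<in> elem \<tau>" using v verts_subset_elem[of \<tau>'] sub by auto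
        moreover have "\<psi> p v \<le> \<psi> q v"
        proof (cases "v = m")
          case True
          then show ?thesis using \<psi>m new(4) e by (auto simp: doubleton_eq_iff)
        next
          case False
          then have "v \<in> verts \<tau> - {p}" using v new by (auto simp: child_def m_def)
          then show ?thesis
            using hat_vertex[OF \<psi>[OF pq(1)] new(1), of v] hat_vertex[OF \<psi>[OF pq(2)] new(1), of v] by auto
        qed
        ultimately show "b1 \<bullet> v + c1 \<le> b2 \<bullet> v + c2" using 1 2 by simp
      qed
      then show ?thesis using 1 2 x sub by (auto simp: \<eta>pq subset_iff)
    qed
    then show ?thesis by blast
  qed
  have \<eta>cont: "continuous_on (closure \<Omega>) \<eta>"
    using \<psi>[OF ab(1)] \<psi>[OF ab(2)] unfolding \<eta>_def hat_function_def by (intro continuous_intros) auto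
  have verts': "vertices \<T>' \<subseteq> insert m (vertices \<T>)"
  proof safe
    fix \<tau>' v assume "\<tau>' \<in> \<T>'" "v \<in> verts \<tau>'" "v \<notin> vertices \<T>"
    then show "v = m" by (cases rule: cases) (auto simp: child_def m_def)
  qed
  have hats': "\<exists>\<psi>'. hat_function \<Omega> \<T>' p \<psi>'" if "p \<in> vertices \<T>'" for p
  proof (cases "p = m")
    case True
    then have "hat_function \<Omega> \<T>' p \<eta>"
      unfolding hat_function_def using \<eta>cont \<eta>aff \<eta>v verts' by blast
    then show ?thesis by blast
  next
    case False
    then have p: "p \<in> vertices \<T>" using that verts' by blast
    let ?f = "\<lambda>x. \<psi> p x - \<psi> p m * \<eta> x"
    have "hat_function \<Omega> \<T>' p ?f"
      unfolding hat_function_def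
    proof (intro conjI ballI)
      show "continuous_on (closure \<Omega>) ?f"
        using \<eta>cont \<psi>[OF p] unfolding hat_function_def by (intro continuous_intros) auto
      show "?f q = (if q = p then 1 else 0)" if "q \<in> vertices \<T>'" for q
      proof (cases "q = m")
        case True
        then show ?thesis using \<eta>v[of q] False by auto
      next
        case False
        then have "q \<in> vertices \<T>" using that verts' by blast
        then show ?thesis using \<eta>v[of q] False hat_vertex[OF \<psi>[OF p], of _ q] by auto
      qed
      fix \<tau>' assume \<tau>': "\<tau>' \<in> \<T>'"
      obtain b2 c2 where 2: "\<forall>x\<in>elem \<tau>'. \<eta> x = b2 \<bullet> x + c2" using \<eta>aff[OF \<tau>'] by blast
      obtain \<tau> where \<tau>: "\<tau> \<in> \<T>" "elem \<tau>' \<subseteq> elem \<tau>"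
        using \<tau>' by (cases rule: cases) (use elem_child_subset[OF lab] in blast)+
      obtain b1 c1 where 1: "\<forall>x\<in>elem \<tau>. \<psi> p x = b1 \<bullet> x + c1"
        using \<psi>[OF p] \<tau>(1) unfolding hat_function_def by blast
      have "\<forall>x\<in>elem \<tau>'. ?f x = (b1 - \<psi> p m *\<^sub>R b2) \<bullet> x + (c1 - \<psi> p m * c2)"
        using 1 2 \<tau>(2) by (auto simp: subset_iff algebra_simps)
      then show "\<exists>b c. \<forall>x\<in>elem \<tau>'. ?f x = b \<bullet> x + c" by blast
    qed
    then show ?thesis by blast
  qed
  show ?thesis unfolding nodal_grid_def \<T>'_def[symmetric]
    by (intro conjI ballI allI impI) (fact fin' lab' cover' hats' faces)+
qed

section \<open>Finite element spaces and nodal bases\<close>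

lemma subspace_fe_space: "funs.subspace (fe_space \<Omega> \<T>)"
proof (rule funs.subspaceI)
  show "0 \<in> fe_space \<Omega> \<T>"
    by (auto simp: fe_space_def zero_fun_def intro!: exI[of _ 0])
  show "u + v \<in> fe_space \<Omega> \<T>" if uv: "u \<in> fe_space \<Omega> \<T>" "v \<in> fe_space \<Omega> \<T>" for u v
    unfolding fe_space_def
  proof (intro CollectI conjI ballI)
    show "continuous_on (closure \<Omega>) (u + v)"
      using uv by (auto simp: fe_space_def plus_fun_def intro!: continuous_intros)
    show "\<forall>x. x \<notin> \<Omega> \<longrightarrow> (u + v) x = 0" using uv by (simp add: fe_space_def)
    fix \<tau> assume "\<tau> \<in> \<T>"
    then obtain b c b' c' where "\<forall>x\<in>elem \<tau>. u x = b \<bullet> x + c" "\<forall>x\<in>elem \<tau>. v x = b' \<bullet> x + c'"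
      using uv unfolding fe_space_def by blast
    then have "\<forall>x\<in>elem \<tau>. (u + v) x = (b + b') \<bullet> x + (c + c')" by (simp add: inner_add_left)
    then show "\<exists>b c. \<forall>x\<in>elem \<tau>. (u + v) x = b \<bullet> x + c" by blast
  qed
  show "(\<lambda>x. k * u x) \<in> fe_space \<Omega> \<T>" if u: "u \<in> fe_space \<Omega> \<T>" for k u
    unfolding fe_space_def
  proof (intro CollectI conjI ballI)
    show "continuous_on (closure \<Omega>) (\<lambda>x. k * u x)"
      using u by (auto simp: fe_space_def intro!: continuous_intros)
    show "\<forall>x. x \<notin> \<Omega> \<longrightarrow> k * u x = 0" using u by (simp add: fe_space_def)
    fix \<tau> assume "\<tau> \<in> \<T>"
    then obtain b c where "\<forall>x\<in>elem \<tau>. u x = b \<bullet> x + c" using u unfolding fe_space_def by blast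
    then have "\<forall>x\<in>elem \<tau>. k * u x = (k *\<^sub>R b) \<bullet> x + k * c" by (simp add: algebra_simps)
    then show "\<exists>b c. \<forall>x\<in>elem \<tau>. k * u x = b \<bullet> x + c" by blast
  qed
qed

lemma fe_space_eqI:
  assumes grid: "nodal_grid \<Omega> \<T>" and uv: "u \<in> fe_space \<Omega> \<T>" "v \<in> fe_space \<Omega> \<T>"
    and nodes: "\<And>q. q \<in> nodes \<Omega> \<T> \<Longrightarrow> u q = v q"
  shows "u = v"
proof
  fix x
  show "u x = v x"
  proof (cases "x \<in> \<Omega>")
    case True
    then have "x \<in> closure \<Omega>" using closure_subset by blast
    then obtain \<tau> where \<tau>: "\<tau> \<in> \<T>" "x \<in> elem \<tau>" using nodal_gridD(3)[OF grid] by blast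
    obtain b c b' c' where bc: "\<forall>x\<in>elem \<tau>. u x = b \<bullet> x + c" "\<forall>x\<in>elem \<tau>. v x = b' \<bullet> x + c'"
      using uv \<tau>(1) unfolding fe_space_def by blast
    have "b \<bullet> x + c = b' \<bullet> x + c'"
    proof (rule affine_eq_on_hull[of x "verts \<tau>"])
      show "x \<in> convex hull verts \<tau>" using \<tau>(2) by (simp add: elem_def)
      fix q assume q: "q \<in> verts \<tau>"
      have "u q = v q"
      proof (cases "q \<in> \<Omega>")
        case True
        then show ?thesis using nodes[of q] q \<tau>(1) by (auto simp: nodes_def)
      next
        case False
        then show ?thesis using uv by (simp add: fe_space_def)
      qed
      then show "b \<bullet> q + c = b' \<bullet> q + c'" using bc q verts_subset_elem[of \<tau>] by auto
    qed
    then show ?thesis using bc \<tau>(2) by simp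
  next
    case False
    then show ?thesis using uv by (simp add: fe_space_def)
  qed
qed

lemma finite_nodes: "nodal_grid \<Omega> \<T> \<Longrightarrow> finite (nodes \<Omega> \<T>)"
  using nodal_gridD(1,2) labeled_simplexD(2) unfolding nodes_def by blast

text \<open>Extension by zero is continuous only if the hat function vanishes on the boundary. A
  boundary point lies in an open face \<open>S\<close>; if \<open>p\<close> belonged to
  \<open>S\<close>, the face would have points close to \<open>p\<close>, hence in the domain, and
  so would lie in the domain altogether.\<close>

lemma interior_hat:
  assumes grid: "nodal_grid \<Omega> \<T>" and op: "open \<Omega>" and p: "p \<in> nodes \<Omega> \<T>"
  shows "\<exists>\<phi>\<in>fe_space \<Omega> \<T>. \<forall>q\<in>nodes \<Omega> \<T>. \<phi> q = (if q = p then 1 else 0)"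
proof -
  have pv: "p \<in> vertices \<T>" "p \<in> \<Omega>" using p by (auto simp: nodes_def)
  obtain \<psi> where \<psi>: "hat_function \<Omega> \<T> p \<psi>" using nodal_gridD(4)[OF grid pv(1)] by blast
  define \<phi> where "\<phi> x = (if x \<in> \<Omega> then \<psi> x else 0)" for x
  have zero: "\<psi> x = 0" if x: "x \<in> closure \<Omega>" "x \<notin> \<Omega>" for x
  proof -
    obtain \<tau> where \<tau>: "\<tau> \<in> \<T>" "x \<in> elem \<tau>" using nodal_gridD(3)[OF grid] x by blast
    note fin = labeled_simplexD(2)[OF nodal_gridD(2)[OF grid \<tau>(1)]]
    obtain S where S: "S \<subseteq> verts \<tau>" "x \<in> open_simplex S"
      using convex_hull_open_simplex[OF fin, of x] \<tau>(2) by (auto simp: elem_def)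
    have finS: "finite S" using S fin finite_subset by blast
    have "p \<notin> S"
    proof
      assume pS: "p \<in> S"
      have "((\<lambda>t. (1 - t) *\<^sub>R p + t *\<^sub>R x) \<longlongrightarrow> (1 - 0) *\<^sub>R p + 0 *\<^sub>R x) (at_right 0)"
        by (intro tendsto_intros)
      then have "eventually (\<lambda>t. (1 - t) *\<^sub>R p + t *\<^sub>R x \<in> \<Omega>) (at_right 0)"
        using op pv(2) topological_tendstoD by fastforce
      moreover have "eventually (\<lambda>t. t \<in> {0<..<1}) (at_right (0::real))"
        by (rule eventually_at_right_real) simp
      ultimately obtain t :: real where t: "(1 - t) *\<^sub>R p + t *\<^sub>R x \<in> \<Omega>" "0 < t" "t < 1"
        using eventually_happens[OF eventually_conj, of _ "at_right (0::real)"] by fastforce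
      then have "(1 - t) *\<^sub>R p + t *\<^sub>R x \<in> open_simplex S"
        using open_simplex_toward_vertex[OF finS S(2) pS] by simp
      then have "open_simplex S \<subseteq> \<Omega>" using nodal_grid_face[OF grid \<tau>(1) S(1)] t(1) by blast
      then show False using S(2) x(2) by blast
    qed
    then show ?thesis
      using hat_eq_0[OF \<psi> \<tau>(1) _ S(1)] open_simplex_subset[OF finS] S(2) by blast
  qed
  have eq: "\<phi> x = \<psi> x" if "x \<in> closure \<Omega>" for x using zero[OF that] by (simp add: \<phi>_def)
  have "\<phi> \<in> fe_space \<Omega> \<T>"
    unfolding fe_space_def
  proof (intro CollectI conjI ballI)
    have "continuous_on (closure \<Omega>) \<psi>" using \<psi> by (simp add: hat_function_def)
    then show "continuous_on (closure \<Omega>) \<phi>" by (rule continuous_on_eq) (simp add: eq)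
    show "\<forall>x. x \<notin> \<Omega> \<longrightarrow> \<phi> x = 0" by (simp add: \<phi>_def)
    fix \<tau> assume \<tau>: "\<tau> \<in> \<T>"
    obtain b c where bc: "\<forall>x\<in>elem \<tau>. \<psi> x = b \<bullet> x + c" using \<psi> \<tau> unfolding hat_function_def by blast
    have "elem \<tau> \<subseteq> closure \<Omega>" using nodal_gridD(3)[OF grid] \<tau> by blast
    then have "\<forall>x\<in>elem \<tau>. \<phi> x = b \<bullet> x + c" using bc eq by auto
    then show "\<exists>b c. \<forall>x\<in>elem \<tau>. \<phi> x = b \<bullet> x + c" by blast
  qed
  moreover have "\<phi> q = (if q = p then 1 else 0)" if "q \<in> nodes \<Omega> \<T>" for q
    using that \<psi> by (auto simp: nodes_def \<phi>_def hat_function_def)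
  ultimately show ?thesis by blast
qed

lemma nodal_basis:
  assumes grid: "nodal_grid \<Omega> \<T>" and op: "open \<Omega>" and p: "p \<in> nodes \<Omega> \<T>"
  shows "nodal_basis \<Omega> \<T> p \<in> fe_space \<Omega> \<T>"
    and "q \<in> nodes \<Omega> \<T> \<Longrightarrow> nodal_basis \<Omega> \<T> p q = (if q = p then 1 else 0)"
proof -
  obtain \<phi> where \<phi>: "\<phi> \<in> fe_space \<Omega> \<T>" "\<forall>q\<in>nodes \<Omega> \<T>. \<phi> q = (if q = p then 1 else 0)"
    using interior_hat[OF assms] by blast
  have "nodal_basis \<Omega> \<T> p = \<phi>"
    unfolding nodal_basis_def
  proof (rule the_equality)
    show "\<phi> \<in> fe_space \<Omega> \<T> \<and> \<phi> p = 1 \<and> (\<forall>q\<in>nodes \<Omega> \<T>. q \<noteq> p \<longrightarrow> \<phi> q = 0)" using \<phi> p by simp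
    show "u = \<phi>" if u: "u \<in> fe_space \<Omega> \<T> \<and> u p = 1 \<and> (\<forall>q\<in>nodes \<Omega> \<T>. q \<noteq> p \<longrightarrow> u q = 0)" for u
      by (rule fe_space_eqI[OF grid]) (use u \<phi> in auto)
  qed
  then show "nodal_basis \<Omega> \<T> p \<in> fe_space \<Omega> \<T>"
    and "q \<in> nodes \<Omega> \<T> \<Longrightarrow> nodal_basis \<Omega> \<T> p q = (if q = p then 1 else 0)"
    using \<phi> by auto
qed

lemma fe_space_expansion:
  assumes grid: "nodal_grid \<Omega> \<T>" and op: "open \<Omega>" and v: "v \<in> fe_space \<Omega> \<T>"
  shows "v = (\<Sum>p\<in>nodes \<Omega> \<T>. (\<lambda>x. v p * nodal_basis \<Omega> \<T> p x))"
proof (rule fe_space_eqI[OF grid v])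
  show "(\<Sum>p\<in>nodes \<Omega> \<T>. (\<lambda>x. v p * nodal_basis \<Omega> \<T> p x)) \<in> fe_space \<Omega> \<T>"
    using nodal_basis(1)[OF grid op]
    by (intro funs.subspace_sum[OF subspace_fe_space] funs.subspace_scale[OF subspace_fe_space])
  fix q assume q: "q \<in> nodes \<Omega> \<T>"
  have "(\<Sum>p\<in>nodes \<Omega> \<T>. v p * nodal_basis \<Omega> \<T> p q) = (\<Sum>p\<in>nodes \<Omega> \<T>. if p = q then v q else 0)"
    using nodal_basis(2)[OF grid op] q by (intro sum.cong) auto
  then show "v q = (\<Sum>p\<in>nodes \<Omega> \<T>. (\<lambda>x. v p * nodal_basis \<Omega> \<T> p x)) q"
    using q finite_nodes[OF grid] by (simp add: sum_fun_eval)
qed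

lemma fe_space_span:
  assumes "nodal_grid \<Omega> \<T>" "open \<Omega>"
  shows "fe_space \<Omega> \<T> = funs.span (nodal_basis \<Omega> \<T> ` nodes \<Omega> \<T>)"
proof
  show "fe_space \<Omega> \<T> \<subseteq> funs.span (nodal_basis \<Omega> \<T> ` nodes \<Omega> \<T>)"
  proof
    fix v assume "v \<in> fe_space \<Omega> \<T>"
    then have "v = (\<Sum>p\<in>nodes \<Omega> \<T>. (\<lambda>x. v p * nodal_basis \<Omega> \<T> p x))" by (rule fe_space_expansion[OF assms])
    also have "\<dots> \<in> funs.span (nodal_basis \<Omega> \<T> ` nodes \<Omega> \<T>)"
      by (intro funs.span_sum funs.span_scale funs.span_base) auto
    finally show "v \<in> funs.span (nodal_basis \<Omega> \<T> ` nodes \<Omega> \<T>)" .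
  qed
  show "funs.span (nodal_basis \<Omega> \<T> ` nodes \<Omega> \<T>) \<subseteq> fe_space \<Omega> \<T>"
    using nodal_basis(1)[OF assms] by (intro funs.span_minimal subspace_fe_space) auto
qed

lemma fe_space_mono:
  assumes "\<And>\<tau>'. \<tau>' \<in> \<T>' \<Longrightarrow> \<exists>\<tau>\<in>\<T>. elem \<tau>' \<subseteq> elem \<tau>"
  shows "fe_space \<Omega> \<T> \<subseteq> fe_space \<Omega> \<T>'"
  unfolding fe_space_def using assms by (auto; meson subsetD)

lemma compatible_bisection_subset:
  assumes "compatible_edge \<T> e" "\<And>\<tau>. \<tau> \<in> \<T> \<Longrightarrow> labeled_simplex \<tau>" "\<tau>' \<in> compatible_bisection \<rho> \<T> e"
  shows "\<exists>\<tau>\<in>\<T>. elem \<tau>' \<subseteq> elem \<tau>"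
proof (rule compatible_bisection_cases[OF assms(3,1,2)])
  show ?thesis if "\<tau> \<in> \<T>" "ref_edge \<tau> = e" "e = {p, q}" "\<tau>' = child \<rho> \<tau> p" for \<tau> p q
    using elem_child_subset[OF assms(2)[OF that(1)], of p] that by auto
qed auto

section \<open>Generations in uniform refinements\<close>

lemma uniform_refinement_mem:
  assumes "\<tau> \<in> uniform_refinement \<rho> \<T> k" "p \<in> ref_edge \<tau>"
  shows "child \<rho> \<tau> p \<in> uniform_refinement \<rho> \<T> (Suc k)"
  using assms by (auto simp: refine_def bisect_def)

text \<open>A vertex \<open>v\<close> survives in the child that drops an endpoint other than
  \<open>v\<close>; the refinement edge always has one.\<close>

lemma uniform_refinement_vertex:
  assumes "\<And>k \<tau>. \<tau> \<in> uniform_refinement \<rho> \<T> k \<Longrightarrow> labeled_simplex \<tau>"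
    and "v \<in> vertices (uniform_refinement \<rho> \<T> k)" "k \<le> l"
  shows "v \<in> vertices (uniform_refinement \<rho> \<T> l)"
  using assms(3,2)
proof (induction l rule: dec_induct)
  case (step l)
  then obtain \<tau> where \<tau>: "\<tau> \<in> uniform_refinement \<rho> \<T> l" "v \<in> verts \<tau>" by blast
  have "ref_edge \<tau> \<noteq> {v}" "ref_edge \<tau> \<noteq> {}" using labeled_simplexD(6)[OF assms(1)[OF \<tau>(1)]] by auto
  then obtain p where "p \<in> ref_edge \<tau>" "p \<noteq> v" by blast
  then have "child \<rho> \<tau> p \<in> uniform_refinement \<rho> \<T> (Suc l)" "v \<in> verts (child \<rho> \<tau> p)"
    using uniform_refinement_mem[OF \<tau>(1)] \<tau>(2) by (auto simp: verts_child)
  then show ?case by blast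
qed

text \<open>If two elements at a compatible edge had different generations, the midpoint of the edge would be
  a hanging node of the uniform refinement that contains the younger one.\<close>

lemma compatible_edge_generation:
  assumes conf: "\<And>k. conforming \<Omega> (uniform_refinement \<rho> \<T>\<^sub>0 k)"
    and \<tau>: "\<tau> \<in> uniform_refinement \<rho> \<T>\<^sub>0 (gen \<tau>)" and \<tau>': "\<tau>' \<in> uniform_refinement \<rho> \<T>\<^sub>0 (gen \<tau>')"
    and e: "ref_edge \<tau> = e" "ref_edge \<tau>' = e"
  shows "gen \<tau>' \<le> gen \<tau>"
proof (rule ccontr)
  assume less: "\<not> ?thesis"
  have lab: "labeled_simplex \<sigma>" if "\<sigma> \<in> uniform_refinement \<rho> \<T>\<^sub>0 k" for k \<sigma>
    using conf that unfolding conforming_def by blast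
  obtain a b where ab: "e = {a, b}" "a \<noteq> b"
    using labeled_simplexD(6)[OF lab[OF \<tau>]] e by (auto simp: card_2_iff)
  let ?U = "uniform_refinement \<rho> \<T>\<^sub>0 (gen \<tau>')"
  have "child \<rho> \<tau> a \<in> uniform_refinement \<rho> \<T>\<^sub>0 (Suc (gen \<tau>))"
    using uniform_refinement_mem[OF \<tau>] ab e by simp
  then have "edge_mid e \<in> vertices (uniform_refinement \<rho> \<T>\<^sub>0 (Suc (gen \<tau>)))"
    using e by (intro UN_I) (auto simp: verts_child)
  then have mid: "edge_mid e \<in> vertices ?U"
    using uniform_refinement_vertex[OF lab] less by (meson Suc_leI not_le)
  obtain \<psi> where \<psi>: "hat_function \<Omega> ?U a \<psi>" using conforming_hat[OF conf] by blast
  have "a \<in> verts \<tau>'" "b \<in> verts \<tau>'" using labeled_simplexD(5)[OF lab[OF \<tau>']] e ab by auto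
  then have "\<psi> (edge_mid e) = 1 / 2" using hat_midpoint[OF \<psi> \<tau>' _ _ ab(2)] ab by simp
  moreover have "\<psi> (edge_mid e) \<in> {0, 1}" using mid hat_vertex[OF \<psi>] by auto
  ultimately show False by simp
qed

section \<open>Lipschitz functions vanishing outside a domain\<close>

text \<open>A common domain, independent of the grid, on which both bilinear forms are inner
  products. The Lipschitz bound tames the singularity of the fractional kernel; the zero values
  outside exclude nonzero constants.\<close>

definition lipschitz_functions :: "'a::euclidean_space set \<Rightarrow> ('a \<Rightarrow> real) set" where
  "lipschitz_functions \<Omega> = {v. (\<exists>L. L-lipschitz_on UNIV v) \<and> (\<forall>x. x \<notin> \<Omega> \<longrightarrow> v x = 0)}"

text \<open>The domain need not be convex, so the gradient bound is applied along a segment that may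
  leave it: the elements and the complement of the domain are finitely many closed sets covering the
  segment, and \<open>v\<close> is Lipschitz along each.\<close>

lemma fe_space_lipschitz:
  fixes \<Omega> :: "'a::euclidean_space set"
  assumes grid: "nodal_grid \<Omega> \<T>" and op: "open \<Omega>"
  shows "fe_space \<Omega> \<T> \<subseteq> lipschitz_functions \<Omega>"
proof
  fix v assume v: "v \<in> fe_space \<Omega> \<T>"
  then have zero: "v x = 0" if "x \<notin> \<Omega>" for x using that by (simp add: fe_space_def)
  note fin = nodal_gridD(1)[OF grid]
  have "\<forall>\<tau>\<in>\<T>. \<exists>b c. \<forall>x\<in>elem \<tau>. v x = b \<bullet> x + c" using v by (simp add: fe_space_def)
  then obtain b c where bc: "\<And>\<tau> x. \<tau> \<in> \<T> \<Longrightarrow> x \<in> elem \<tau> \<Longrightarrow> v x = b \<tau> \<bullet> x + c \<tau>" by metis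
  define L where "L = (\<Sum>\<tau>\<in>\<T>. norm (b \<tau>))"
  have L: "L \<ge> 0" "norm (b \<tau>) \<le> L" if "\<tau> \<in> \<T>" for \<tau>
    using fin that by (auto simp: L_def sum_nonneg intro: member_le_sum)
  have L0: "L \<ge> 0" by (simp add: L_def sum_nonneg)
  have "dist (v x) (v y) \<le> L * dist x y" for x y
  proof -
    define g where "g t = x + t *\<^sub>R (y - x)" for t
    have g: "continuous_on UNIV g" unfolding g_def by (intro continuous_intros)
    have gd: "g t - g t' = (t - t') *\<^sub>R (y - x)" for t t' by (simp add: g_def algebra_simps)
    have "(L * dist x y)-lipschitz_on {0..1} (\<lambda>t. v (g t))"
    proof (rule lipschitz_on_closed_Union)
      \<comment> \<open>\<open>None\<close> stands for the complement of the domain, where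
        \<open>v\<close> is 0.\<close>
      let ?I = "insert None (Some ` \<T>)" and ?U = "\<lambda>i. g -` (case i of None \<Rightarrow> - \<Omega> | Some \<tau> \<Rightarrow> elem \<tau>)"
      show "finite ?I" using fin by simp
      show "0 \<le> L * dist x y" using L0 by simp
      show "closed (?U i)" if "i \<in> ?I" for i
      proof (rule closed_vimage[OF _ g])
        show "closed (case i of None \<Rightarrow> - \<Omega> | Some \<tau> \<Rightarrow> elem \<tau>)"
          using that op compact_imp_closed[OF compact_elem[OF nodal_gridD(2)[OF grid]]] by auto
      qed
      show "{0..1} \<subseteq> (\<Union>i\<in>?I. ?U i)"
      proof
        fix t
        show "t \<in> (\<Union>i\<in>?I. ?U i)"
        proof (cases "g t \<in> \<Omega>")
          case True
          then have "g t \<in> closure \<Omega>" using closure_subset by blast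
          then obtain \<tau> where "\<tau> \<in> \<T>" "g t \<in> elem \<tau>" using nodal_gridD(3)[OF grid] by blast
          then show ?thesis by (intro UN_I[of "Some \<tau>"]) auto
        qed auto
      qed
      show "(L * dist x y)-lipschitz_on (?U i) (\<lambda>t. v (g t))" if i: "i \<in> ?I" for i
      proof (rule lipschitz_onI)
        show "0 \<le> L * dist x y" using L0 by simp
        fix t t' assume t: "t \<in> ?U i" "t' \<in> ?U i"
        show "dist (v (g t)) (v (g t')) \<le> L * dist x y * dist t t'"
        proof (cases i)
          case None
          then show ?thesis using t zero L0 by simp
        next
          case (Some \<tau>)
          then have \<tau>: "\<tau> \<in> \<T>" using i by auto
          have "v (g t) - v (g t') = b \<tau> \<bullet> (g t - g t')"
            using bc[OF \<tau>] t Some by (simp add: inner_diff_right)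
          then have "dist (v (g t)) (v (g t')) \<le> norm (b \<tau>) * norm (g t - g t')"
            using Cauchy_Schwarz_ineq2 by (simp add: dist_norm)
          also have "\<dots> \<le> L * norm (g t - g t')" using L[OF \<tau>] by (intro mult_right_mono) auto
          also have "\<dots> = L * dist x y * dist t t'" by (simp add: gd dist_norm norm_minus_commute)
          finally show ?thesis .
        qed
      qed
    qed
    from lipschitz_onD[OF this, of 0 1] show ?thesis by (simp add: g_def)
  qed
  then have "L-lipschitz_on UNIV v" using L0 by (intro lipschitz_onI) auto
  then show "v \<in> lipschitz_functions \<Omega>" using zero by (auto simp: lipschitz_functions_def)
qed

lemma subspace_lipschitz_functions: "funs.subspace (lipschitz_functions \<Omega>)"
proof (rule funs.subspaceI)
  have "0-lipschitz_on UNIV (0 :: 'a \<Rightarrow> real)" by (simp add: lipschitz_on_def)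
  then show "0 \<in> lipschitz_functions \<Omega>" by (auto simp: lipschitz_functions_def)
  show "u + v \<in> lipschitz_functions \<Omega>" if "u \<in> lipschitz_functions \<Omega>" "v \<in> lipschitz_functions \<Omega>" for u v
    using that by (auto simp: lipschitz_functions_def plus_fun_def dest: lipschitz_on_add)
  show "(\<lambda>x. c * u x) \<in> lipschitz_functions \<Omega>" if "u \<in> lipschitz_functions \<Omega>" for c u
    using that by (auto simp: lipschitz_functions_def dest: lipschitz_on_cmult_real)
qed

lemma lipschitz_functions_continuous:
  "v \<in> lipschitz_functions \<Omega> \<Longrightarrow> continuous_on S v"
  by (auto simp: lipschitz_functions_def intro: lipschitz_on_continuous_on continuous_on_subset)

lemma lipschitz_functions_measurable:
  "v \<in> lipschitz_functions \<Omega> \<Longrightarrow> v \<in> borel_measurable borel"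
  using lipschitz_functions_continuous borel_measurable_continuous_onI by blast

text \<open>The Lipschitz constant serves for close points and twice the supremum for distant ones,
  matching the singularity of the kernel on the diagonal and its integrability at infinity.\<close>

lemma lipschitz_functions_modulus:
  assumes v: "v \<in> lipschitz_functions \<Omega>" and bdd: "bounded \<Omega>"
  obtains C where "C \<ge> 0" "\<And>x y. \<bar>v x - v y\<bar> \<le> C * min (norm (x - y)) 1"
proof -
  obtain L where L: "L-lipschitz_on UNIV v" using v by (auto simp: lipschitz_functions_def)
  have "compact (v ` closure \<Omega>)"
    using bdd lipschitz_functions_continuous[OF v]
    by (intro compact_continuous_image) (auto simp: compact_closure)
  then obtain B where B: "\<And>x. x \<in> closure \<Omega> \<Longrightarrow> \<bar>v x\<bar> \<le> B"
    by (force simp: bounded_iff dest!: compact_imp_bounded)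
  have B': "\<bar>v x\<bar> \<le> \<bar>B\<bar>" for x
    using B[of x] v closure_subset[of \<Omega>] by (cases "x \<in> \<Omega>") (force simp: lipschitz_functions_def)+
  define C where "C = max L (2 * \<bar>B\<bar>)"
  have "\<bar>v x - v y\<bar> \<le> C * min (norm (x - y)) 1" for x y
  proof -
    have "\<bar>v x - v y\<bar> \<le> L * norm (x - y)" using lipschitz_onD[OF L] by (simp add: dist_norm)
    also have "\<dots> \<le> C * norm (x - y)" by (intro mult_right_mono) (auto simp: C_def)
    finally have 1: "\<bar>v x - v y\<bar> \<le> C * norm (x - y)" .
    have "\<bar>v x - v y\<bar> \<le> C" using B'[of x] B'[of y] by (simp add: C_def)
    then show ?thesis using 1 by (simp add: min_def)
  qed
  moreover have "C \<ge> 0" by (simp add: C_def)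
  ultimately show ?thesis using that by blast
qed

lemma lipschitz_functions_integrable:
  assumes "u \<in> lipschitz_functions \<Omega>" "v \<in> lipschitz_functions \<Omega>" "bounded \<Omega>"
  shows "integrable lborel (\<lambda>x. u x * v x)" "l2_inner \<Omega> u v = (\<integral>x. u x * v x \<partial>lborel)"
proof -
  have "integrable lborel (\<lambda>x. indicator (closure \<Omega>) x *\<^sub>R (u x * v x))"
    using assms lipschitz_functions_continuous
    by (intro borel_integrable_compact continuous_intros) (auto simp: compact_closure)
  moreover have "(\<lambda>x. indicator (closure \<Omega>) x *\<^sub>R (u x * v x)) = (\<lambda>x. u x * v x)"
    using assms closure_subset[of \<Omega>] by (auto simp: fun_eq_iff lipschitz_functions_def indicator_def)
  ultimately show "integrable lborel (\<lambda>x. u x * v x)" by simp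
  have "(\<lambda>x. indicator \<Omega> x *\<^sub>R (u x * v x)) = (\<lambda>x. u x * v x)"
    using assms by (auto simp: fun_eq_iff lipschitz_functions_def indicator_def)
  then show "l2_inner \<Omega> u v = (\<integral>x. u x * v x \<partial>lborel)"
    by (simp add: l2_inner_def set_lebesgue_integral_def)
qed

lemma emeasure_lborel_open_ball_pos: "r > 0 \<Longrightarrow> emeasure lborel (ball x r) > 0"
  for x :: "'a::euclidean_space"
  using ennreal_lessI[of "unit_ball_vol (real DIM('a)) * r ^ DIM('a)" 0]
  by (simp add: emeasure_ball)

text \<open>Definiteness rests on continuity: a function that is nonzero somewhere is nonzero on a
  ball, which has positive measure.\<close>

lemma inner_form_l2:
  fixes \<Omega> :: "'a::euclidean_space set"
  assumes bdd: "bounded \<Omega>"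
  shows "inner_form (lipschitz_functions \<Omega>) (l2_inner \<Omega>)"
proof
  let ?W = "lipschitz_functions \<Omega>"
  note W = funs.subspace_add[OF subspace_lipschitz_functions] funs.subspace_scale[OF subspace_lipschitz_functions]
  note eq = lipschitz_functions_integrable(2)[OF _ _ bdd] and int = lipschitz_functions_integrable(1)[OF _ _ bdd]
  show "funs.subspace ?W" by (rule subspace_lipschitz_functions)
  show "l2_inner \<Omega> u v = l2_inner \<Omega> v u" for u v by (simp add: l2_inner_def mult.commute)
  show "l2_inner \<Omega> (u + v) w = l2_inner \<Omega> u w + l2_inner \<Omega> v w" if "u \<in> ?W" "v \<in> ?W" "w \<in> ?W" for u v w
  proof -
    have "l2_inner \<Omega> (u + v) w = (\<integral>x. u x * w x + v x * w x \<partial>lborel)"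
      using that W by (subst eq) (auto simp: distrib_right)
    also have "\<dots> = l2_inner \<Omega> u w + l2_inner \<Omega> v w"
      using that by (subst Bochner_Integration.integral_add) (auto simp: eq intro: int)
    finally show ?thesis .
  qed
  show "l2_inner \<Omega> (\<lambda>x. c * u x) w = c * l2_inner \<Omega> u w" if "u \<in> ?W" "w \<in> ?W" for u w c
    using eq[OF W(2)[OF that(1), of c] that(2)] eq[OF that] by (simp add: mult.assoc)
  show "0 < l2_inner \<Omega> u u" if u: "u \<in> ?W" "u \<noteq> 0" for u
  proof -
    have nn: "0 \<le> (\<integral>x. u x * u x \<partial>lborel)" by (intro Bochner_Integration.integral_nonneg) simp
    have "(\<integral>x. u x * u x \<partial>lborel) \<noteq> 0"
    proof
      assume "(\<integral>x. u x * u x \<partial>lborel) = 0"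
      then have "AE x in lborel. u x * u x = 0"
        using integral_nonneg_eq_0_iff_AE[OF int[OF u(1) u(1)]] by simp
      then have AE: "AE x in lborel. u x = 0" by simp
      obtain x where x: "u x \<noteq> 0" using u(2) by (auto simp: fun_eq_iff)
      have "open {x. u x \<noteq> 0}"
        using lipschitz_functions_continuous[OF u(1)] by (intro open_Collect_neq) auto
      then obtain r where r: "r > 0" "ball x r \<subseteq> {x. u x \<noteq> 0}" using x open_contains_ball by blast
      have "{x \<in> space lborel. \<not> u x = 0} \<in> sets lborel"
        using lipschitz_functions_measurable[OF u(1)] by measurable
      then have "emeasure lborel {x. u x \<noteq> 0} = 0"
        using AE by (subst (asm) AE_iff_measurable[of "{x. u x \<noteq> 0}"]) auto
      then have "emeasure lborel (ball x r) = 0"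
        using r(2) emeasure_mono[OF r(2), of lborel] \<open>{x \<in> space lborel. \<not> u x = 0} \<in> sets lborel\<close> by auto
      then show False using emeasure_lborel_open_ball_pos[OF r(1), of x] by simp
    qed
    then show ?thesis using nn unfolding eq[OF u(1) u(1)] by linarith
  qed
qed

section \<open>The fractional form\<close>

lemma ennreal_term_le_suminf: "f n \<le> (\<Sum>n. f n :: ennreal)"
  using sum_le_suminf[OF summableI, of "{n}" f] by simp

text \<open>The integrand is of order |z|^(2-d-2s) near 0 and |z|^(-d-2s) at infinity. Summation
  over dyadic shells gives geometric series with ratios 2^(-(2-2s)) and 2^(-2s), which converge
  because s < 1 and s > 0.\<close>

lemma nn_integral_frac_kernel_finite:
  assumes s: "0 < s" "s < 1"
  shows "(\<integral>\<^sup>+z. ennreal ((min (norm (z::'a::euclidean_space)) 1)\<^sup>2 / norm z powr (real DIM('a) + 2 * s)) \<partial>lborel) < \<infinity>"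
    (is "nn_integral _ (\<lambda>z. ennreal (?\<phi> z)) < _")
proof -
  let ?d = "real DIM('a)"
  define \<alpha> where "\<alpha> = ?d + 2 * s"
  have \<alpha>: "\<alpha> > 0" using s by (simp add: \<alpha>_def)
  define r where "r n = (2::real) powr - real n" for n :: nat
  define R where "R n = (2::real) powr real n" for n :: nat
  define a where "a n = (r n)\<^sup>2 / r (Suc n) powr \<alpha>" for n
  define b where "b n = 1 / R n powr \<alpha>" for n
  have nonneg: "a n \<ge> 0" "b n \<ge> 0" "r n \<ge> 0" "R n \<ge> 0" for n
    by (auto simp: a_def b_def r_def R_def)
  \<comment> \<open>On the dyadic annuli \<open>r (n + 1) < |z| \<le> r n\<close> and \<open>R n \<le> |z| < R (n + 1)\<close> the kernel is
    bounded by \<open>a n\<close> and \<open>b n\<close> respectively.\<close>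
  have bound: "ennreal (?\<phi> z) \<le> (\<Sum>n. ennreal (a n) * indicator (cball 0 (r n)) z) +
      (\<Sum>n. ennreal (b n) * indicator (cball 0 (R (Suc n))) z)" for z :: 'a
  proof -
    consider "z = 0" | "z \<noteq> 0" "norm z \<le> 1" | "norm z > 1" by fastforce
    then show ?thesis
    proof cases
      case 2
      define n where "n = nat \<lfloor>- log 2 (norm z)\<rfloor>"
      have "- log 2 (norm z) \<ge> 0" using 2 by (simp add: log_le_zero_cancel_iff)
      then have n: "real n \<le> - log 2 (norm z)" "- log 2 (norm z) < real (Suc n)"
        by (auto simp: n_def) linarith+
      have zr: "norm z = 2 powr (log 2 (norm z))" using 2 by (simp add: powr_log_cancel)
      have le: "norm z \<le> r n" "r (Suc n) \<le> norm z"
        using n by (subst zr; simp add: r_def)+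
      have "?\<phi> z \<le> a n"
        unfolding a_def \<alpha>_def[symmetric] using le 2 \<alpha>
        by (intro frac_le power_mono powr_mono2) (auto simp: r_def)
      then have "ennreal (?\<phi> z) \<le> ennreal (a n) * indicator (cball 0 (r n)) z" using le by (simp add: ennreal_leI)
      also have "\<dots> \<le> (\<Sum>n. ennreal (a n) * indicator (cball 0 (r n)) z)"
        by (rule ennreal_term_le_suminf)
      finally show ?thesis by (simp add: add_increasing2)
    next
      case 3
      define n where "n = nat \<lfloor>log 2 (norm z)\<rfloor>"
      have "log 2 (norm z) \<ge> 0" using 3 by (subst zero_le_log_cancel_iff) linarith+
      then have n: "real n \<le> log 2 (norm z)" "log 2 (norm z) < real (Suc n)"
        by (auto simp: n_def) linarith+
      have zr: "norm z = 2 powr (log 2 (norm z))" using 3 by (subst powr_log_cancel) linarith+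
      have le: "norm z \<le> R (Suc n)" "R n \<le> norm z"
        using n by (subst zr; simp add: R_def)+
      have "?\<phi> z \<le> b n"
        unfolding b_def \<alpha>_def[symmetric] using le 3 \<alpha>
        by (intro frac_le powr_mono2) (auto simp: R_def power_le_one)
      then have "ennreal (?\<phi> z) \<le> ennreal (b n) * indicator (cball 0 (R (Suc n))) z" using le by (simp add: ennreal_leI)
      also have "\<dots> \<le> (\<Sum>n. ennreal (b n) * indicator (cball 0 (R (Suc n))) z)"
        by (rule ennreal_term_le_suminf)
      finally show ?thesis by (simp add: add_increasing)
    qed auto
  qed
  have [measurable]: "cball (0::'a) t \<in> sets borel" for t by simp
  have meas: "(\<lambda>z::'a. ennreal c * indicator (cball 0 t) z) \<in> borel_measurable lborel"
    "(\<lambda>z::'a. (\<Sum>n. ennreal (f n) * indicator (cball 0 (g n)) z)) \<in> borel_measurable lborel" for c t f g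
    by measurable
  define V where "V = unit_ball_vol ?d"
  have V: "V \<ge> 0" by (simp add: V_def)
  have ball: "(\<integral>\<^sup>+z. ennreal c * indicator (cball 0 t) (z :: 'a) \<partial>lborel) = ennreal (c * (V * t ^ DIM('a)))"
    if "c \<ge> 0" "t \<ge> 0" for c t
    using that V by (subst nn_integral_cmult_indicator) (auto simp: emeasure_cball V_def ennreal_mult)
  have ra: "a n * (V * r n ^ DIM('a)) = V * 2 powr \<alpha> * (2 powr - (2 - 2 * s)) ^ n" for n
    unfolding a_def r_def \<alpha>_def
    by (simp add: powr_powr powr_realpow[symmetric] powr_add[symmetric] powr_diff[symmetric] powr_minus_divide[symmetric] algebra_simps)
  have Rb: "b n * (V * R (Suc n) ^ DIM('a)) = V * 2 powr ?d * (2 powr - (2 * s)) ^ n" for n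
    unfolding b_def R_def \<alpha>_def
    by (simp add: powr_powr powr_realpow[symmetric] powr_add[symmetric] powr_diff[symmetric] powr_minus_divide[symmetric] algebra_simps)
  have q: "2 powr - (2 - 2 * s) < (1::real)" "2 powr - (2 * s) < (1::real)"
    using s powr_less_mono[of "- (2 - 2 * s)" 0 2] powr_less_mono[of "- (2 * s)" 0 2] by auto
  have "(\<integral>\<^sup>+z. ennreal (?\<phi> z) \<partial>lborel) \<le>
    (\<integral>\<^sup>+z. (\<Sum>n. ennreal (a n) * indicator (cball 0 (r n)) (z :: 'a)) +
      (\<Sum>n. ennreal (b n) * indicator (cball 0 (R (Suc n))) z) \<partial>lborel)"
    by (intro nn_integral_mono bound)
  also have "\<dots> = (\<Sum>n. \<integral>\<^sup>+z. ennreal (a n) * indicator (cball 0 (r n)) (z :: 'a) \<partial>lborel) +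
      (\<Sum>n. \<integral>\<^sup>+z. ennreal (b n) * indicator (cball 0 (R (Suc n))) (z::'a) \<partial>lborel)"
    using meas by (simp add: nn_integral_add nn_integral_suminf)
  also have "\<dots> = (\<Sum>n. ennreal (V * 2 powr \<alpha> * (2 powr - (2 - 2 * s)) ^ n)) +
      (\<Sum>n. ennreal (V * 2 powr ?d * (2 powr - (2 * s)) ^ n))"
    by (simp only: ball nonneg ra Rb)
  also have "\<dots> = ennreal (\<Sum>n. V * 2 powr \<alpha> * (2 powr - (2 - 2 * s)) ^ n) +
      ennreal (\<Sum>n. V * 2 powr ?d * (2 powr - (2 * s)) ^ n)"
    using q V by (subst (1 2) suminf_ennreal2) (auto intro!: summable_mult summable_geometric)
  also have "\<dots> < \<infinity>" by simp
  finally show ?thesis .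
qed

section \<open>Integrability and positivity of the fractional form\<close>

definition frac_integrand :: "real \<Rightarrow> ('a::euclidean_space \<Rightarrow> real) \<Rightarrow> ('a \<Rightarrow> real) \<Rightarrow> 'a \<times> 'a \<Rightarrow> real" where
  "frac_integrand s u v p = (u (fst p) - u (snd p)) * (v (fst p) - v (snd p)) /
     norm (fst p - snd p) powr (real DIM('a) + 2 * s)"

lemma frac_form_integrand:
  "frac_form s u v = frac_const DIM('a) s / 2 * (\<integral>p. frac_integrand s u v p \<partial>(lborel \<Otimes>\<^sub>M lborel))"
  for u v :: "'a::euclidean_space \<Rightarrow> real"
  by (simp add: frac_form_def frac_integrand_def case_prod_beta')

lemma frac_integrand_measurable:
  assumes "u \<in> lipschitz_functions \<Omega>" "v \<in> lipschitz_functions \<Omega>"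
  shows "frac_integrand s u v \<in> borel_measurable (lborel \<Otimes>\<^sub>M lborel)"
proof -
  have [measurable]: "u \<in> borel_measurable borel" "v \<in> borel_measurable borel"
    using assms lipschitz_functions_measurable by auto
  show ?thesis unfolding frac_integrand_def by measurable
qed

text \<open>The integrand vanishes unless one of the two points lies in the domain. It is therefore
  dominated by the kernel on two strips, and Tonelli with translation invariance reduces each strip
  to the volume of the domain times the integral of the kernel.\<close>

lemma frac_integrand_integrable:
  fixes \<Omega> :: "'a::euclidean_space set"
  assumes u: "u \<in> lipschitz_functions \<Omega>" and v: "v \<in> lipschitz_functions \<Omega>"
    and bdd: "bounded \<Omega>" and op: "open \<Omega>" and s: "0 < s" "s < 1"
  shows "integrable (lborel \<Otimes>\<^sub>M lborel) (frac_integrand s u v)"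
proof (rule integrableI_bounded[OF frac_integrand_measurable[OF u v]])
  define \<phi> where "\<phi> z = (min (norm z) 1)\<^sup>2 / norm z powr (real DIM('a) + 2 * s)" for z :: 'a
  have [measurable]: "\<phi> \<in> borel_measurable borel" unfolding \<phi>_def by measurable
  have [measurable]: "\<Omega> \<in> sets borel" using op by simp
  have \<phi>0: "\<phi> z \<ge> 0" for z by (simp add: \<phi>_def)
  define I where "I = (\<integral>\<^sup>+z. ennreal (\<phi> z) \<partial>lborel)"
  have I: "I < \<infinity>" unfolding I_def \<phi>_def by (rule nn_integral_frac_kernel_finite[OF s])
  have shift: "(\<integral>\<^sup>+y. ennreal (\<phi> (x - y)) \<partial>lborel) = I" for x
  proof -
    have "I = (\<integral>\<^sup>+z. ennreal (\<phi> z) \<partial>distr lborel borel ((+) (- x)))"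
      unfolding I_def by (simp add: lborel_distr_plus)
    also have "\<dots> = (\<integral>\<^sup>+y. ennreal (\<phi> (- x + y)) \<partial>lborel)" by (rule nn_integral_distr) measurable
    also have "\<dots> = (\<integral>\<^sup>+y. ennreal (\<phi> (x - y)) \<partial>lborel)"
      by (simp add: \<phi>_def norm_minus_commute)
    finally show ?thesis by simp
  qed
  have shift': "(\<integral>\<^sup>+y. ennreal (\<phi> (y - x)) \<partial>lborel) = I" for x
    using shift[of x] by (simp add: \<phi>_def norm_minus_commute)
  obtain Cu where Cu: "Cu \<ge> 0" "\<And>x y. \<bar>u x - u y\<bar> \<le> Cu * min (norm (x - y)) 1"
    using lipschitz_functions_modulus[OF u bdd] by metis
  obtain Cv where Cv: "Cv \<ge> 0" "\<And>x y. \<bar>v x - v y\<bar> \<le> Cv * min (norm (x - y)) 1"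
    using lipschitz_functions_modulus[OF v bdd] by metis
  define C where "C = Cu * Cv"
  have C: "C \<ge> 0" using Cu Cv by (simp add: C_def)
  have bound: "ennreal (norm (frac_integrand s u v p)) \<le>
      ennreal C * (indicator \<Omega> (fst p) * ennreal (\<phi> (fst p - snd p)) + indicator \<Omega> (snd p) * ennreal (\<phi> (fst p - snd p)))" for p
  proof (cases "fst p \<in> \<Omega> \<or> snd p \<in> \<Omega>")
    case True
    have "\<bar>u (fst p) - u (snd p)\<bar> * \<bar>v (fst p) - v (snd p)\<bar> \<le>
        (Cu * min (norm (fst p - snd p)) 1) * (Cv * min (norm (fst p - snd p)) 1)"
      using Cu Cv by (intro mult_mono) auto
    also have "\<dots> = C * (min (norm (fst p - snd p)) 1)\<^sup>2" by (simp add: C_def power2_eq_square)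
    finally have "norm (frac_integrand s u v p) \<le> C * \<phi> (fst p - snd p)"
      by (simp add: frac_integrand_def \<phi>_def abs_mult divide_right_mono)
    then have "ennreal (norm (frac_integrand s u v p)) \<le> ennreal C * ennreal (\<phi> (fst p - snd p))"
      using C \<phi>0 by (simp add: ennreal_mult[symmetric] ennreal_leI)
    also have "\<dots> \<le> ennreal C * (indicator \<Omega> (fst p) * ennreal (\<phi> (fst p - snd p)) + indicator \<Omega> (snd p) * ennreal (\<phi> (fst p - snd p)))"
      using True by (intro mult_left_mono) (auto simp: indicator_def)
    finally show ?thesis .
  next
    case False
    then show ?thesis using u v by (simp add: frac_integrand_def lipschitz_functions_def)
  qed
  have \<Omega>fin: "emeasure lborel \<Omega> < \<infinity>" using emeasure_bounded_finite[OF bdd] by simp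
  have 1: "(\<integral>\<^sup>+p. indicator \<Omega> (fst p) * ennreal (\<phi> (fst p - snd p)) \<partial>(lborel \<Otimes>\<^sub>M lborel)) = emeasure lborel \<Omega> * I"
  proof -
    have "(\<integral>\<^sup>+p. indicator \<Omega> (fst p) * ennreal (\<phi> (fst p - snd p)) \<partial>(lborel \<Otimes>\<^sub>M lborel)) =
      (\<integral>\<^sup>+x. \<integral>\<^sup>+y. indicator \<Omega> x * ennreal (\<phi> (x - y)) \<partial>lborel \<partial>lborel)"
      by (subst lborel.nn_integral_fst[symmetric]) auto
    also have "\<dots> = (\<integral>\<^sup>+x. I * indicator \<Omega> x \<partial>lborel)"
      by (intro nn_integral_cong) (simp add: nn_integral_cmult shift mult.commute)
    finally show ?thesis by (simp add: nn_integral_cmult_indicator mult.commute)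
  qed
  have 2: "(\<integral>\<^sup>+p. indicator \<Omega> (snd p) * ennreal (\<phi> (fst p - snd p)) \<partial>(lborel \<Otimes>\<^sub>M lborel)) = emeasure lborel \<Omega> * I"
  proof -
    have "(\<integral>\<^sup>+p. indicator \<Omega> (snd p) * ennreal (\<phi> (fst p - snd p)) \<partial>(lborel \<Otimes>\<^sub>M lborel)) =
      (\<integral>\<^sup>+y. \<integral>\<^sup>+x. indicator \<Omega> y * ennreal (\<phi> (x - y)) \<partial>lborel \<partial>lborel)"
      by (subst lborel_pair.nn_integral_snd[symmetric]) auto
    also have "\<dots> = (\<integral>\<^sup>+x. I * indicator \<Omega> x \<partial>lborel)"
      by (intro nn_integral_cong) (simp add: nn_integral_cmult shift' mult.commute)
    finally show ?thesis by (simp add: nn_integral_cmult_indicator mult.commute)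
  qed
  have "(\<integral>\<^sup>+p. ennreal (norm (frac_integrand s u v p)) \<partial>(lborel \<Otimes>\<^sub>M lborel)) \<le>
    (\<integral>\<^sup>+p. ennreal C * (indicator \<Omega> (fst p) * ennreal (\<phi> (fst p - snd p)) + indicator \<Omega> (snd p) * ennreal (\<phi> (fst p - snd p))) \<partial>(lborel \<Otimes>\<^sub>M lborel))"
    by (intro nn_integral_mono bound)
  also have "\<dots> = ennreal C * (emeasure lborel \<Omega> * I + emeasure lborel \<Omega> * I)"
    by (subst nn_integral_cmult, measurable, subst nn_integral_add) (auto simp: 1 2)
  also have "\<dots> < \<infinity>" using I \<Omega>fin by (simp add: ennreal_mult_less_top)
  finally show "(\<integral>\<^sup>+p. ennreal (norm (frac_integrand s u v p)) \<partial>(lborel \<Otimes>\<^sub>M lborel)) < \<infinity>" .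
qed

lemma frac_const_pos: "0 < s \<Longrightarrow> s < 1 \<Longrightarrow> 0 < d \<Longrightarrow> frac_const d s > 0"
  by (simp add: frac_const_def Gamma_real_pos)

text \<open>For definiteness a ball on which \<open>u\<close> is nonzero is paired with a ball
  beyond the bounded domain, where \<open>u\<close> is 0; on their product the integrand is
  nonzero.\<close>

lemma inner_form_frac:
  fixes \<Omega> :: "'a::euclidean_space set"
  assumes bdd: "bounded \<Omega>" and op: "open \<Omega>" and s: "0 < s" "s < 1"
  shows "inner_form (lipschitz_functions \<Omega>) (frac_form s)"
proof
  let ?W = "lipschitz_functions \<Omega>" and ?P = "lborel \<Otimes>\<^sub>M lborel :: ('a \<times> 'a) measure"
  note int = frac_integrand_integrable[OF _ _ bdd op s]
  show "funs.subspace ?W" by (rule subspace_lipschitz_functions)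
  show "frac_form s u v = frac_form s v u" for u v :: "'a \<Rightarrow> real"
    by (simp add: frac_form_def mult.commute)
  show "frac_form s (u + v) w = frac_form s u w + frac_form s v w"
    if "u \<in> ?W" "v \<in> ?W" "w \<in> ?W" for u v w
  proof -
    have "frac_integrand s (u + v) w = (\<lambda>p. frac_integrand s u w p + frac_integrand s v w p)"
      by (auto simp: frac_integrand_def add_divide_distrib[symmetric] algebra_simps)
    then show ?thesis using that
      by (simp add: frac_form_integrand Bochner_Integration.integral_add int distrib_left)
  qed
  show "frac_form s (\<lambda>x. c * u x) w = c * frac_form s u w" for u w c
  proof -
    have "frac_integrand s (\<lambda>x. c * u x) w = (\<lambda>p. c * frac_integrand s u w p)"
      by (auto simp: frac_integrand_def algebra_simps)
    then show ?thesis by (simp add: frac_form_integrand)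
  qed
  show "0 < frac_form s u u" if u: "u \<in> ?W" "u \<noteq> 0" for u
  proof -
    have nn: "0 \<le> frac_integrand s u u p" for p by (simp add: frac_integrand_def)
    have "(\<integral>p. frac_integrand s u u p \<partial>?P) \<noteq> 0"
    proof
      assume "(\<integral>p. frac_integrand s u u p \<partial>?P) = 0"
      then have AE: "AE p in ?P. frac_integrand s u u p = 0"
        using integral_nonneg_eq_0_iff_AE[OF int[OF u(1) u(1)]] nn by simp
      obtain x where x: "u x \<noteq> 0" using u(2) by (auto simp: fun_eq_iff)
      have "open {x. u x \<noteq> 0}"
        using lipschitz_functions_continuous[OF u(1)] by (intro open_Collect_neq) auto
      then obtain r where r: "r > 0" "ball x r \<subseteq> {x. u x \<noteq> 0}" using x open_contains_ball by blast
      obtain R where R: "\<And>x. x \<in> \<Omega> \<Longrightarrow> norm x \<le> R" using bdd by (auto simp: bounded_iff)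
      obtain y :: 'a where y: "norm y = \<bar>R\<bar> + 1" using vector_choose_size[of "\<bar>R\<bar> + 1"] by auto
      have uy: "u z = 0" if "z \<in> ball y 1" for z
      proof -
        have "norm y \<le> norm z + norm (y - z)" by (metis norm_triangle_sub)
        then have "z \<notin> \<Omega>" using that y R[of z] by (auto simp: dist_norm)
        then show ?thesis using u by (simp add: lipschitz_functions_def)
      qed
      let ?N = "{p. frac_integrand s u u p \<noteq> 0}"
      have sub: "ball x r \<times> ball y 1 \<subseteq> ?N"
      proof
        fix p assume p: "p \<in> ball x r \<times> ball y 1"
        have "u (fst p) \<noteq> 0" using p r(2) by auto
        moreover have "u (snd p) = 0" using p uy by auto
        ultimately have "fst p \<noteq> snd p" "u (fst p) - u (snd p) \<noteq> 0" by auto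
        then show "p \<in> ?N" by (simp add: frac_integrand_def)
      qed
      have N: "?N \<in> sets ?P"
      proof -
        have "{p \<in> space ?P. frac_integrand s u u p \<noteq> 0} \<in> sets ?P"
          using frac_integrand_measurable[OF u(1) u(1), of s] by measurable
        then show ?thesis by (simp add: space_pair_measure)
      qed
      then have "emeasure ?P ?N = 0"
        using AE by (subst (asm) AE_iff_measurable[of ?N]) (auto simp: space_pair_measure)
      then have "emeasure ?P (ball x r \<times> ball y 1) = 0"
        using emeasure_mono[OF sub N] by simp
      then have "emeasure lborel (ball x r) * emeasure lborel (ball y 1) = 0"
        by (subst (asm) lborel.emeasure_pair_measure_Times) auto
      then show False
        using emeasure_lborel_open_ball_pos[OF r(1), of x] emeasure_lborel_open_ball_pos[of 1 y] by auto
    qed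
    moreover have "0 \<le> (\<integral>p. frac_integrand s u u p \<partial>?P)"
      using nn by (intro Bochner_Integration.integral_nonneg) auto
    ultimately show ?thesis using frac_const_pos[OF s, of "DIM('a)"] by (simp add: frac_form_integrand)
  qed
qed

section \<open>Comparison of the weights\<close>

text \<open>Both sides are compared with \<open>s\<close>:
  \<open>1 - exp (- (a * s)) \<le> a * s\<close>, and by convexity of the exponential
  \<open>1 - exp (- (b * s)) \<ge> s * (1 - exp (- b))\<close>. The quotient bound is therefore free
  of \<open>s\<close>.\<close>

lemma one_minus_exp_ratio:
  fixes a b s :: real
  assumes "0 < a" "0 < b" "0 < s" "s < 1"
  shows "1 - exp (- (a * s)) \<le> a / (1 - exp (- b)) * (1 - exp (- (b * s)))"
proof -
  have "exp ((1 - s) *\<^sub>R 0 + s *\<^sub>R (- b)) \<le> (1 - s) * exp 0 + s * exp (- b)"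
    using assms by (intro convex_onD[OF exp_convex]) auto
  then have "s * (1 - exp (- b)) \<le> 1 - exp (- (b * s))" by (simp add: algebra_simps)
  then have "s \<le> (1 - exp (- (b * s))) / (1 - exp (- b))" using assms by (simp add: pos_le_divide_eq)
  then have "a * s \<le> a * ((1 - exp (- (b * s))) / (1 - exp (- b)))"
    using assms(1) by (intro mult_left_mono) auto
  moreover have "1 - exp (- (a * s)) \<le> a * s" using exp_ge_add_one_self[of "- (a * s)"] by simp
  ultimately show ?thesis by simp
qed

lemma one_minus_powr_ratio:
  fixes x y s :: real
  assumes "0 < x" "x < 1" "0 < y" "y < 1" "0 < s" "s < 1"
  shows "1 - x powr s \<le> (- ln x) / (1 - y) * (1 - y powr s)"
  using one_minus_exp_ratio[of "- ln x" "- ln y" s] assms by (simp add: powr_def mult.commute)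

text \<open>The geometric sum telescopes to \<open>q ^ (l - m) - q ^ Suc n\<close>. For
  \<open>l\<close> near \<open>n\<close> it degenerates as \<open>q\<close> tends to 1, that is, as
  s tends to 0; the extra \<open>q ^ n\<close>, from the fine-grid term of Bhat, compensates for
  this. The subtraction \<open>l - m\<close> is truncated at 0.\<close>

lemma node_weight_bounds:
  fixes q :: real and m :: nat
  assumes q: "0 < q" "q < 1" and l: "l \<le> n"
  defines "W \<equiv> q ^ n + (1 - q) * (\<Sum>k\<in>{k\<in>{..n}. l \<le> k + m}. q ^ k)"
  shows "q ^ l \<le> W" "W \<le> 2 / q ^ m * q ^ l"
proof -
  have "{k\<in>{..n}. l \<le> k + m} = {l - m..n}" by auto
  then have W: "W = q ^ n + (q ^ (l - m) - q ^ Suc n)"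
    using l unfolding W_def by (simp only:) (subst sum_gp_multiplied, auto)
  have "q ^ Suc n \<le> q ^ n" "q ^ l \<le> q ^ (l - m)" "q ^ n \<le> q ^ l"
    using q l by (auto intro!: power_decreasing)
  moreover have "q ^ (l - m) * q ^ m \<le> q ^ l"
    using q by (subst power_add[symmetric]) (auto intro!: power_decreasing)
  then have "q ^ (l - m) \<le> q ^ l / q ^ m" using q by (simp add: pos_le_divide_eq)
  moreover have "q ^ l \<le> q ^ l / q ^ m"
    using q by (simp add: pos_le_divide_eq power_le_one mult_left_le)
  moreover have "q ^ Suc n \<ge> 0" using q by simp
  ultimately show "q ^ l \<le> W" "W \<le> 2 / q ^ m * q ^ l" unfolding W by auto
qed

text \<open>At most \<open>2 * m + 1\<close> levels contribute, each at most
  \<open>q ^ g / q ^ m\<close>. The bound \<open>g \<le> n\<close> ensures that the level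
  \<open>k = g\<close> is among them.\<close>

lemma patch_weight_bounds:
  fixes q :: real and m :: nat
  assumes q: "0 < q" "q < 1" and g: "g \<le> n"
  defines "W \<equiv> \<Sum>k\<in>{k\<in>{..n}. int k - int m \<le> int g \<and> g \<le> k + m}. q ^ k"
  shows "q ^ g \<le> W" "W \<le> real (2 * m + 1) / q ^ m * q ^ g"
proof -
  let ?K = "{k\<in>{..n}. int k - int m \<le> int g \<and> g \<le> k + m}"
  show "q ^ g \<le> W" unfolding W_def using q g by (intro member_le_sum) auto
  have "W \<le> (\<Sum>k\<in>?K. q ^ g / q ^ m)"
    unfolding W_def
  proof (rule sum_mono)
    fix k assume "k \<in> ?K"
    then have "q ^ k * q ^ m \<le> q ^ g"
      using q by (subst power_add[symmetric]) (auto intro!: power_decreasing)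
    then show "q ^ k \<le> q ^ g / q ^ m" using q by (simp add: pos_le_divide_eq)
  qed
  also have "\<dots> = real (card ?K) * (q ^ g / q ^ m)" by simp
  also have "\<dots> \<le> real (2 * m + 1) * (q ^ g / q ^ m)"
  proof (rule mult_right_mono)
    have "card ?K \<le> card {g - m..g + m}" by (rule card_mono) auto
    moreover have "card {g - m..g + m} \<le> 2 * m + 1" unfolding card_atLeastAtMost by linarith
    ultimately show "real (card ?K) \<le> real (2 * m + 1)" by linarith
  qed (use q in simp)
  finally show "W \<le> real (2 * m + 1) / q ^ m * q ^ g" by simp
qed

text \<open>Cutting \<open>m1\<close> and \<open>m2\<close> off at 1 makes their powers monotone in
  the exponent in the required direction, so that \<open>2 * s\<close> can be replaced by 2 and the
  constants become free of \<open>s\<close>.\<close>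

lemma mesh_size_powr_bounds:
  fixes h :: real
  assumes \<gamma>: "0 < \<gamma>" and m1: "0 < m1" and s: "0 < s" "s < 1"
    and h: "m1 * \<gamma> ^ l \<le> h" "h \<le> m2 * \<gamma> ^ l"
  shows "(min 1 m1)\<^sup>2 * (\<gamma> powr (2 * s)) ^ l \<le> h powr (2 * s)"
    and "h powr (2 * s) \<le> (max 1 m2)\<^sup>2 * (\<gamma> powr (2 * s)) ^ l"
proof -
  have eq: "(c * \<gamma> ^ l) powr (2 * s) = c powr (2 * s) * (\<gamma> powr (2 * s)) ^ l" if "c > 0" for c
    using \<gamma> that by (simp add: powr_mult powr_realpow[symmetric] powr_powr mult.commute)
  have h0: "h > 0" using h(1) mult_pos_pos[OF m1 zero_less_power[OF \<gamma>, of l]] by linarith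
  have g: "\<gamma> ^ l > 0" "(\<gamma> powr (2 * s)) ^ l > 0" using \<gamma> by auto
  have "(min 1 m1)\<^sup>2 = min 1 m1 powr 2" using m1 by simp
  also have "\<dots> \<le> min 1 m1 powr (2 * s)" using m1 s by (intro powr_mono') auto
  finally have "(min 1 m1)\<^sup>2 * (\<gamma> powr (2 * s)) ^ l \<le> min 1 m1 powr (2 * s) * (\<gamma> powr (2 * s)) ^ l"
    using g by (intro mult_right_mono) auto
  also have "\<dots> = (min 1 m1 * \<gamma> ^ l) powr (2 * s)" using m1 by (simp add: eq)
  also have "\<dots> \<le> h powr (2 * s)"
  proof (rule powr_mono2)
    have "min 1 m1 * \<gamma> ^ l \<le> m1 * \<gamma> ^ l" using g by (intro mult_right_mono) auto
    then show "min 1 m1 * \<gamma> ^ l \<le> h" using h by linarith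
  qed (use s m1 g in auto)
  finally show "(min 1 m1)\<^sup>2 * (\<gamma> powr (2 * s)) ^ l \<le> h powr (2 * s)" .
  have "h powr (2 * s) \<le> (max 1 m2 * \<gamma> ^ l) powr (2 * s)"
  proof (rule powr_mono2)
    have "m2 * \<gamma> ^ l \<le> max 1 m2 * \<gamma> ^ l" using g by (intro mult_right_mono) auto
    then show "h \<le> max 1 m2 * \<gamma> ^ l" using h by linarith
  qed (use s h0 in auto)
  also have "\<dots> = max 1 m2 powr (2 * s) * (\<gamma> powr (2 * s)) ^ l" by (intro eq) auto
  also have "\<dots> \<le> max 1 m2 powr 2 * (\<gamma> powr (2 * s)) ^ l"
    using g s by (intro mult_right_mono powr_mono) auto
  also have "max 1 m2 powr 2 = (max 1 m2)\<^sup>2" by simp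
  finally show "h powr (2 * s) \<le> (max 1 m2)\<^sup>2 * (\<gamma> powr (2 * s)) ^ l" .
qed

section \<open>Sequences of compatible bisections\<close>

locale bisection_sequence =
  fixes \<Omega> :: "'a::euclidean_space set" and \<rho> :: "('a, 't) bisection_rule"
    and \<T>\<^sub>0 :: "('a, 't) lsimplex set" and e :: "nat \<Rightarrow> 'a set" and J :: nat
  assumes domain: "bounded_lipschitz_domain \<Omega>" and rule: "admissible_rule \<rho>"
    and uniform: "\<And>k. conforming \<Omega> (uniform_refinement \<rho> \<T>\<^sub>0 k)"
    and gen0: "\<And>\<tau>. \<tau> \<in> \<T>\<^sub>0 \<Longrightarrow> gen \<tau> = 0"
    and compatible: "compatible_sequence \<rho> \<T>\<^sub>0 e J"
begin

abbreviation M :: "nat \<Rightarrow> ('a, 't) lsimplex set" where "M \<equiv> grid_seq \<rho> \<T>\<^sub>0 e"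

lemma open_domain: "open \<Omega>" and bounded_domain: "bounded \<Omega>"
  using domain by (auto simp: bounded_lipschitz_domain_def)

lemma compatible_edge: "j < J \<Longrightarrow> compatible_edge (M j) (e (Suc j))"
  using compatible by (simp add: compatible_sequence_def)

lemma nodal_grid: "j \<le> J \<Longrightarrow> nodal_grid \<Omega> (M j)"
proof (induction j)
  case 0
  then show ?case using nodal_grid_conforming[OF domain, of \<T>\<^sub>0] uniform[of 0] by simp
next
  case (Suc j)
  then show ?case using nodal_grid_step[OF _ rule compatible_edge] by simp
qed

lemma labeled: "j \<le> J \<Longrightarrow> \<tau> \<in> M j \<Longrightarrow> labeled_simplex \<tau>"
  using nodal_gridD(2)[OF nodal_grid] by blast

lemma M_Suc_cases:
  assumes "j < J" "\<tau>' \<in> M (Suc j)"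
  obtains (old) "\<tau>' \<in> M j" "\<not> e (Suc j) \<subseteq> verts \<tau>'"
    | (new) \<tau> p q where "\<tau> \<in> M j" "e (Suc j) \<subseteq> verts \<tau>" "ref_edge \<tau> = e (Suc j)"
        "e (Suc j) = {p, q}" "p \<noteq> q" "\<tau>' = child \<rho> \<tau> p"
  using compatible_bisection_cases[OF assms(2)[unfolded grid_seq.simps] compatible_edge[OF assms(1)]
    labeled[OF less_imp_le[OF assms(1)]]] by metis

lemma fe_space_mono_seq: "i \<le> j \<Longrightarrow> j \<le> J \<Longrightarrow> fe_space \<Omega> (M i) \<subseteq> fe_space \<Omega> (M j)"
proof (induction j rule: dec_induct)
  case (step j)
  have "fe_space \<Omega> (M j) \<subseteq> fe_space \<Omega> (M (Suc j))"
    using compatible_bisection_subset[OF compatible_edge[of j] labeled[of j]] step.prems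
    by (intro fe_space_mono) auto
  then show ?case using step by simp
qed simp

text \<open>A child depends on its parent alone, so an element reached by \<open>gen \<tau>\<close>
  bisections also appears after as many uniform ones. This makes conformity of the uniform
  refinements usable on adaptive grids.\<close>

lemma mem_uniform_refinement: "j \<le> J \<Longrightarrow> \<tau> \<in> M j \<Longrightarrow> \<tau> \<in> uniform_refinement \<rho> \<T>\<^sub>0 (gen \<tau>)"
proof (induction j arbitrary: \<tau>)
  case 0
  then show ?case using gen0 by simp
next
  case (Suc j)
  have "j < J" using Suc.prems by simp
  then show ?case using Suc.prems(2)
  proof (cases rule: M_Suc_cases)
    case old
    then show ?thesis using Suc by simp
  next
    case (new \<sigma> p q)
    then have "child \<rho> \<sigma> p \<in> uniform_refinement \<rho> \<T>\<^sub>0 (Suc (gen \<sigma>))"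
      using Suc by (intro uniform_refinement_mem) auto
    then show ?thesis using new by (simp add: child_def)
  qed
qed

lemma gen_mono: "i \<le> j \<Longrightarrow> j \<le> J \<Longrightarrow> \<tau> \<in> M i \<Longrightarrow> \<exists>\<tau>'\<in>M j. gen \<tau> \<le> gen \<tau>'"
proof (induction j rule: dec_induct)
  case (step j)
  then obtain \<tau>' where \<tau>': "\<tau>' \<in> M j" "gen \<tau> \<le> gen \<tau>'" by auto
  show ?case
  proof (cases "e (Suc j) \<subseteq> verts \<tau>'")
    case True
    have "ref_edge \<tau>' \<noteq> {}" using labeled_simplexD(6)[OF labeled[OF _ \<tau>'(1)]] step.prems by auto
    then obtain p where "p \<in> ref_edge \<tau>'" by blast
    then have "child \<rho> \<tau>' p \<in> M (Suc j)" using \<tau>' True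
      by (auto simp: compatible_bisection_def refine_def bisect_def)
    then show ?thesis using \<tau>'(2) by (intro bexI) (auto simp: child_def)
  next
    case False
    then show ?thesis using \<tau>' by (intro bexI[of _ \<tau>']) (auto simp: compatible_bisection_def refine_def)
  qed
qed auto

text \<open>The description in \<open>patch_gen\<close> is meaningful only if all elements at the
  midpoint share a generation. They are children of the elements around the edge, which have equal
  generations; unbisected elements cannot contain the midpoint.\<close>

lemma patch_gen_le: "j \<le> J \<Longrightarrow> patch_gen M e j \<le> max_gen (M J)"
proof (cases j)
  case (Suc i)
  assume "j \<le> J"
  then have i: "i < J" using Suc by simp
  obtain \<tau> a b where \<tau>: "\<tau> \<in> M i" "ref_edge \<tau> = e j" "a \<in> verts \<tau>" "b \<in> verts \<tau>" and ab: "e j = {a, b}" "a \<noteq> b"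
    using compatible_edge_pair[OF compatible_edge[OF i] labeled[OF less_imp_le[OF i]]] Suc by metis
  obtain \<psi>a \<psi>b where \<psi>: "hat_function \<Omega> (M i) a \<psi>a" "hat_function \<Omega> (M i) b \<psi>b"
    using nodal_gridD(4)[OF nodal_grid, of i] \<tau> i by (metis UN_I less_imp_le)
  have mid: "\<psi>a (edge_mid (e j)) = 1 / 2" "\<psi>b (edge_mid (e j)) = 1 / 2"
    using hat_midpoint[OF \<psi>(1) \<tau>(1,3,4) ab(2)] hat_midpoint[OF \<psi>(2) \<tau>(1,4,3)] ab
    by (auto simp: insert_commute)
  have gens: "gen \<tau>' = Suc (gen \<tau>)" if \<tau>': "\<tau>' \<in> M j" "edge_mid (e j) \<in> elem \<tau>'" for \<tau>'
    using i \<tau>'(1)[unfolded Suc]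
  proof (cases rule: M_Suc_cases)
    case old
    \<comment> \<open>The hat function of the missing endpoint is 0 on this element, but 1/2 at the
      midpoint.\<close>
    then have "a \<notin> verts \<tau>' \<or> b \<notin> verts \<tau>'" using ab Suc by auto
    then show ?thesis
      using hat_eq_0[OF \<psi>(1) old(1), of _ "verts \<tau>'"] hat_eq_0[OF \<psi>(2) old(1), of _ "verts \<tau>'"] \<tau>'(2) mid
      by (auto simp: elem_def)
  next
    case (new \<sigma> p q)
    have "gen \<sigma> = gen \<tau>"
      using compatible_edge_generation[OF uniform, of \<sigma> \<tau> "e j"] compatible_edge_generation[OF uniform, of \<tau> \<sigma> "e j"]
        mem_uniform_refinement[of i] i \<tau> new Suc by (auto intro: antisym)
    then show ?thesis using new by (simp add: child_def)
  qed
  have ch: "child \<rho> \<tau> a \<in> M j"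
    using \<tau> ab Suc by (auto simp: compatible_bisection_def refine_def bisect_def)
  have "edge_mid (e j) \<in> elem (child \<rho> \<tau> a)"
    using verts_subset_elem[of "child \<rho> \<tau> a"] \<tau>(2) by (simp add: verts_child)
  then have "patch_gen M e j = Suc (gen \<tau>)"
    using gens ch Suc unfolding patch_gen_def by (auto intro!: the_equality)
  moreover obtain \<tau>' where \<tau>': "\<tau>' \<in> M J" "gen (child \<rho> \<tau> a) \<le> gen \<tau>'"
    using gen_mono[OF \<open>j \<le> J\<close> order_refl ch] by blast
  moreover have "gen \<tau>' \<le> max_gen (M J)"
    unfolding max_gen_def using \<tau>'(1) nodal_gridD(1)[OF nodal_grid[OF order_refl]] by (intro Max_ge) auto
  ultimately show ?thesis by (simp add: child_def)
qed (simp add: patch_gen_def)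

lemma level_le: "p \<in> nodes \<Omega> (M J) \<Longrightarrow> level (M J) p \<le> max_gen (M J)"
  unfolding level_def max_gen_def using nodal_gridD(1)[OF nodal_grid[OF order_refl]]
  by (intro Max_mono) (auto simp: nodes_def)

text \<open>Gives the coarse space, \<open>j = 0\<close>, the same form as the other patch spaces,
  so that all fit \<open>subspace_corrections\<close>.\<close>

definition patch_basis :: "nat \<Rightarrow> ('a \<Rightarrow> real) set" where
  "patch_basis j = nodal_basis \<Omega> (M j) ` (if j = 0 then nodes \<Omega> (M 0) else triplet (e j) \<inter> nodes \<Omega> (M j))"

lemma patch_basis:
  assumes "j \<le> J"
  shows "finite (patch_basis j)" "patch_basis j \<subseteq> fe_space \<Omega> (M J)"
    "patch_space \<Omega> M e j = funs.span (patch_basis j)"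
proof -
  note grid = nodal_grid[OF assms]
  show fin: "finite (patch_basis j)"
    using finite_nodes[OF grid] by (auto simp: patch_basis_def)
  show "patch_basis j \<subseteq> fe_space \<Omega> (M J)"
    using nodal_basis(1)[OF grid open_domain] fe_space_mono_seq[OF assms order_refl]
    by (auto simp: patch_basis_def split: if_splits)
  show "patch_space \<Omega> M e j = funs.span (patch_basis j)"
  proof (cases "j = 0")
    case True
    then show ?thesis
      using fe_space_span[OF nodal_grid[of 0] open_domain] by (simp add: patch_space_def patch_basis_def)
  next
    case False
    then show ?thesis using fun_span_eq[OF fin] by (simp add: patch_space_def patch_basis_def)
  qed
qed

lemma node_space_eq: "node_space \<Omega> (M J) p = funs.span {nodal_basis \<Omega> (M J) p}"
  by (simp add: node_space_def fun_span_eq)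

text \<open>The nodal expansion on the finest grid is already a decomposition, with all patch
  components 0; conversely the coarser spaces are contained in the finest.\<close>

lemma fe_space_decomposes:
  "fe_space \<Omega> (M J) = {v. \<exists>vp vj. decomposes \<Omega> M e J v vp vj}"
proof
  note grid = nodal_grid[OF order_refl]
  note sub = subspace_fe_space[of \<Omega> "M J"]
  show "fe_space \<Omega> (M J) \<subseteq> {v. \<exists>vp vj. decomposes \<Omega> M e J v vp vj}"
  proof
    fix v assume v: "v \<in> fe_space \<Omega> (M J)"
    have "decomposes \<Omega> M e J v (\<lambda>p x. v p * nodal_basis \<Omega> (M J) p x) (\<lambda>j. 0)"
      unfolding decomposes_def
    proof (intro conjI ballI allI impI)
      show "(\<lambda>x. v p * nodal_basis \<Omega> (M J) p x) \<in> node_space \<Omega> (M J) p" for p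
        unfolding node_space_eq by (intro funs.span_scale funs.span_base) simp
      show "0 \<in> patch_space \<Omega> M e j" if "j \<le> J" for j
        unfolding patch_basis(3)[OF that] by (rule funs.span_zero)
      show "v = (\<lambda>x. (\<Sum>p\<in>nodes \<Omega> (M J). v p * nodal_basis \<Omega> (M J) p x) + (\<Sum>j\<le>J. 0 x))"
        by (subst fe_space_expansion[OF grid open_domain v]) (simp add: fun_eq_iff sum_fun_eval)
    qed
    then show "v \<in> {v. \<exists>vp vj. decomposes \<Omega> M e J v vp vj}" by blast
  qed
  show "{v. \<exists>vp vj. decomposes \<Omega> M e J v vp vj} \<subseteq> fe_space \<Omega> (M J)"
  proof safe
    fix v vp vj assume d: "decomposes \<Omega> M e J v vp vj"
    have "vp p \<in> fe_space \<Omega> (M J)" if "p \<in> nodes \<Omega> (M J)" for p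
      using d that nodal_basis(1)[OF grid open_domain that] funs.span_minimal[OF _ sub, of "{nodal_basis \<Omega> (M J) p}"]
      unfolding decomposes_def node_space_eq by blast
    moreover have "vj j \<in> fe_space \<Omega> (M J)" if "j \<le> J" for j
      using d that patch_basis(2,3)[OF that] funs.span_minimal[OF _ sub, of "patch_basis j"]
      unfolding decomposes_def by blast
    ultimately have "(\<Sum>p\<in>nodes \<Omega> (M J). vp p) + (\<Sum>j\<le>J. vj j) \<in> fe_space \<Omega> (M J)"
      by (intro funs.subspace_add[OF sub] funs.subspace_sum[OF sub]) auto
    also have "(\<Sum>p\<in>nodes \<Omega> (M J). vp p) + (\<Sum>j\<le>J. vj j) = v"
      using d by (simp add: decomposes_def fun_eq_iff sum_fun_eval)
    finally show "v \<in> fe_space \<Omega> (M J)" .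
  qed
qed

end

section \<open>The BPX preconditioner\<close>

text \<open>Collects the coefficient of each subspace by exchanging the sum over levels with those
  over nodes and patches; \<open>R\<close> and \<open>S\<close> stand for membership in the index
  sets of level \<open>k\<close>.\<close>

lemma hat_sum_swap:
  fixes f :: "'k \<Rightarrow> real"
  assumes "finite N" "finite K" "finite A"
  shows "c0 * (\<Sum>p\<in>N. x p) + c * (\<Sum>k\<in>K. f k * ((\<Sum>p\<in>{p\<in>N. R k p}. x p) + (\<Sum>j\<in>{j\<in>A. S k j}. y j))) =
    (\<Sum>p\<in>N. (c0 + c * (\<Sum>k\<in>{k\<in>K. R k p}. f k)) * x p) + (\<Sum>j\<in>A. c * (\<Sum>k\<in>{k\<in>K. S k j}. f k) * y j)"
proof -
  have 1: "(\<Sum>k\<in>K. \<Sum>p\<in>{p\<in>N. R k p}. f k * x p) = (\<Sum>p\<in>N. \<Sum>k\<in>{k\<in>K. R k p}. f k * x p)"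
    using assms by (intro sum.swap_restrict)
  have 2: "(\<Sum>k\<in>K. \<Sum>j\<in>{j\<in>A. S k j}. f k * y j) = (\<Sum>j\<in>A. \<Sum>k\<in>{k\<in>K. S k j}. f k * y j)"
    using assms by (intro sum.swap_restrict)
  define S' where "S' p = (\<Sum>k\<in>{k\<in>K. R k p}. f k)" for p
  define T' where "T' j = (\<Sum>k\<in>{k\<in>K. S k j}. f k)" for j
  have "(\<Sum>k\<in>K. f k * ((\<Sum>p\<in>{p\<in>N. R k p}. x p) + (\<Sum>j\<in>{j\<in>A. S k j}. y j))) =
    (\<Sum>p\<in>N. S' p * x p) + (\<Sum>j\<in>A. T' j * y j)"
    unfolding S'_def T'_def by (simp only: distrib_left sum.distrib sum_distrib_left sum_distrib_right 1 2)
  then show ?thesis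
    unfolding S'_def[symmetric] T'_def[symmetric]
    by (simp add: distrib_left distrib_right sum.distrib sum_distrib_left mult.assoc)
qed

text \<open>The four summands bound, in this order, node weights of Bhat by those of B, the
  converse, and the same two for patches. \<open>\<gamma> ^ (2 * kst)\<close> stands for a lower
  bound of \<open>(\<gamma> powr (2 * s)) ^ kst\<close> valid for all s < 1.\<close>

definition equivalence_constant :: "real \<Rightarrow> real \<Rightarrow> nat \<Rightarrow> real \<Rightarrow> real \<Rightarrow> real" where
  "equivalence_constant \<gamma> \<gamma>t kst m1 m2 =
     2 / \<gamma> ^ (2 * kst) / (min 1 m1)\<^sup>2 + (max 1 m2)\<^sup>2
     + (- ln (\<gamma>\<^sup>2)) / (1 - \<gamma>t) * (real (2 * kst + 1) / \<gamma> ^ (2 * kst) / (min 1 m1)\<^sup>2)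
     + (- ln \<gamma>t) / (1 - \<gamma>\<^sup>2) * (max 1 m2)\<^sup>2"

lemma equivalence_constant_pos:
  assumes "0 < \<gamma>" "\<gamma> < 1" "0 < \<gamma>t" "\<gamma>t < 1" "0 < m1"
  shows "0 < equivalence_constant \<gamma> \<gamma>t kst m1 m2"
proof -
  have "0 < \<gamma>\<^sup>2" "\<gamma>\<^sup>2 < 1" using assms by (auto simp: power_less_one_iff)
  then have "0 < - ln (\<gamma>\<^sup>2)" "0 < - ln \<gamma>t" "0 < 1 - \<gamma>\<^sup>2" using assms by simp_all
  then show ?thesis unfolding equivalence_constant_def using assms
    by (intro add_pos_pos mult_pos_pos divide_pos_pos) auto
qed

locale bpx_setting = bisection_sequence \<Omega> \<rho> \<T>\<^sub>0 e J
  for \<Omega> :: "'a::euclidean_space set" and \<rho> :: "('a, 't) bisection_rule" and \<T>\<^sub>0 e J +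
  fixes s \<gamma> \<gamma>t :: real and kst :: nat and m1 m2 :: real and hp :: "'a \<Rightarrow> real" and hj :: "nat \<Rightarrow> real"
  assumes s: "0 < s" "s < 1" and \<gamma>: "0 < \<gamma>" "\<gamma> < 1" and \<gamma>t: "0 < \<gamma>t" "\<gamma>t < 1" and m1: "0 < m1"
    and mesh: "local_mesh_sizes \<Omega> (grid_seq \<rho> \<T>\<^sub>0 e) e J \<gamma> m1 m2 hp hj"
begin

abbreviation "V \<equiv> fe_space \<Omega> (M J)"
abbreviation "N \<equiv> nodes \<Omega> (M J)"
abbreviation "Jmax \<equiv> max_gen (M J)"

definition q where "q = \<gamma> powr (2 * s)"

definition F :: "'a + nat \<Rightarrow> ('a \<Rightarrow> real) set" where
  "F = case_sum (\<lambda>p. {nodal_basis \<Omega> (M J) p}) patch_basis"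

definition w :: "'a + nat \<Rightarrow> real" where
  "w = case_sum (\<lambda>p. hp p powr (2 * s)) (\<lambda>j. (1 - \<gamma>t powr s) * hj j powr (2 * s))"

text \<open>\<open>Inl p\<close> indexes the fine-grid term, \<open>Inr (k, i)\<close> the copy of
  subspace \<open>i\<close> at level \<open>k\<close>, since a subspace may occur at several levels
  with different weights.\<close>

definition Ihat :: "('a + nat \<times> ('a + nat)) set" where
  "Ihat = N <+> Sigma {..Jmax} (\<lambda>k. nodes_upto \<Omega> (M J) (k + kst) <+> patches_near M e J kst k)"

definition Fhat :: "'a + nat \<times> ('a + nat) \<Rightarrow> ('a \<Rightarrow> real) set" where
  "Fhat = case_sum (\<lambda>p. {nodal_basis \<Omega> (M J) p}) (\<lambda>(k, i). F i)"

definition what :: "'a + nat \<times> ('a + nat) \<Rightarrow> real" where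
  "what = case_sum (\<lambda>p. q ^ Jmax) (\<lambda>(k, i). (1 - q) * q ^ k)"

lemma q: "0 < q" "q < 1"
  using \<gamma> s powr_less_mono'[of \<gamma> 0 "2 * s"] by (auto simp: q_def)

lemma \<gamma>t_powr: "\<gamma>t powr s < 1"
  using \<gamma>t s powr_less_mono'[of \<gamma>t 0 s] by simp

lemma q_powr: "\<gamma> powr (2 * s * real k) = q ^ k" "\<gamma> powr (- 2 * s * real k) = 1 / q ^ k"
proof -
  show *: "\<gamma> powr (2 * s * real k) = q ^ k"
    using \<gamma> by (simp add: q_def powr_realpow[symmetric] powr_powr)
  show "\<gamma> powr (- 2 * s * real k) = 1 / q ^ k"
    using powr_minus_divide[of \<gamma> "2 * s * real k"] by (simp add: *)
qed

lemma finite_N: "finite N"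
  by (rule finite_nodes[OF nodal_grid[OF order_refl]])

lemma nodes_upto_subset: "nodes_upto \<Omega> (M J) m \<subseteq> N"
  by (auto simp: nodes_upto_def)

lemma patches_near_subset: "patches_near M e J kst k \<subseteq> {..J}"
  by (auto simp: patches_near_def)

lemma finite_levels: "finite (nodes_upto \<Omega> (M J) m)" "finite (patches_near M e J kst k)"
  using finite_subset[OF nodes_upto_subset finite_N] finite_subset[OF patches_near_subset] by auto

lemma F: "i \<in> N <+> {..J} \<Longrightarrow> finite (F i)" "i \<in> N <+> {..J} \<Longrightarrow> F i \<subseteq> V"
proof -
  assume i: "i \<in> N <+> {..J}"
  have "finite (F i) \<and> F i \<subseteq> V"
  proof (cases i)
    case (Inl p)
    then show ?thesis
      using i nodal_basis(1)[OF nodal_grid[OF order_refl] open_domain] by (auto simp: F_def)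
  next
    case (Inr j)
    then have "j \<le> J" using i by auto
    then show ?thesis using patch_basis(1,2) Inr by (simp add: F_def)
  qed
  then show "finite (F i)" "F i \<subseteq> V" by blast+
qed

lemma mesh_pos: "p \<in> N \<Longrightarrow> hp p > 0" "j \<le> J \<Longrightarrow> hj j > 0"
proof -
  have *: "0 < m1 * \<gamma> ^ l" for l using m1 \<gamma> by simp
  show "p \<in> N \<Longrightarrow> hp p > 0" "j \<le> J \<Longrightarrow> hj j > 0"
    using mesh *[of "level (M J) p"] *[of "patch_gen M e j"] less_le_trans
    unfolding local_mesh_sizes_def by blast+
qed

lemma l2_form: "inner_form V (l2_inner \<Omega>)" and energy_form: "inner_form V (frac_form s)"
  using inner_form.inner_form_subspace[OF inner_form_l2[OF bounded_domain] subspace_fe_space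
      fe_space_lipschitz[OF nodal_grid[OF order_refl] open_domain]]
    inner_form.inner_form_subspace[OF inner_form_frac[OF bounded_domain open_domain s] subspace_fe_space
      fe_space_lipschitz[OF nodal_grid[OF order_refl] open_domain]] by auto

section \<open>Both preconditioners as subspace corrections\<close>

sublocale bpx: preconditioned V "l2_inner \<Omega>" "N <+> {..J}" F w "frac_form s" "nodal_basis \<Omega> (M J) ` N"
proof -
  interpret l2: inner_form V "l2_inner \<Omega>" by (rule l2_form)
  interpret en: inner_form V "frac_form s" by (rule energy_form)
  show "preconditioned V (l2_inner \<Omega>) (N <+> {..J}) F w (frac_form s) (nodal_basis \<Omega> (M J) ` N)"
  proof unfold_locales
    show "finite (N <+> {..J})" using finite_N by simp
    show "finite (F i)" "F i \<subseteq> V" if "i \<in> N <+> {..J}" for i using F that by blast+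
    show "0 < w i" if "i \<in> N <+> {..J}" for i
    proof (cases i)
      case (Inl p)
      then show ?thesis using that mesh_pos(1)[of p] by (auto simp: w_def)
    next
      case (Inr j)
      then show ?thesis using that mesh_pos(2)[of j] \<gamma>t_powr by (auto simp: w_def intro!: mult_pos_pos)
    qed
    show "finite (nodal_basis \<Omega> (M J) ` N)" using finite_N by simp
    show "V = funs.span (nodal_basis \<Omega> (M J) ` N)"
      by (rule fe_space_span[OF nodal_grid[OF order_refl] open_domain])
  qed
qed

lemma Ihat_F: "Inr (k, i) \<in> Ihat \<Longrightarrow> i \<in> N <+> {..J}"
  using nodes_upto_subset patches_near_subset by (fastforce simp: Ihat_def)

sublocale hat: subspace_corrections V "l2_inner \<Omega>" Ihat Fhat what
proof -
  interpret l2: inner_form V "l2_inner \<Omega>" by (rule l2_form)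
  show "subspace_corrections V (l2_inner \<Omega>) Ihat Fhat what"
  proof unfold_locales
    show "finite Ihat" unfolding Ihat_def using finite_N finite_levels by (intro finite_Plus finite_SigmaI) auto
    fix i assume i: "i \<in> Ihat"
    have "Fhat i = (case i of Inl p \<Rightarrow> F (Inl p) | Inr (k, i) \<Rightarrow> F i)"
      by (simp add: Fhat_def F_def split: sum.split)
    moreover have "(case i of Inl p \<Rightarrow> Inl p | Inr (k, i) \<Rightarrow> i) \<in> N <+> {..J}"
      using i Ihat_F by (auto simp: Ihat_def split: sum.split)
    ultimately show "finite (Fhat i)" "Fhat i \<subseteq> V"
      using F[of "case i of Inl p \<Rightarrow> Inl p | Inr (k, i) \<Rightarrow> i"] by (auto split: sum.splits)
    show "0 < what i" using q by (auto simp: what_def split: sum.split)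
  qed
qed

lemma Q_node: "bpx.Q (Inl p) v = l2_proj \<Omega> (node_space \<Omega> (M J) p) v"
  unfolding bpx.Q_def by (simp add: l2_proj_def node_space_eq F_def)

lemma Q_patch: "j \<le> J \<Longrightarrow> bpx.Q (Inr j) v = l2_proj \<Omega> (patch_space \<Omega> M e j) v"
  unfolding bpx.Q_def by (simp add: l2_proj_def patch_basis(3) F_def)

lemma Q_hat: "hat.Q (Inl p) = bpx.Q (Inl p)" "hat.Q (Inr (k, i)) = bpx.Q i"
  unfolding bpx.Q_def[abs_def] hat.Q_def[abs_def] by (simp_all add: Fhat_def F_def)

lemma sum_I: "(\<Sum>i\<in>N <+> {..J}. f i) = (\<Sum>p\<in>N. f (Inl p)) + (\<Sum>j\<le>J. f (Inr j))"
  for f :: "'a + nat \<Rightarrow> 'c::comm_monoid_add"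
  using finite_N by (simp add: sum.Plus)

lemma sum_Ihat: "(\<Sum>i\<in>Ihat. f i) = (\<Sum>p\<in>N. f (Inl p)) +
    (\<Sum>k\<le>Jmax. (\<Sum>p\<in>nodes_upto \<Omega> (M J) (k + kst). f (Inr (k, Inl p))) +
      (\<Sum>j\<in>patches_near M e J kst k. f (Inr (k, Inr j))))"
  for f :: "'a + nat \<times> ('a + nat) \<Rightarrow> 'c::comm_monoid_add"
proof -
  let ?S = "\<lambda>k. nodes_upto \<Omega> (M J) (k + kst) <+> patches_near M e J kst k"
  have fin: "finite (Sigma {..Jmax} ?S)" using finite_levels by (intro finite_SigmaI finite_Plus) auto
  have "(\<Sum>i\<in>Ihat. f i) = (\<Sum>p\<in>N. f (Inl p)) + (\<Sum>z\<in>Sigma {..Jmax} ?S. f (Inr z))"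
    unfolding Ihat_def using finite_N fin by (simp add: sum.Plus)
  also have "(\<Sum>z\<in>Sigma {..Jmax} ?S. f (Inr z)) = (\<Sum>k\<le>Jmax. \<Sum>i\<in>?S k. f (Inr (k, i)))"
    using finite_levels by (subst sum.Sigma) (auto simp: case_prod_beta)
  also have "\<dots> = (\<Sum>k\<le>Jmax. (\<Sum>p\<in>nodes_upto \<Omega> (M J) (k + kst). f (Inr (k, Inl p))) +
      (\<Sum>j\<in>patches_near M e J kst k. f (Inr (k, Inr j))))"
    using finite_levels by (simp add: sum.Plus)
  finally show ?thesis .
qed

lemma bpx_eq: "Defs.bpx \<Omega> M e J s \<gamma>t hp hj = bpx.B"
proof (intro ext)
  fix v x
  have "(1 - \<gamma>t powr s) * (\<Sum>j\<le>J. hj j powr (2 * s) * l2_proj \<Omega> (patch_space \<Omega> M e j) v x) =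
    (\<Sum>j\<le>J. w (Inr j) * bpx.Q (Inr j) v x)"
    by (simp add: sum_distrib_left w_def Q_patch mult.assoc)
  then show "Defs.bpx \<Omega> M e J s \<gamma>t hp hj v x = bpx.B v x"
    by (simp add: bpx_def bpx.B_def sum_fun_eval sum_I) (simp add: w_def Q_node)
qed

lemma bpx_hat_eq: "bpx_hat \<Omega> M e J s \<gamma> kst = hat.B"
proof (intro ext)
  fix v x
  have near: "j \<le> J" if "j \<in> patches_near M e J kst k" for j k using that patches_near_subset by blast
  have "hat.B v x = (\<Sum>p\<in>N. q ^ Jmax * bpx.Q (Inl p) v x) +
    (\<Sum>k\<le>Jmax. (\<Sum>p\<in>nodes_upto \<Omega> (M J) (k + kst). (1 - q) * q ^ k * bpx.Q (Inl p) v x) +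
      (\<Sum>j\<in>patches_near M e J kst k. (1 - q) * q ^ k * bpx.Q (Inr j) v x))"
    unfolding hat.B_def sum_fun_eval sum_Ihat Q_hat by (simp add: what_def)
  also have "\<dots> = bpx_hat \<Omega> M e J s \<gamma> kst v x"
    unfolding bpx_hat_def q_powr unfolding q_def[symmetric]
    by (simp add: near sum_distrib_left distrib_left mult.assoc Q_node Q_patch cong: sum.cong)
  finally show "bpx_hat \<Omega> M e J s \<gamma> kst v x = hat.B v x" by simp
qed

lemma form_operator_eq: "form_operator \<Omega> s V = bpx.A"
  by (auto simp: form_operator_def bpx.A_def fun_eq_iff)

section \<open>Comparison of the quadratic forms\<close>

lemma ip_bpx:
  assumes "v \<in> V"
  shows "l2_inner \<Omega> (bpx.B v) v = (\<Sum>p\<in>N. w (Inl p) * l2_inner \<Omega> (bpx.Q (Inl p) v) (bpx.Q (Inl p) v)) +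
    (\<Sum>j\<le>J. w (Inr j) * l2_inner \<Omega> (bpx.Q (Inr j) v) (bpx.Q (Inr j) v))"
  unfolding bpx.ip_B[OF assms assms] sum_I ..

text \<open>The total weight of node \<open>p\<close> in Bhat, over the fine-grid term and all
  levels at which \<open>p\<close> occurs; \<open>Wpatch\<close> plays the same role for
  patches.\<close>

definition Wnode :: "'a \<Rightarrow> real" where
  "Wnode p = q ^ Jmax + (1 - q) * (\<Sum>k\<in>{k\<in>{..Jmax}. level (M J) p \<le> k + kst}. q ^ k)"

definition Wpatch :: "nat \<Rightarrow> real" where
  "Wpatch j = (1 - q) * (\<Sum>k\<in>{k\<in>{..Jmax}. int k - int kst \<le> int (patch_gen M e j) \<and> patch_gen M e j \<le> k + kst}. q ^ k)"

lemma ip_hat: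
  assumes "v \<in> V"
  shows "l2_inner \<Omega> (hat.B v) v = (\<Sum>p\<in>N. Wnode p * l2_inner \<Omega> (bpx.Q (Inl p) v) (bpx.Q (Inl p) v)) +
    (\<Sum>j\<le>J. Wpatch j * l2_inner \<Omega> (bpx.Q (Inr j) v) (bpx.Q (Inr j) v))"
proof -
  define n where "n i = l2_inner \<Omega> (bpx.Q i v) (bpx.Q i v)" for i
  have near: "patches_near M e J kst k = {j\<in>{..J}. int k - int kst \<le> int (patch_gen M e j) \<and> patch_gen M e j \<le> k + kst}" for k
    by (auto simp: patches_near_def)
  have "l2_inner \<Omega> (hat.B v) v = (\<Sum>p\<in>N. q ^ Jmax * n (Inl p)) +
    (\<Sum>k\<le>Jmax. (\<Sum>p\<in>nodes_upto \<Omega> (M J) (k + kst). (1 - q) * q ^ k * n (Inl p)) +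
      (\<Sum>j\<in>patches_near M e J kst k. (1 - q) * q ^ k * n (Inr j)))"
    unfolding hat.ip_B[OF assms assms] sum_Ihat Q_hat by (simp add: what_def n_def)
  also have "\<dots> = q ^ Jmax * (\<Sum>p\<in>N. n (Inl p)) + (1 - q) * (\<Sum>k\<le>Jmax. q ^ k *
      ((\<Sum>p\<in>{p\<in>N. level (M J) p \<le> k + kst}. n (Inl p)) +
       (\<Sum>j\<in>{j\<in>{..J}. int k - int kst \<le> int (patch_gen M e j) \<and> patch_gen M e j \<le> k + kst}. n (Inr j))))"
    unfolding near nodes_upto_def by (simp add: sum_distrib_left distrib_left mult.assoc)
  also have "\<dots> = (\<Sum>p\<in>N. Wnode p * n (Inl p)) + (\<Sum>j\<le>J. Wpatch j * n (Inr j))"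
    unfolding Wnode_def Wpatch_def using finite_N by (intro hat_sum_swap) auto
  finally show ?thesis unfolding n_def .
qed

abbreviation "C \<equiv> equivalence_constant \<gamma> \<gamma>t kst m1 m2"

lemma weights:
  shows "p \<in> N \<Longrightarrow> Wnode p \<le> C * w (Inl p) \<and> w (Inl p) \<le> C * Wnode p"
    and "j \<le> J \<Longrightarrow> Wpatch j \<le> C * w (Inr j) \<and> w (Inr j) \<le> C * Wpatch j"
    and "C > 0"
proof -
  define D where "D = \<gamma> ^ (2 * kst)"
  define K1 where "K1 = (min 1 m1)\<^sup>2"
  define K2 where "K2 = (max 1 m2)\<^sup>2"
  define E1 where "E1 = (- ln (\<gamma>\<^sup>2)) / (1 - \<gamma>t)"
  define E2 where "E2 = (- ln \<gamma>t) / (1 - \<gamma>\<^sup>2)"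
  have pos: "D > 0" "K1 > 0" "K2 > 0" using \<gamma> m1 by (auto simp: D_def K1_def K2_def)
  have \<gamma>2: "0 < \<gamma>\<^sup>2" "\<gamma>\<^sup>2 < 1" using \<gamma> by (auto simp: power_less_one_iff)
  have E: "E1 > 0" "E2 > 0" using \<gamma>2 \<gamma>t by (simp_all add: E1_def E2_def divide_neg_pos)
  have q2: "q = \<gamma>\<^sup>2 powr s" using \<gamma> by (simp add: q_def powr_powr[symmetric])
  have ratio: "1 - q \<le> E1 * (1 - \<gamma>t powr s)" "1 - \<gamma>t powr s \<le> E2 * (1 - q)"
    unfolding q2 E1_def E2_def using one_minus_powr_ratio \<gamma>2 \<gamma>t s by blast+
  have C: "C = 2 / D / K1 + K2 + E1 * (real (2 * kst + 1) / D / K1) + E2 * K2"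
    by (simp only: equivalence_constant_def D_def K1_def K2_def E1_def E2_def)
  have terms: "2 / D / K1 > 0" "K2 > 0" "E1 * (real (2 * kst + 1) / D / K1) > 0" "E2 * K2 > 0"
    using pos E by auto
  then have Cge: "2 / D / K1 \<le> C" "K2 \<le> C" "E1 * (real (2 * kst + 1) / D / K1) \<le> C" "E2 * K2 \<le> C"
    unfolding C by linarith+
  show "C > 0" using terms Cge by linarith
  have "\<gamma>\<^sup>2 \<le> q" using \<gamma> s powr_mono'[of "2 * s" 2 \<gamma>] by (simp add: q_def)
  \<comment> \<open>This trades the s-dependent \<open>q ^ kst\<close> for the constant
    \<open>D\<close>.\<close>
  then have "D \<le> q ^ kst" using \<gamma> unfolding D_def power_mult by (intro power_mono) auto
  then have D: "c / q ^ kst \<le> c / D" if "c \<ge> 0" for c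
    using pos that by (intro divide_left_mono mult_pos_pos) (auto simp: q)
  have qk: "q ^ k > 0" for k using q by simp
  show "Wnode p \<le> C * w (Inl p) \<and> w (Inl p) \<le> C * Wnode p" if p: "p \<in> N"
  proof
    let ?l = "level (M J) p"
    have h: "K1 * q ^ ?l \<le> w (Inl p)" "w (Inl p) \<le> K2 * q ^ ?l"
      using mesh_size_powr_bounds[OF \<gamma>(1) m1 s, of ?l "hp p" m2] mesh p
      by (auto simp: local_mesh_sizes_def w_def q_def K1_def K2_def)
    note W = node_weight_bounds[OF q level_le[OF p], of kst, folded Wnode_def]
    have "Wnode p \<le> 2 / q ^ kst * q ^ ?l" by (rule W)
    also have "\<dots> \<le> 2 / D * q ^ ?l" using D[of 2] qk[of ?l] by (intro mult_right_mono) auto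
    also have "\<dots> = 2 / D / K1 * (K1 * q ^ ?l)" using pos by simp
    also have "\<dots> \<le> C * w (Inl p)"
      using h Cge terms pos qk[of ?l] by (intro mult_mono) auto
    finally show "Wnode p \<le> C * w (Inl p)" .
    have "w (Inl p) \<le> K2 * q ^ ?l" by (rule h)
    also have "\<dots> \<le> C * Wnode p" using W Cge terms qk[of ?l] by (intro mult_mono) auto
    finally show "w (Inl p) \<le> C * Wnode p" .
  qed
  show "Wpatch j \<le> C * w (Inr j) \<and> w (Inr j) \<le> C * Wpatch j" if j: "j \<le> J"
  proof
    let ?g = "patch_gen M e j" and ?t = "1 - \<gamma>t powr s"
    have t: "?t > 0" using \<gamma>t_powr by simp
    have "K1 * q ^ ?g \<le> hj j powr (2 * s)" "hj j powr (2 * s) \<le> K2 * q ^ ?g"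
      using mesh_size_powr_bounds[OF \<gamma>(1) m1 s, of ?g "hj j" m2] mesh j
      by (auto simp: local_mesh_sizes_def q_def K1_def K2_def)
    then have h: "?t * (K1 * q ^ ?g) \<le> w (Inr j)" "w (Inr j) \<le> ?t * (K2 * q ^ ?g)"
      using t by (auto simp: w_def intro!: mult_left_mono)
    define X where "X = (\<Sum>k\<in>{k\<in>{..Jmax}. int k - int kst \<le> int ?g \<and> ?g \<le> k + kst}. q ^ k)"
    have WX: "Wpatch j = (1 - q) * X" by (simp add: Wpatch_def X_def)
    note X = patch_weight_bounds[OF q patch_gen_le[OF j], of kst, folded X_def]
    have X0: "0 \<le> X" using X(1) qk[of ?g] by linarith
    let ?c = "real (2 * kst + 1)"
    have "X \<le> ?c / q ^ kst * q ^ ?g" by (rule X)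
    also have "\<dots> \<le> ?c / D * q ^ ?g" using D[of ?c] qk[of ?g] by (intro mult_right_mono) auto
    \<comment> \<open>Here the factor \<open>1 - q\<close> of Bhat is exchanged for
      \<open>1 - \<gamma>t powr s\<close>, the factor of B, at the price of
      \<open>E1\<close>.\<close>
    finally have "Wpatch j \<le> (E1 * ?t) * (?c / D * q ^ ?g)"
      unfolding WX using ratio(1) X0 E t by (intro mult_mono) (auto simp del: of_nat_add of_nat_mult)
    also have "\<dots> = (E1 * (?c / D / K1)) * (?t * (K1 * q ^ ?g))" using pos by simp
    also have "\<dots> \<le> C * w (Inr j)"
    proof (rule mult_mono)
      show "0 \<le> ?t * (K1 * q ^ ?g)" using pos qk[of ?g] t by simp
    qed (use h Cge \<open>C > 0\<close> in auto)
    finally show "Wpatch j \<le> C * w (Inr j)" .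
    have "w (Inr j) \<le> ?t * (K2 * q ^ ?g)" by (rule h)
    also have "\<dots> \<le> (E2 * (1 - q)) * (K2 * X)"
    proof (intro mult_mono)
      show "0 \<le> K2 * q ^ ?g" using pos qk[of ?g] by simp
    qed (use ratio X X0 E q pos qk[of ?g] in auto)
    also have "\<dots> = (E2 * K2) * Wpatch j" by (simp add: WX)
    also have "\<dots> \<le> C * Wpatch j"
      using Cge X0 q unfolding WX by (intro mult_right_mono) auto
    finally show "w (Inr j) \<le> C * Wpatch j" .
  qed
qed

lemma spectral_equivalence:
  assumes v: "v \<in> V"
  shows "l2_inner \<Omega> (hat.B v) v \<le> C * l2_inner \<Omega> (bpx.B v) v"
    and "l2_inner \<Omega> (bpx.B v) v \<le> C * l2_inner \<Omega> (hat.B v) v"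
proof -
  have nn: "0 \<le> l2_inner \<Omega> (bpx.Q i v) (bpx.Q i v)" if "i \<in> N <+> {..J}" for i
    using bpx.nonneg[OF bpx.Q(2)[OF that v]] .
  have m: "W * n \<le> C * (W' * n)" if "W \<le> C * W'" "0 \<le> n" for W W' n
    using mult_right_mono[OF that] by (simp add: mult.assoc)
  show "l2_inner \<Omega> (hat.B v) v \<le> C * l2_inner \<Omega> (bpx.B v) v"
    "l2_inner \<Omega> (bpx.B v) v \<le> C * l2_inner \<Omega> (hat.B v) v"
    unfolding ip_hat[OF v] ip_bpx[OF v] distrib_left sum_distrib_left
    using weights nn by (auto intro!: add_mono sum_mono m)
qed

section \<open>Bounds for the spectrum of BA\<close>

lemma l2_norm_square: "v \<in> V \<Longrightarrow> (l2_norm \<Omega> v)\<^sup>2 = l2_inner \<Omega> v v"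
  using bpx.nonneg by (simp add: l2_norm_def)

lemma frac_norm_square: "v \<in> V \<Longrightarrow> (frac_norm s v)\<^sup>2 = frac_form s v v"
  using bpx.en.nonneg by (simp add: frac_norm_def)

text \<open>The weights in \<open>stable_decomposition\<close> are the reciprocals of
  \<open>what\<close>, so \<open>stable_decomposition_bound\<close> applies with \<open>g\<close>
  the function \<open>bpx.A v\<close>, whose pairing with \<open>v\<close> is the energy.\<close>

lemma stable_decomposition_hat:
  assumes stable: "stable_decomposition \<Omega> M e J s \<gamma> kst c\<^sub>0" and v: "v \<in> V" "v \<noteq> 0"
  shows "c\<^sub>0 > 0" "frac_form s v v \<le> c\<^sub>0 * l2_inner \<Omega> (hat.B (bpx.A v)) (bpx.A v)"
proof -
  obtain vp vq vj where
    vp: "\<forall>p\<in>N. vp p \<in> node_space \<Omega> (M J) p"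
    and vqj: "\<forall>k\<le>Jmax. (\<forall>p\<in>nodes_upto \<Omega> (M J) (k + kst). vq p k \<in> node_space \<Omega> (M J) p) \<and>
      (\<forall>j\<in>patches_near M e J kst k. vj j k \<in> patch_space \<Omega> M e j)"
    and sum: "v = (\<lambda>x. (\<Sum>p\<in>N. vp p x) + (\<Sum>k\<le>Jmax. (\<Sum>p\<in>nodes_upto \<Omega> (M J) (k + kst). vq p k x)
        + (\<Sum>j\<in>patches_near M e J kst k. vj j k x)))"
    and est: "\<gamma> powr (- 2 * s * real Jmax) * (\<Sum>p\<in>N. (l2_norm \<Omega> (vp p))\<^sup>2)
        + (\<Sum>k\<le>Jmax. \<gamma> powr (- 2 * s * real k) / (1 - \<gamma> powr (2 * s)) *
             ((\<Sum>p\<in>nodes_upto \<Omega> (M J) (k + kst). (l2_norm \<Omega> (vq p k))\<^sup>2)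
              + (\<Sum>j\<in>patches_near M e J kst k. (l2_norm \<Omega> (vj j k))\<^sup>2)))
        \<le> c\<^sub>0 * (frac_norm s v)\<^sup>2"
    using bspec[OF stable[unfolded stable_decomposition_def] v(1)] by (elim exE conjE) (rule that)
  define vs where "vs = case_sum vp (\<lambda>(k, i). case_sum (\<lambda>p. vq p k) (\<lambda>j. vj j k) i)"
  have mem: "vs i \<in> funs.span (Fhat i)" if "i \<in> Ihat" for i
    using that vp vqj patch_basis(3) patches_near_subset
    by (fastforce simp: Ihat_def vs_def Fhat_def F_def node_space_eq)
  have vsV: "vs i \<in> V" if "i \<in> Ihat" for i using hat.span_F[OF that mem[OF that]] .
  have v_sum: "(\<Sum>i\<in>Ihat. vs i) = v"
    unfolding sum_Ihat by (subst sum) (simp add: vs_def fun_eq_iff sum_fun_eval)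
  have X: "frac_form s v v = l2_inner \<Omega> (bpx.A v) (\<Sum>i\<in>Ihat. vs i)"
    unfolding v_sum using bpx.A(2)[OF v(1) v(1)] by simp
  have inIhat: "Inl p \<in> Ihat" if "p \<in> N" for p using that by (auto simp: Ihat_def)
  have inIhat': "Inr (k, Inl p) \<in> Ihat" if "k \<le> Jmax" "p \<in> nodes_upto \<Omega> (M J) (k + kst)" for k p
    using that by (auto simp: Ihat_def)
  have inIhat'': "Inr (k, Inr j) \<in> Ihat" if "k \<le> Jmax" "j \<in> patches_near M e J kst k" for k j
    using that by (auto simp: Ihat_def)
  have norms: "p \<in> N \<Longrightarrow> (l2_norm \<Omega> (vp p))\<^sup>2 = l2_inner \<Omega> (vp p) (vp p)"
    "k \<le> Jmax \<Longrightarrow> p \<in> nodes_upto \<Omega> (M J) (k + kst) \<Longrightarrow> (l2_norm \<Omega> (vq p k))\<^sup>2 = l2_inner \<Omega> (vq p k) (vq p k)"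
    "k \<le> Jmax \<Longrightarrow> j \<in> patches_near M e J kst k \<Longrightarrow> (l2_norm \<Omega> (vj j k))\<^sup>2 = l2_inner \<Omega> (vj j k) (vj j k)" for p k j
    using l2_norm_square vsV[OF inIhat] vsV[OF inIhat'] vsV[OF inIhat''] by (auto simp: vs_def)
  have "(\<Sum>i\<in>Ihat. l2_inner \<Omega> (vs i) (vs i) / what i) = 1 / q ^ Jmax * (\<Sum>p\<in>N. l2_inner \<Omega> (vp p) (vp p))
        + (\<Sum>k\<le>Jmax. 1 / q ^ k / (1 - q) *
             ((\<Sum>p\<in>nodes_upto \<Omega> (M J) (k + kst). l2_inner \<Omega> (vq p k) (vq p k))
              + (\<Sum>j\<in>patches_near M e J kst k. l2_inner \<Omega> (vj j k) (vj j k))))"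
    unfolding sum_Ihat by (simp add: vs_def what_def sum_divide_distrib add_divide_distrib sum_distrib_left mult.commute)
  also have "\<dots> \<le> c\<^sub>0 * frac_form s v v"
    using est unfolding q_powr frac_norm_square[OF v(1)]
    by (simp add: norms q_def[symmetric] cong: sum.cong_simp)
  finally have N: "(\<Sum>i\<in>Ihat. l2_inner \<Omega> (vs i) (vs i) / what i) \<le> c\<^sub>0 * frac_form s v v" .
  show "c\<^sub>0 > 0" "frac_form s v v \<le> c\<^sub>0 * l2_inner \<Omega> (hat.B (bpx.A v)) (bpx.A v)"
    using hat.stable_decomposition_bound[OF bpx.A(1)[OF v(1)] mem X bpx.en.pos[OF v] N] by auto
qed

text \<open>The weights in \<open>bounded_decompositions\<close> are the reciprocals of
  \<open>w\<close>, as \<open>eigenvalue_upper\<close> requires.\<close>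

lemma bounded_decompositions_sum:
  assumes bd: "bounded_decompositions \<Omega> M e J s \<gamma>t hp hj c\<^sub>1"
    and vs: "\<And>i. i \<in> N <+> {..J} \<Longrightarrow> vs i \<in> funs.span (F i)"
  shows "frac_form s (\<Sum>i\<in>N <+> {..J}. vs i) (\<Sum>i\<in>N <+> {..J}. vs i) \<le>
    c\<^sub>1 * (\<Sum>i\<in>N <+> {..J}. l2_inner \<Omega> (vs i) (vs i) / w i)"
proof -
  define v where "v = (\<Sum>i\<in>N <+> {..J}. vs i)"
  have vsV: "vs i \<in> V" if "i \<in> N <+> {..J}" for i using bpx.span_F[OF that vs[OF that]] .
  have vV: "v \<in> V" unfolding v_def using vsV by (intro bpx.mem_simps)
  have "decomposes \<Omega> M e J v (\<lambda>p. vs (Inl p)) (\<lambda>j. vs (Inr j))"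
    unfolding decomposes_def
  proof (intro conjI ballI allI impI)
    show "vs (Inl p) \<in> node_space \<Omega> (M J) p" if "p \<in> N" for p
      using vs[of "Inl p"] that by (auto simp: node_space_eq F_def)
    show "vs (Inr j) \<in> patch_space \<Omega> M e j" if "j \<le> J" for j
      using vs[of "Inr j"] that by (auto simp: patch_basis(3) F_def)
    show "v = (\<lambda>x. (\<Sum>p\<in>N. vs (Inl p) x) + (\<Sum>j\<le>J. vs (Inr j) x))"
      unfolding v_def sum_I by (simp add: fun_eq_iff sum_fun_eval)
  qed
  then have "(frac_norm s v)\<^sup>2 \<le> c\<^sub>1 * ((\<Sum>p\<in>N. hp p powr (- 2 * s) * (l2_norm \<Omega> (vs (Inl p)))\<^sup>2)
      + 1 / (1 - \<gamma>t powr s) * (\<Sum>j\<le>J. hj j powr (- 2 * s) * (l2_norm \<Omega> (vs (Inr j)))\<^sup>2))"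
    using bd unfolding bounded_decompositions_def by blast
  also have "(\<Sum>p\<in>N. hp p powr (- 2 * s) * (l2_norm \<Omega> (vs (Inl p)))\<^sup>2) =
      (\<Sum>p\<in>N. l2_inner \<Omega> (vs (Inl p)) (vs (Inl p)) / w (Inl p))"
    by (intro sum.cong) (auto simp: l2_norm_square[OF vsV[OF InlI]] w_def powr_minus_divide)
  also have "1 / (1 - \<gamma>t powr s) * (\<Sum>j\<le>J. hj j powr (- 2 * s) * (l2_norm \<Omega> (vs (Inr j)))\<^sup>2) =
      (\<Sum>j\<le>J. l2_inner \<Omega> (vs (Inr j)) (vs (Inr j)) / w (Inr j))"
    unfolding sum_distrib_left by (intro sum.cong) (auto simp: l2_norm_square[OF vsV[OF InrI]] w_def powr_minus_divide)
  finally show ?thesis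
    unfolding frac_norm_square[OF vV] unfolding v_def[symmetric] unfolding sum_I .
qed

lemma fe_space_nontrivial: "N \<noteq> {} \<Longrightarrow> \<exists>v\<in>V. v \<noteq> 0"
proof -
  assume "N \<noteq> {}"
  then obtain p where p: "p \<in> N" by blast
  note nb = nodal_basis[OF nodal_grid[OF order_refl] open_domain p]
  have "nodal_basis \<Omega> (M J) p p = 1" using nb(2)[OF p] by simp
  then show ?thesis using nb(1) by (intro bexI[of _ "nodal_basis \<Omega> (M J) p"]) auto
qed

text \<open>An interior node is assumed because the zero space has no eigenvectors.\<close>

lemma eigenvalues:
  assumes N: "N \<noteq> {}"
  defines "E \<equiv> eigenvalues_on V (bpx.B \<circ> bpx.A)"
  shows "finite E" "E \<noteq> {}"
    and "stable_decomposition \<Omega> M e J s \<gamma> kst c\<^sub>0 \<Longrightarrow> c\<^sub>0 > 0"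
    and "stable_decomposition \<Omega> M e J s \<gamma> kst c\<^sub>0 \<Longrightarrow> \<mu> \<in> E \<Longrightarrow> 1 / (C * c\<^sub>0) \<le> \<mu>"
    and "\<mu> \<in> E \<Longrightarrow> 0 < \<mu> \<Longrightarrow> bounded_decompositions \<Omega> M e J s \<gamma>t hp hj c\<^sub>1 \<Longrightarrow> \<mu> \<le> c\<^sub>1"
proof -
  show "finite E" "E \<noteq> {}"
    unfolding E_def using bpx.BA.finite_eigenvalues bpx.BA.eigenvalue_exists[OF fe_space_nontrivial[OF N]] by auto
  show c0: "c\<^sub>0 > 0" if "stable_decomposition \<Omega> M e J s \<gamma> kst c\<^sub>0"
    using stable_decomposition_hat(1)[OF that] fe_space_nontrivial[OF N] by blast
  show "1 / (C * c\<^sub>0) \<le> \<mu>" if st: "stable_decomposition \<Omega> M e J s \<gamma> kst c\<^sub>0" and \<mu>: "\<mu> \<in> E"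
  proof (rule bpx.eigenvalue_lower[OF \<mu>[unfolded E_def]])
    show "C * c\<^sub>0 > 0" using c0[OF st] weights(3) by simp
    fix v assume v: "v \<in> V" "v \<noteq> 0"
    have "frac_form s v v \<le> c\<^sub>0 * l2_inner \<Omega> (hat.B (bpx.A v)) (bpx.A v)"
      by (rule stable_decomposition_hat(2)[OF st v])
    also have "\<dots> \<le> c\<^sub>0 * (C * l2_inner \<Omega> (bpx.B (bpx.A v)) (bpx.A v))"
      using spectral_equivalence(1)[OF bpx.A(1)[OF v(1)]] c0[OF st] by (intro mult_left_mono) auto
    finally show "frac_form s v v \<le> C * c\<^sub>0 * l2_inner \<Omega> (bpx.B (bpx.A v)) (bpx.A v)"
      by (simp add: mult_ac)
  qed
  show "\<mu> \<le> c\<^sub>1" if "\<mu> \<in> E" "0 < \<mu>" "bounded_decompositions \<Omega> M e J s \<gamma>t hp hj c\<^sub>1"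
    using bpx.eigenvalue_upper[OF that(1)[unfolded E_def] that(2) bounded_decompositions_sum[OF that(3)]] .
qed

lemma lambda_min_bound:
  assumes "N \<noteq> {}" "stable_decomposition \<Omega> M e J s \<gamma> kst c\<^sub>0"
  shows "1 / (C * c\<^sub>0) \<le> lambda_min V (bpx.B \<circ> bpx.A)"
  unfolding lambda_min_def using eigenvalues(1,2,4)[OF assms(1)] assms(2) by (intro Min.boundedI) auto

text \<open>The stable decomposition enters twice: it bounds \<open>lambda_min\<close> from below
  and makes \<open>lambda_max\<close> positive, which the upper bound by \<open>c\<^sub>1\<close>
  presupposes.\<close>

lemma cond_number_bound:
  assumes N: "N \<noteq> {}" and st: "stable_decomposition \<Omega> M e J s \<gamma> kst c\<^sub>0"
    and bd: "bounded_decompositions \<Omega> M e J s \<gamma>t hp hj c\<^sub>1"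
  shows "cond_number V (bpx.B \<circ> bpx.A) \<le> C * c\<^sub>0 * c\<^sub>1"
proof -
  let ?E = "eigenvalues_on V (bpx.B \<circ> bpx.A)" and ?c = "C * c\<^sub>0"
  note E = eigenvalues[OF N]
  have c: "?c > 0" using E(3)[OF st] weights(3) by simp
  have "lambda_max V (bpx.B \<circ> bpx.A) \<in> ?E" unfolding lambda_max_def using E(1,2) by (rule Max_in)
  moreover from this have "1 / ?c \<le> lambda_max V (bpx.B \<circ> bpx.A)" using E(4)[OF st] by blast
  then have pos: "0 < lambda_max V (bpx.B \<circ> bpx.A)" using c by (meson divide_pos_pos less_le_trans zero_less_one)
  ultimately have max: "lambda_max V (bpx.B \<circ> bpx.A) \<le> c\<^sub>1" using E(5) bd by blast
  have "cond_number V (bpx.B \<circ> bpx.A) \<le> lambda_max V (bpx.B \<circ> bpx.A) / (1 / ?c)"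
    unfolding cond_number_def using lambda_min_bound[OF N st] pos c
    by (intro divide_left_mono mult_pos_pos) (auto intro: less_le_trans[of _ "1 / ?c"])
  also have "\<dots> \<le> ?c * c\<^sub>1" using mult_left_mono[OF max, of ?c] c by (simp add: mult.commute)
  finally show ?thesis by simp
qed

end

theorem theorem6p2:
  fixes \<Omega> :: "'a::euclidean_space set"
    and \<rho> :: "('a, 't) bisection_rule"
    and \<T>\<^sub>0 :: "('a, 't) lsimplex set"
    and kst :: nat
    and \<gamma> \<gamma>t size1 size2 m1 m2 :: real
  assumes "bounded_lipschitz_domain \<Omega>"
    and "admissible_rule \<rho>"
    and "conforming \<Omega> \<T>\<^sub>0"
    and "\<forall>\<tau>\<in>\<T>\<^sub>0. gen \<tau> = 0"
    and "0 < size1" and "\<forall>\<tau>\<in>\<T>\<^sub>0. size1 \<le> diameter (elem \<tau>) \<and> diameter (elem \<tau>) \<le> size2"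
    and "shape_regular (conforming_grids \<Omega> \<rho> \<T>\<^sub>0)"
    and "\<forall>k. conforming \<Omega> (uniform_refinement \<rho> \<T>\<^sub>0 k)"
    and "local_quasi_uniformity (conforming_grids \<Omega> \<rho> \<T>\<^sub>0) kst"
    and "\<gamma> = (1 / 2) powr (1 / real DIM('a))"
    and "0 < \<gamma>t" and "\<gamma>t < 1"
    and "0 < m1"
  shows "\<exists>C>0. \<forall>s::real. 0 < s \<and> s < 1 \<longrightarrow>
    (\<forall>\<T> \<in> conforming_grids \<Omega> \<rho> \<T>\<^sub>0. \<forall>J e hp hj.
       compatible_sequence \<rho> \<T>\<^sub>0 e J \<and> grid_seq \<rho> \<T>\<^sub>0 e J = \<T> \<and>
       local_mesh_sizes \<Omega> (grid_seq \<rho> \<T>\<^sub>0 e) e J \<gamma> m1 m2 hp hj \<longrightarrow>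
       (let M = grid_seq \<rho> \<T>\<^sub>0 e;
            V = fe_space \<Omega> \<T>;
            A = form_operator \<Omega> s V;
            B = bpx \<Omega> M e J s \<gamma>t hp hj;
            Bhat = bpx_hat \<Omega> M e J s \<gamma> kst
        in V = {v. \<exists>vp vj. decomposes \<Omega> M e J v vp vj} \<and>
           (\<forall>v\<in>V. l2_inner \<Omega> (Bhat v) v \<le> C * l2_inner \<Omega> (B v) v \<and>
                   l2_inner \<Omega> (B v) v \<le> C * l2_inner \<Omega> (Bhat v) v) \<and>
           (nodes \<Omega> \<T> \<noteq> {} \<longrightarrow>
             (\<forall>c\<^sub>0 c\<^sub>1.
               (stable_decomposition \<Omega> M e J s \<gamma> kst c\<^sub>0 \<longrightarrow>
                  lambda_min V (B \<circ> A) \<ge> 1 / (C * c\<^sub>0)) \<and>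
               (stable_decomposition \<Omega> M e J s \<gamma> kst c\<^sub>0 \<and>
                bounded_decompositions \<Omega> M e J s \<gamma>t hp hj c\<^sub>1 \<longrightarrow>
                  cond_number V (B \<circ> A) \<le> C * c\<^sub>0 * c\<^sub>1)))))"
proof -
  have \<gamma>: "0 < \<gamma>" "\<gamma> < 1"
    using assms(10) powr_less_mono2[of "1 / real DIM('a)" "1 / 2" 1] by auto
  have uniform: "conforming \<Omega> (uniform_refinement \<rho> \<T>\<^sub>0 k)" for k using assms(8) by blast
  show ?thesis
  \<comment> \<open>The witness depends on \<open>\<gamma>\<close>, \<open>\<gamma>t\<close>,
    \<open>kst\<close>, \<open>m1\<close> and \<open>m2\<close> only and is fixed before s, the grid
    and the bisection sequence.\<close>
  proof (intro exI[of _ "equivalence_constant \<gamma> \<gamma>t kst m1 m2"] conjI allI impI ballI)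
    show "0 < equivalence_constant \<gamma> \<gamma>t kst m1 m2" using equivalence_constant_pos \<gamma> assms(11-13) by blast
    fix s :: real and \<T> J e hp hj
    assume s: "0 < s \<and> s < 1" and H: "compatible_sequence \<rho> \<T>\<^sub>0 e J \<and> grid_seq \<rho> \<T>\<^sub>0 e J = \<T> \<and>
       local_mesh_sizes \<Omega> (grid_seq \<rho> \<T>\<^sub>0 e) e J \<gamma> m1 m2 hp hj"
    interpret bpx_setting \<Omega> \<rho> \<T>\<^sub>0 e J s \<gamma> \<gamma>t kst m1 m2 hp hj
      using assms(1,2,4,11-13) uniform \<gamma> s H by unfold_locales auto
    have \<T>: "\<T> = grid_seq \<rho> \<T>\<^sub>0 e J" using H by simp
    show "(let M = grid_seq \<rho> \<T>\<^sub>0 e;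
            V = fe_space \<Omega> \<T>;
            A = form_operator \<Omega> s V;
            B = bpx \<Omega> M e J s \<gamma>t hp hj;
            Bhat = bpx_hat \<Omega> M e J s \<gamma> kst
        in V = {v. \<exists>vp vj. decomposes \<Omega> M e J v vp vj} \<and>
           (\<forall>v\<in>V. l2_inner \<Omega> (Bhat v) v \<le> C * l2_inner \<Omega> (B v) v \<and>
                   l2_inner \<Omega> (B v) v \<le> C * l2_inner \<Omega> (Bhat v) v) \<and>
           (nodes \<Omega> \<T> \<noteq> {} \<longrightarrow>
             (\<forall>c\<^sub>0 c\<^sub>1.
               (stable_decomposition \<Omega> M e J s \<gamma> kst c\<^sub>0 \<longrightarrow>
                  lambda_min V (B \<circ> A) \<ge> 1 / (C * c\<^sub>0)) \<and>
               (stable_decomposition \<Omega> M e J s \<gamma> kst c\<^sub>0 \<and>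
                bounded_decompositions \<Omega> M e J s \<gamma>t hp hj c\<^sub>1 \<longrightarrow>
                  cond_number V (B \<circ> A) \<le> C * c\<^sub>0 * c\<^sub>1))))"
      unfolding Let_def \<T> bpx_eq bpx_hat_eq form_operator_eq
      using fe_space_decomposes spectral_equivalence lambda_min_bound cond_number_bound by blast
  qed
qed

end
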